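(* Let $D<-4$ be the discriminant of an imaginary quadratic field with $D\equiv0\pmod4$, and assume $D$ is not divisible by $3$. Let $N=|D|$, $\chi=\chi_D$, $h=h(D)$. If $D\equiv1\pmod3$, then $$h=\sum_{1\le x<\frac N6}\chi(x)\quad\text{and}\quad\sum_{\frac N6<x<\frac N4}\chi(x)=0.$$ If $D\equiv2\pmod3$, then $$\sum_{1\le x<\frac N6}\chi(x)=0\quad\text{and}\quad h=\sum_{\frac N6<x<\frac N4}\chi(x).$$
   Context: Here $D=4m$, where $m$ is a negative square-free integer with $m\equiv2$ or $3\pmod4$; $D$ is the discriminant of $K=\mathbb{Q}(\sqrt m)$, and $h(D)$ is the order of the ideal class group of $K$. The quadratic character $\chi_D:\mathbb{Z}\to\{0,1,-1\}$ modulo $N=|D|$ satisfies $\chi_D(x)=0$ if $\gcd(x,N)>1$, and for $\gcd(x,N)=1$: $\chi_D(x)=\chi_4(x)\left(\frac{x}{|m|}\right)$ if $m\equiv3\pmod4$; $\chi_D(x)=\chi_8(x)\left(\frac{x}{|n|}\right)$ if $m=2n$, $n\equiv1\pmod4$; $\chi_D(x)=\chi_4(x)\chi_8(x)\left(\frac{x}{|n|}\right)$ if $m=2n$, $n\equiv3\pmod4$. Here $\left(\frac{\cdot}{\cdot}\right)$ is the Jacobi symbol and, for odd $x$, $\chi_4(x)=(-1)^{(x-1)/2}$, $\chi_8(x)=(-1)^{(x^2-1)/8}$. Sums are over integers $x$ with $1\le x\le N$ and $\gcd(x,N)=1$ in the indicated ranges. *)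

theory Defs
  imports
    "HOL-Analysis.Analysis"
    "HOL-Algebra.Coset"
    "HOL-Computational_Algebra.Squarefree"
    "HOL-Number_Theory.Number_Theory"
begin

definition jacobi :: "int \<Rightarrow> int \<Rightarrow> int" where
  "jacobi a n = (\<Prod>p\<in>#prime_factorization n. Legendre a p)"

(* chi4 and chi8 are meant for odd arguments only; the quotient (x - 1) div 2 may be
   negative, and only its parity matters *)
definition chi4 :: "int \<Rightarrow> int" where
  "chi4 x = (-1) ^ nat \<bar>(x - 1) div 2\<bar>"

definition chi8 :: "int \<Rightarrow> int" where
  "chi8 x = (-1) ^ nat ((x\<^sup>2 - 1) div 8)"

(* The quadratic character chi_D for D = 4 m. The last branch covers m = 2 n with n = 3 (mod 4);
   the definition is only meaningful for square-free m with m = 2 or 3 (mod 4). *)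
definition quad_char :: "int \<Rightarrow> int \<Rightarrow> int" where
  "quad_char D x =
     (let m = D div 4; n = m div 2 in
      if \<not> coprime x \<bar>D\<bar> then 0
      else if m mod 4 = 3 then chi4 x * jacobi x \<bar>m\<bar>
      else if n mod 4 = 1 then chi8 x * jacobi x \<bar>n\<bar>
      else chi4 x * chi8 x * jacobi x \<bar>n\<bar>)"

definition quad_field :: "int \<Rightarrow> complex set" where
  "quad_field m = {of_rat a + of_rat b * csqrt (of_int m) | a b. True}"

text \<open>In the following, \<open>K\<close> is a number field, given as a subfield of the complex numbers.\<close>

definition ring_of_integers :: "complex set \<Rightarrow> complex set" where
  "ring_of_integers K = {x \<in> K. algebraic_int x}"

definition fractional_ideal :: "complex set \<Rightarrow> complex set \<Rightarrow> bool" where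
  "fractional_ideal K I \<longleftrightarrow>
     I \<subseteq> K \<and> 0 \<in> I \<and> I \<noteq> {0} \<and>
     (\<forall>x\<in>I. \<forall>y\<in>I. x + y \<in> I) \<and>
     (\<forall>r\<in>ring_of_integers K. \<forall>x\<in>I. r * x \<in> I) \<and>
     (\<exists>d\<in>ring_of_integers K. d \<noteq> 0 \<and> (\<forall>x\<in>I. d * x \<in> ring_of_integers K))"

definition ideal_mult :: "complex set \<Rightarrow> complex set \<Rightarrow> complex set" where
  "ideal_mult I J =
     {\<Sum>i<n. f i * g i | (n::nat) f g. \<forall>i<n. f i \<in> I \<and> g i \<in> J}"

definition fractional_ideal_group :: "complex set \<Rightarrow> complex set monoid" where
  "fractional_ideal_group K =
     \<lparr>carrier = {I. fractional_ideal K I}, mult = ideal_mult, one = ring_of_integers K\<rparr>"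

definition principal_fractional_ideals :: "complex set \<Rightarrow> complex set set" where
  "principal_fractional_ideals K = {(*) a ` ring_of_integers K | a. a \<in> K - {0}}"

definition ideal_class_group :: "complex set \<Rightarrow> complex set set monoid" where
  "ideal_class_group K = fractional_ideal_group K Mod principal_fractional_ideals K"

definition class_number :: "complex set \<Rightarrow> nat" where
  "class_number K = Coset.order (ideal_class_group K)"

end

theory Submission
  imports Defs
begin

text \<open>
  Write \<open>N = \<bar>D\<bar> = 4 \<bar>m\<bar>\<close>. The theorem follows from Dirichlet's class number formula
  \<open>N h = - (\<Sum>x<N. x \<chi>(x))\<close> (\<open>class_number_formula\<close>) by comparing finite character sums.

  \<^emph>\<open>From the formula to the theorem\<close> (\<open>third_and_quarter_sums_of_character\<close>). The character is odd and
  changes sign under \<open>x \<mapsto> x + N/2\<close>, hence it is symmetric about \<open>N/4\<close>, and the first moment collapses to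
  the sum over \<open>0 < x < N/4\<close>, which is therefore \<open>h\<close>. Replacing \<open>x\<close> by \<open>3 x\<close> in the first moment gives the
  sum over \<open>0 < x < N/3\<close> as \<open>(3 - \<chi>(3)) h / 2\<close>. By the symmetry about \<open>N/4\<close> the part between \<open>N/6\<close>
  and \<open>N/3\<close> is twice the part between \<open>N/6\<close> and \<open>N/4\<close>, so the two sums of the theorem solve a linear
  system, in which \<open>\<chi>(3) = 1\<close> for \<open>D\<close> congruent to 1 modulo 3 and \<open>\<chi>(3) = -1\<close> otherwise.

  \<^emph>\<open>The class number formula.\<close> It is obtained without evaluating \<open>L(1, \<chi>)\<close>, hence without Gauss sums,
  by comparing the constant terms of two expansions at \<open>t = 0\<close>. Let \<open>f\<close> run through one norm form for each
  ideal class and put \<open>\<Theta>(t) = (\<Sum>f. \<Sum>v. exp (- t f(v)))\<close>, where \<open>v\<close> runs through the pairs of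
  integers. The zero vectors contribute \<open>h\<close>. A nonzero vector \<open>v\<close> of a lattice \<open>L\<close> corresponds to the
  fractional ideal \<open>L/v\<close>, which contains 1; each fractional ideal containing 1 arises twice, from \<open>v\<close> and
  \<open>-v\<close>, because the only units are 1 and -1 (\<open>card_vectors\<close>). These ideals are counted by triples
  \<open>(k, A, B)\<close> with \<open>B\<^sup>2\<close> congruent to \<open>m\<close> modulo \<open>A\<close>, and counting square roots of \<open>m\<close> modulo \<open>A\<close> gives
  \<open>\<Sum>d dvd n. \<chi>(d)\<close> ideals of norm \<open>n\<close> (\<open>ideal_count_eq_divisor_chi\<close>). Consequently
  \<open>\<Theta>(t) = h + 2 Z(t)\<close> where \<open>Z(t) = (\<Sum>n. (\<Sum>d dvd n. \<chi>(d)) exp (- n t))\<close> (\<open>theta_eq\<close>).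

  As \<open>t\<close> tends to 0, every theta series is a multiple of \<open>1/t\<close> up to \<open>o(1)\<close>: its expansion has no constant
  term. The Lambert series \<open>Z\<close>, on the other hand, is a multiple of \<open>1/t\<close> plus the constant \<open>- L/2\<close>, where
  \<open>L\<close> is the mean value of the partial sums of \<open>\<chi>\<close>, that is \<open>- (\<Sum>x<N. x \<chi>(x)) / N\<close>. Hence \<open>h = L\<close>.
  The pole is removed beforehand: \<open>F(t) \<mapsto> 4 F(4 t) - F(t)\<close> annihilates multiples of \<open>1/t\<close>. For theta series
  this combination is a sum twisted by nontrivial sign characters, which tends to 0 because alternating sums
  of Gaussians are small (\<open>theta_no_constant_term\<close>); for \<open>Z\<close> it reduces to sums of \<open>\<chi>(d) / (exp (d t) + 1)\<close>,
  whose limit follows from two Abel summations (\<open>lambert_constant_term\<close>).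
\<close>

section \<open>The quadratic character\<close>

lemma Legendre_cong:
  assumes "[a = b] (mod p)"
  shows "Legendre a p = Legendre b p"
proof -
  have "[a = 0] (mod p) \<longleftrightarrow> [b = 0] (mod p)" using assms by (metis cong_sym cong_trans)
  moreover have "QuadRes p a \<longleftrightarrow> QuadRes p b"
    unfolding QuadRes_def using assms by (meson cong_sym cong_trans)
  ultimately show ?thesis by (simp add: Legendre_def)
qed

text \<open>Turns congruences such as Euler's criterion into equations between signs.\<close>
lemma sign_eq_of_cong:
  fixes a b p :: int
  assumes "[a = b] (mod p)" "p > 2" "\<bar>a\<bar> \<le> 1" "\<bar>b\<bar> \<le> 1"
  shows "a = b"
proof -
  have "p dvd a - b" using assms(1) by (simp add: cong_iff_dvd_diff)
  hence "a - b = 0 \<or> p \<le> \<bar>a - b\<bar>" using zdvd_imp_le[of p "\<bar>a - b\<bar>"] by auto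
  thus ?thesis using assms by auto
qed

lemma abs_Legendre_le_1: "\<bar>Legendre a p\<bar> \<le> 1"
  by (simp add: Legendre_def)

lemma prime_nat_of_int: "prime (p :: int) \<Longrightarrow> prime (nat p)"
  by (metis prime_int_nat_transfer)

lemma Legendre_mult:
  fixes p :: int
  assumes "prime p" "p > 2"
  shows "Legendre (a * b) p = Legendre a p * Legendre b p"
proof -
  define q where "q = nat p"
  have q: "prime q" "2 < q" "p = int q" using assms(2) prime_nat_of_int[OF assms(1)] unfolding q_def by simp_all
  have "[Legendre (a * b) p = (a * b) ^ ((q - 1) div 2)] (mod p)"
    using euler_criterion[of q "a * b"] q by simp
  moreover have "[Legendre a p * Legendre b p = a ^ ((q - 1) div 2) * b ^ ((q - 1) div 2)] (mod p)"
    using euler_criterion[of q a] euler_criterion[of q b] q by (simp add: cong_mult)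
  ultimately have "[Legendre (a * b) p = Legendre a p * Legendre b p] (mod p)"
    by (metis cong_sym cong_trans power_mult_distrib)
  moreover have "\<bar>Legendre a p * Legendre b p\<bar> \<le> 1"
    using abs_Legendre_le_1[of a p] abs_Legendre_le_1[of b p] by (simp add: abs_mult mult_le_one)
  ultimately show ?thesis using assms(2) abs_Legendre_le_1 sign_eq_of_cong by blast
qed

lemma Legendre_eq_0_iff: "Legendre a p = 0 \<longleftrightarrow> p dvd a"
  by (simp add: Legendre_def cong_0_iff)

lemma Legendre_1:
  assumes "p > (2 :: int)" shows "Legendre 1 p = 1"
proof -
  have "QuadRes p 1" unfolding QuadRes_def by (rule exI[of _ 1]) simp
  thus ?thesis using assms by (auto simp: Legendre_def cong_0_iff dest: zdvd_imp_le)
qed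

lemma chi4_odd:
  assumes "odd x"
  shows "chi4 x = (if x mod 4 = 1 then 1 else -1)"
proof -
  have "x mod 4 = 1 \<longleftrightarrow> even ((x - 1) div 2)" using assms by presburger
  thus ?thesis by (simp add: chi4_def even_nat_iff)
qed

lemma chi8_odd:
  assumes "odd x"
  shows "chi8 x = (if x mod 8 = 1 \<or> x mod 8 = 7 then 1 else -1)"
proof -
  define k where "k = x div 8"
  define r where "r = x mod 8"
  have x: "x = 8 * k + r" by (simp add: k_def r_def)
  have "r \<ge> 0" "r < 8" "odd r" using assms unfolding r_def by presburger+
  hence r: "r = 1 \<or> r = 3 \<or> r = 5 \<or> r = 7" by presburger
  have "x\<^sup>2 - 1 = 8 * (8 * k\<^sup>2 + 2 * k * r) + (r\<^sup>2 - 1)"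
    by (simp add: x power2_eq_square algebra_simps)
  hence "(x\<^sup>2 - 1) div 8 = 8 * k\<^sup>2 + 2 * k * r + (r\<^sup>2 - 1) div 8" by simp
  hence "even ((x\<^sup>2 - 1) div 8) \<longleftrightarrow> even ((r\<^sup>2 - 1) div 8)" by simp
  also have "\<dots> \<longleftrightarrow> r = 1 \<or> r = 7" using r by auto
  finally have e: "even ((x\<^sup>2 - 1) div 8) \<longleftrightarrow> r = 1 \<or> r = 7" .
  have "x \<noteq> 0" using assms by auto
  hence "x\<^sup>2 > 0" by simp
  hence "(x\<^sup>2 - 1) div 8 \<ge> 0" by (simp add: pos_imp_zdiv_nonneg_iff)
  thus ?thesis using e by (simp add: chi8_def even_nat_iff r_def)
qed

lemma chi4_mult:
  assumes "odd x" "odd y" shows "chi4 (x * y) = chi4 x * chi4 y"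
proof -
  define u v where "u = x mod 4" and "v = y mod 4"
  have "u = 1 \<or> u = 3" "v = 1 \<or> v = 3" unfolding u_def v_def using assms by presburger+
  moreover have "(x * y) mod 4 = (u * v) mod 4" by (simp add: mod_mult_eq u_def v_def)
  moreover have "odd (x * y)" using assms by simp
  ultimately show ?thesis unfolding chi4_odd[OF assms(1)] chi4_odd[OF assms(2)] u_def[symmetric] v_def[symmetric]
    by (elim disjE) (simp_all add: chi4_odd)
qed

lemma chi8_mult:
  assumes "odd x" "odd y" shows "chi8 (x * y) = chi8 x * chi8 y"
proof -
  define u v where "u = x mod 8" and "v = y mod 8"
  have "u = 1 \<or> u = 3 \<or> u = 5 \<or> u = 7" "v = 1 \<or> v = 3 \<or> v = 5 \<or> v = 7"
    unfolding u_def v_def using assms by presburger+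
  moreover have "(x * y) mod 8 = (u * v) mod 8" by (simp add: mod_mult_eq u_def v_def)
  moreover have "odd (x * y)" using assms by simp
  ultimately show ?thesis unfolding chi8_odd[OF assms(1)] chi8_odd[OF assms(2)] u_def[symmetric] v_def[symmetric]
    by (elim disjE) (simp_all add: chi8_odd)
qed

lemma chi4_shift:
  assumes "odd x"
  shows "chi4 (x + 4 * k) = chi4 x" and "odd k \<Longrightarrow> chi4 (x + 2 * k) = - chi4 x"
proof -
  have "odd (x + 4 * k)" "odd (x + 2 * k)" using assms by auto
  note * = this[THEN chi4_odd] chi4_odd[OF assms]
  show "chi4 (x + 4 * k) = chi4 x" by (simp add: *)
  assume "odd k"
  hence "(x + 2 * k) mod 4 = 1 \<longleftrightarrow> x mod 4 \<noteq> 1" using assms by presburger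
  thus "chi4 (x + 2 * k) = - chi4 x" by (simp add: *)
qed

lemma chi8_shift:
  assumes "odd x" "odd k"
  shows "chi8 (x + 4 * k) = - chi8 x"
proof -
  have "odd (x + 4 * k)" using assms by auto
  note * = this[THEN chi8_odd] chi8_odd[OF assms(1)]
  have "(x + 4 * k) mod 8 = 1 \<or> (x + 4 * k) mod 8 = 7 \<longleftrightarrow> \<not> (x mod 8 = 1 \<or> x mod 8 = 7)"
    using assms by presburger
  thus ?thesis by (simp add: *)
qed

lemma Legendre_minus_one:
  fixes p :: int
  assumes "prime p" "p > 2"
  shows "Legendre (-1) p = chi4 p"
proof -
  define q where "q = nat p"
  have q: "prime q" "2 < q" "p = int q" using assms(2) prime_nat_of_int[OF assms(1)] unfolding q_def by simp_all
  have "[Legendre (-1) p = (-1) ^ ((q - 1) div 2)] (mod p)"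
    using euler_criterion[of q "-1"] q by simp
  moreover have "nat \<bar>(p - 1) div 2\<bar> = (q - 1) div 2"
    using q by linarith
  ultimately have "[Legendre (-1) p = chi4 p] (mod p)" by (simp add: chi4_def)
  thus ?thesis using assms(2) abs_Legendre_le_1 by (rule sign_eq_of_cong) (auto simp: chi4_def abs_if)
qed

text \<open>By Gauss's lemma \<open>(2/p)\<close> is \<open>-1\<close> to the number of even integers between \<open>p/2\<close> and \<open>p\<close>, whose
  parity depends only on \<open>p\<close> modulo 8.\<close>
lemma Legendre_two:
  fixes p :: int
  assumes "prime p" "p > 2"
  shows "Legendre 2 p = chi8 p"
proof -
  define q where "q = nat p"
  have q: "prime q" "2 < q" "p = int q" using assms(2) prime_nat_of_int[OF assms(1)] unfolding q_def by simp_all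
  have nd: "\<not> p dvd 2" using assms zdvd_imp_le[of p 2] by auto
  interpret GAUSS q 2
    by unfold_locales (use q nd in \<open>auto simp: cong_0_iff\<close>)
  define h where "h = (p - 1) div 2"
  have ph: "p = 2 * h + 1" using p_eq2 q by (simp add: h_def)
  have h: "h > 0" using ph assms by linarith
  have C: "C = (\<lambda>x. 2 * x) ` {0<..h}"
  proof -
    have "(x * 2) mod p = 2 * x" if "x \<in> {0<..h}" for x
      using that ph by (intro mod_pos_pos_trivial[THEN trans]) auto
    thus ?thesis unfolding C_def B_def A_def image_image
      by (intro image_cong) (auto simp: q(3)[symmetric] h_def)
  qed
  have E: "E = (\<lambda>x. 2 * x) ` {h div 2<..h}"
    unfolding E_def C q(3)[symmetric] h_def[symmetric] using h by auto
  have "card E = nat (h - h div 2)"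
    unfolding E by (subst card_image) (auto simp: inj_on_def)
  moreover have "h - h div 2 \<ge> 0" using h by linarith
  moreover have "even (h - h div 2) \<longleftrightarrow> p mod 8 = 1 \<or> p mod 8 = 7" using ph by presburger
  moreover have "odd p" using ph by simp
  ultimately show ?thesis using gauss_lemma q by (simp add: chi8_odd even_nat_iff)
qed

lemma jacobi_cong:
  assumes "[a = b] (mod n)"
  shows "jacobi a n = jacobi b n"
  unfolding jacobi_def
proof (rule arg_cong[where f = prod_mset], rule image_mset_cong)
  fix p assume "p \<in># prime_factorization n"
  hence "p dvd n" by auto
  thus "Legendre a p = Legendre b p" using assms by (intro Legendre_cong) (metis cong_dvd_modulus)
qed

lemma odd_prime_factor_gt_2:
  fixes n :: int
  assumes "odd n" "p \<in># prime_factorization n"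
  shows "prime p" "p > 2" "odd p"
proof -
  show "prime p" using assms by auto
  have "p dvd n" using assms by auto
  thus "odd p" using assms by (auto dest: dvd_trans)
  with prime_ge_2_int[OF \<open>prime p\<close>] show "p > 2" by (cases "p = 2") auto
qed

lemma jacobi_mult:
  assumes "odd n"
  shows "jacobi (a * b) n = jacobi a n * jacobi b n"
  unfolding jacobi_def prod_mset.distrib[symmetric]
  by (rule arg_cong[where f = prod_mset], rule image_mset_cong)
     (use odd_prime_factor_gt_2[OF assms] Legendre_mult in blast)

lemma abs_jacobi_le_1: "\<bar>jacobi a n\<bar> \<le> 1"
proof -
  have "\<bar>\<Prod>p\<in>#A. Legendre a p\<bar> \<le> 1" for A
    by (induction A) (auto simp: abs_mult abs_Legendre_le_1 mult_le_one)
  thus ?thesis by (simp add: jacobi_def)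
qed

lemma jacobi_1: "odd n \<Longrightarrow> jacobi 1 n = 1"
proof -
  assume "odd n"
  hence "image_mset (Legendre 1) (prime_factorization n) = image_mset (\<lambda>_. 1) (prime_factorization n)"
    by (intro image_mset_cong) (auto dest: odd_prime_factor_gt_2 simp: Legendre_1)
  thus ?thesis by (simp add: jacobi_def)
qed

lemma jacobi_minus_one:
  assumes "odd n" "n > 0"
  shows "jacobi (-1) n = chi4 n"
proof -
  have "(\<Prod>p\<in>#A. Legendre (-1) p) = chi4 (prod_mset A) \<and> odd (prod_mset A)"
    if "\<And>p. p \<in># A \<Longrightarrow> prime p \<and> p > 2 \<and> odd p" for A
    using that
  proof (induction A)
    case empty
    show ?case by (simp add: chi4_def)
  next
    case (add x A)
    thus ?case by (auto simp: Legendre_minus_one chi4_mult)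
  qed
  from this[of "prime_factorization n"] show ?thesis
    using assms odd_prime_factor_gt_2[OF assms(1)]
    by (auto simp: jacobi_def prod_mset_prime_factorization_int)
qed

text \<open>Quadratic reciprocity is applied to one prime factor of \<open>n\<close> at a time. If \<open>p\<close> is 3 modulo 4 then a
  factor \<open>q\<close> contributes the sign \<open>chi4 q\<close>, and these signs multiply to \<open>chi4 n\<close>.\<close>
lemma jacobi_reciprocity:
  fixes p n :: int
  assumes p: "prime p" "p > 2" and n: "odd n" "n > 0" and np: "\<not> p dvd n"
  shows "jacobi p n = Legendre n p * (if p mod 4 = 1 then 1 else chi4 n)"
proof -
  have oddp: "odd p" using p prime_odd_int by blast
  have *: "(\<Prod>q\<in>#A. Legendre p q) = Legendre (prod_mset A) p * (if p mod 4 = 1 then 1 else chi4 (prod_mset A))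
      \<and> odd (prod_mset A)"
    if "\<And>q. q \<in># A \<Longrightarrow> prime q \<and> q > 2 \<and> odd q \<and> q \<noteq> p" for A
    using that
  proof (induction A)
    case empty
    show ?case using p by (simp add: chi4_def Legendre_1)
  next
    case (add q A)
    have q: "prime q" "q > 2" "odd q" "q \<noteq> p" using add.prems by auto
    have "Legendre p q * Legendre q p = (-1) ^ nat ((p - 1) div 2 * ((q - 1) div 2))"
      using Quadratic_Reciprocity_int[of p q] p q prime_nat_of_int by blast
    also have "\<dots> = (if p mod 4 = 1 then 1 else chi4 q)"
    proof -
      have "p mod 4 = 1 \<longleftrightarrow> even ((p - 1) div 2)" "q mod 4 = 1 \<longleftrightarrow> even ((q - 1) div 2)"
        using oddp q by presburger+
      moreover have "(p - 1) div 2 * ((q - 1) div 2) \<ge> 0" using p q by auto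
      ultimately show ?thesis using q by (auto simp: chi4_odd even_nat_iff)
    qed
    finally have "Legendre p q * Legendre q p = (if p mod 4 = 1 then 1 else chi4 q)" .
    moreover have "Legendre q p = 1 \<or> Legendre q p = -1"
      using p q primes_dvd_imp_eq[of p q] Legendre_eq_0_iff[of q p] by (auto simp: Legendre_def)
    ultimately have L: "Legendre p q = Legendre q p * (if p mod 4 = 1 then 1 else chi4 q)" by auto
    define P where "P = prod_mset A"
    have IH: "(\<Prod>q\<in>#A. Legendre p q) = Legendre P p * (if p mod 4 = 1 then 1 else chi4 P)" "odd P"
      using add.IH add.prems unfolding P_def by auto
    have "Legendre (q * P) p = Legendre q p * Legendre P p" "chi4 (q * P) = chi4 q * chi4 P"
      using p q IH(2) by (simp_all add: Legendre_mult chi4_mult)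
    thus ?case using IH q(3) L by (simp add: P_def[symmetric])
  qed
  have "q \<noteq> p" if "q \<in># prime_factorization n" for q
    using that np by auto
  with *[of "prime_factorization n"] show ?thesis
    using n odd_prime_factor_gt_2[OF n(1)]
    by (auto simp: jacobi_def prod_mset_prime_factorization_int)
qed

text \<open>These are the radicands for which \<open>4 m\<close> is the discriminant of an imaginary quadratic field whose only
  units are 1 and -1.\<close>
locale imag_quadratic =
  fixes m :: int
  assumes m_less: "m < -1" and squarefree_m: "squarefree m" and m_mod4: "m mod 4 = 2 \<or> m mod 4 = 3"
begin

definition "chi = quad_char (4 * m)"

lemma coprime_iff: "coprime x (4 * \<bar>m\<bar>) \<longleftrightarrow> odd x \<and> coprime x m"
proof -
  have "coprime x (4 * \<bar>m\<bar>) \<longleftrightarrow> coprime x (2\<^sup>2) \<and> coprime x m" by (simp add: coprime_mult_right_iff)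
  also have "coprime x (2\<^sup>2) \<longleftrightarrow> odd x"
    by (simp only: coprime_power_right_iff coprime_right_2_iff_odd) simp
  finally show ?thesis .
qed

text \<open>The residue of the modulus of the Jacobi symbol modulo 4 decides every sign below, so each shape of the
  character is recorded together with it.\<close>
lemma m_cases:
  obtains (odd) "m mod 4 = 3" "odd m" "\<bar>m\<bar> mod 4 = 1"
      "\<And>x. chi x = (if coprime x (4 * \<bar>m\<bar>) then chi4 x * jacobi x \<bar>m\<bar> else 0)"
  | (even1) n where "m = 2 * n" "n mod 4 = 1" "odd n" "\<bar>n\<bar> mod 4 = 3" "n < 0"
      "\<And>x. chi x = (if coprime x (4 * \<bar>m\<bar>) then chi8 x * jacobi x \<bar>n\<bar> else 0)"
  | (even3) n where "m = 2 * n" "n mod 4 = 3" "odd n" "\<bar>n\<bar> mod 4 = 1" "n < 0"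
      "\<And>x. chi x = (if coprime x (4 * \<bar>m\<bar>) then chi4 x * chi8 x * jacobi x \<bar>n\<bar> else 0)"
proof -
  define n where "n = m div 2"
  have D: "(4 * m) div 4 = m" "\<bar>4 * m\<bar> = 4 * \<bar>m\<bar>" by auto
  have neg: "\<bar>m\<bar> = - m" using m_less by simp
  show ?thesis
  proof (cases "m mod 4 = 3")
    case True
    have "odd m" "\<bar>m\<bar> mod 4 = 1" using True unfolding neg by presburger+
    moreover have "chi x = (if coprime x (4 * \<bar>m\<bar>) then chi4 x * jacobi x \<bar>m\<bar> else 0)" for x
      unfolding chi_def quad_char_def D Let_def using True by simp
    ultimately show ?thesis by (intro odd True)
  next
    case False
    hence m: "m = 2 * n" "odd n" using m_mod4 unfolding n_def by presburger+
    have n: "n < 0" "\<bar>n\<bar> = - n" using m(1) m_less by linarith+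
    show ?thesis
    proof (cases "n mod 4 = 1")
      case True
      have "\<bar>n\<bar> mod 4 = 3" using True unfolding n by presburger
      moreover have "chi x = (if coprime x (4 * \<bar>m\<bar>) then chi8 x * jacobi x \<bar>n\<bar> else 0)" for x
        unfolding chi_def quad_char_def D Let_def n_def[symmetric] using True False by simp
      ultimately show ?thesis by (intro even1[of n] True m n(1))
    next
      case n1: False
      hence n3: "n mod 4 = 3" using m(2) by presburger
      have "\<bar>n\<bar> mod 4 = 1" using n3 unfolding n by presburger
      moreover have "chi x = (if coprime x (4 * \<bar>m\<bar>) then chi4 x * chi8 x * jacobi x \<bar>n\<bar> else 0)" for x
        unfolding chi_def quad_char_def D Let_def n_def[symmetric] using n1 False by simp
      ultimately show ?thesis by (intro even3[of n] n3 m n(1))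
    qed
  qed
qed

lemma chi_eq_0: "\<not> coprime x (4 * \<bar>m\<bar>) \<Longrightarrow> chi x = 0"
  by (cases rule: m_cases) auto

lemma abs_chi_le_1: "\<bar>chi x\<bar> \<le> 1"
proof -
  have "\<bar>chi4 x\<bar> = 1" "\<bar>chi8 x\<bar> = 1" by (simp_all add: chi4_def chi8_def power_abs)
  thus ?thesis by (cases rule: m_cases) (auto simp: abs_mult abs_jacobi_le_1)
qed

lemma chi_mult: "chi (x * y) = chi x * chi y"
proof (cases "coprime (x * y) (4 * \<bar>m\<bar>)")
  case True
  hence xy: "coprime x (4 * \<bar>m\<bar>)" "coprime y (4 * \<bar>m\<bar>)" by (auto simp: coprime_mult_left_iff)
  hence "odd x" "odd y" using coprime_iff by blast+
  show ?thesis
    by (cases rule: m_cases)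
      (use True xy \<open>odd x\<close> \<open>odd y\<close> in \<open>simp_all add: chi4_mult chi8_mult jacobi_mult\<close>)
next
  case False
  hence "chi x = 0 \<or> chi y = 0" using chi_eq_0 by (auto simp: coprime_mult_left_iff)
  thus ?thesis using chi_eq_0[OF False] by auto
qed

lemma chi_1: "chi 1 = 1"
  by (cases rule: m_cases) (simp_all add: jacobi_1 chi4_def chi8_def)

lemma chi_minus: "chi (-x) = - chi x"
proof -
  have c: "coprime (-1) (4 * \<bar>m\<bar>)" by simp
  have "chi (-1) = -1"
  proof (cases rule: m_cases)
    case odd
    have "chi4 \<bar>m\<bar> = 1" using odd by (subst chi4_odd) auto
    thus ?thesis using odd c m_less by (simp add: jacobi_minus_one chi4_odd)
  next
    case (even1 n)
    have "chi4 \<bar>n\<bar> = -1" using even1 by (subst chi4_odd) auto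
    thus ?thesis using even1 c m_less by (simp add: jacobi_minus_one chi8_odd)
  next
    case (even3 n)
    have "chi4 \<bar>n\<bar> = 1" using even3 by (subst chi4_odd) auto
    thus ?thesis using even3 c m_less by (simp add: jacobi_minus_one chi4_odd chi8_odd)
  qed
  thus ?thesis using chi_mult[of "-1" x] by simp
qed

text \<open>Half a period is an odd multiple of 2 or 4 and a multiple of the modulus of the Jacobi symbol. In the
  first shape of the character it flips \<open>chi4\<close>, in the other two it flips \<open>chi8\<close> alone.\<close>
lemma chi_half_period: "chi (x + 2 * \<bar>m\<bar>) = - chi x"
proof -
  have cop: "coprime (x + 2 * \<bar>m\<bar>) (4 * \<bar>m\<bar>) \<longleftrightarrow> coprime x (4 * \<bar>m\<bar>)"
  proof -
    have "gcd (x + 2 * \<bar>m\<bar>) \<bar>m\<bar> = gcd x \<bar>m\<bar>"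
      using gcd_add_mult[of "\<bar>m\<bar>" 2 x] by (simp add: gcd.commute add.commute)
    thus ?thesis unfolding coprime_iff by (simp add: coprime_iff_gcd_eq_1)
  qed
  show ?thesis
  proof (cases "coprime x (4 * \<bar>m\<bar>)")
    case True
    hence "odd x" using coprime_iff by blast
    show ?thesis
    proof (cases rule: m_cases)
      case odd
      have "chi4 (x + 2 * \<bar>m\<bar>) = - chi4 x"
        using chi4_shift(2)[OF \<open>odd x\<close>, of "\<bar>m\<bar>"] odd(2) by simp
      moreover have "jacobi (x + 2 * \<bar>m\<bar>) \<bar>m\<bar> = jacobi x \<bar>m\<bar>"
        by (rule jacobi_cong) (simp add: cong_iff_dvd_diff)
      ultimately show ?thesis using True cop odd(4) by simp
    next
      case (even1 n)
      have m: "2 * \<bar>m\<bar> = 4 * \<bar>n\<bar>" using even1(1) by simp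
      have "chi8 (x + 2 * \<bar>m\<bar>) = - chi8 x"
        using chi8_shift[OF \<open>odd x\<close>, of "\<bar>n\<bar>"] even1(3) unfolding m by simp
      moreover have "jacobi (x + 2 * \<bar>m\<bar>) \<bar>n\<bar> = jacobi x \<bar>n\<bar>"
        unfolding m by (rule jacobi_cong) (simp add: cong_iff_dvd_diff)
      ultimately show ?thesis using True cop even1(6) by simp
    next
      case (even3 n)
      have m: "2 * \<bar>m\<bar> = 4 * \<bar>n\<bar>" using even3(1) by simp
      have "chi8 (x + 2 * \<bar>m\<bar>) = - chi8 x"
        using chi8_shift[OF \<open>odd x\<close>, of "\<bar>n\<bar>"] even3(3) unfolding m by simp
      moreover have "chi4 (x + 2 * \<bar>m\<bar>) = chi4 x"
        using chi4_shift(1)[OF \<open>odd x\<close>, of "\<bar>n\<bar>"] unfolding m by simp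
      moreover have "jacobi (x + 2 * \<bar>m\<bar>) \<bar>n\<bar> = jacobi x \<bar>n\<bar>"
        unfolding m by (rule jacobi_cong) (simp add: cong_iff_dvd_diff)
      ultimately show ?thesis using True cop even3(6) by simp
    qed
  qed (use cop chi_eq_0 in auto)
qed

text \<open>Reciprocity exchanges \<open>p\<close> and the odd part of \<open>m\<close>; the sign of \<open>m\<close> and a possible factor 2 account for
  \<open>chi4\<close> and \<open>chi8\<close>.\<close>
lemma chi_prime:
  assumes p: "prime p" "p > 2" "\<not> p dvd m"
  shows "chi p = Legendre m p"
proof -
  have odd_p: "odd p" using p prime_odd_int by blast
  have "coprime p m" using p by (intro prime_imp_coprime) auto
  hence cop: "coprime p (4 * \<bar>m\<bar>)" using odd_p coprime_iff by blast
  have L: "Legendre (- a) p = chi4 p * Legendre a p" for a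
    using Legendre_mult[OF p(1,2), of "-1" a] Legendre_minus_one[OF p(1,2)] by simp
  have sq: "chi4 p * chi4 p = 1" by (simp add: chi4_def power_mult_distrib[symmetric])
  show ?thesis
  proof (cases rule: m_cases)
    case odd
    have "jacobi p \<bar>m\<bar> = Legendre \<bar>m\<bar> p"
      using jacobi_reciprocity[of p "\<bar>m\<bar>"] p odd m_less by (simp add: chi4_odd)
    thus ?thesis using odd cop L[of "\<bar>m\<bar>"] m_less by simp
  next
    case (even1 n)
    have np: "\<not> p dvd \<bar>n\<bar>" using p(3) even1(1) by auto
    have "chi4 \<bar>n\<bar> = -1" using even1 by (subst chi4_odd) auto
    hence "jacobi p \<bar>n\<bar> = Legendre \<bar>n\<bar> p * chi4 p"
      using jacobi_reciprocity[of p "\<bar>n\<bar>"] p(1,2) np even1(1-5) odd_p by (auto simp: chi4_odd[of p])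
    moreover have "Legendre m p = chi4 p * (chi8 p * Legendre \<bar>n\<bar> p)"
      using L[of "2 * \<bar>n\<bar>"] even1 Legendre_mult[OF p(1,2), of 2 "\<bar>n\<bar>"] Legendre_two[OF p(1,2)] by simp
    ultimately show ?thesis using even1 cop by simp
  next
    case (even3 n)
    have np: "\<not> p dvd \<bar>n\<bar>" using p(3) even3(1) by auto
    have "chi4 \<bar>n\<bar> = 1" using even3 by (subst chi4_odd) auto
    hence "jacobi p \<bar>n\<bar> = Legendre \<bar>n\<bar> p"
      using jacobi_reciprocity[of p "\<bar>n\<bar>"] p(1,2) np even3(1-5) odd_p by auto
    moreover have "Legendre m p = chi4 p * (chi8 p * Legendre \<bar>n\<bar> p)"
      using L[of "2 * \<bar>n\<bar>"] even3 Legendre_mult[OF p(1,2), of 2 "\<bar>n\<bar>"] Legendre_two[OF p(1,2)] by simp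
    ultimately show ?thesis using even3 cop by simp
  qed
qed

lemma chi_prime_dvd:
  assumes p: "prime p" "p dvd 2 * m"
  shows "chi p = 0"
proof (rule chi_eq_0)
  have "p dvd 2 * (2 * m)" by (rule dvd_mult[OF p(2)])
  hence "p dvd 4 * \<bar>m\<bar>" using abs_dvd_iff[of p] dvd_abs_iff[of p "4 * m"] by (simp add: abs_mult)
  thus "\<not> coprime p (4 * \<bar>m\<bar>)" using p(1) not_coprimeI[of p p "4 * \<bar>m\<bar>"] not_prime_unit by auto
qed

lemma chi_3:
  assumes "\<not> 3 dvd m"
  shows "chi 3 = (if m mod 3 = 1 then 1 else -1)"
proof -
  have m3: "m mod 3 = 1 \<or> m mod 3 = 2" using assms by presburger
  have "prime (3 :: int)" by simp
  hence "chi 3 = Legendre m 3" using assms by (intro chi_prime) auto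
  also have "\<dots> = (if m mod 3 = 1 then 1 else -1)"
  proof (cases "m mod 3 = 1")
    case True
    have "QuadRes 3 m" unfolding QuadRes_def by (rule exI[of _ 1]) (simp add: cong_def True)
    thus ?thesis using True by (simp add: Legendre_def cong_def)
  next
    case False
    have "\<not> QuadRes 3 m"
    proof
      assume "QuadRes 3 m"
      then obtain y where y: "y\<^sup>2 mod 3 = m mod 3" by (auto simp: QuadRes_def cong_def)
      have "y mod 3 = 0 \<or> y mod 3 = 1 \<or> y mod 3 = 2" by presburger
      moreover have "y\<^sup>2 mod 3 = (y mod 3)\<^sup>2 mod 3" by (simp add: power_mod)
      ultimately have "y\<^sup>2 mod 3 = 0 \<or> y\<^sup>2 mod 3 = 1" by auto
      with y m3 False show False by auto
    qed
    thus ?thesis using False m3 by (auto simp: Legendre_def cong_def)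
  qed
  finally show ?thesis .
qed

end

section \<open>Counting square roots of m modulo A\<close>

lemma square_mod_4: "x\<^sup>2 mod 4 = (if even x then 0 else 1)" for x :: int
proof (cases "even x")
  case True thus ?thesis by (auto elim!: evenE simp: power2_eq_square)
next
  case False
  then obtain c where "x = 2 * c + 1" by (elim oddE)
  hence "x\<^sup>2 = 4 * (c\<^sup>2 + c) + 1" by (simp add: power2_eq_square algebra_simps)
  thus ?thesis using False by (simp del: distrib_left_numeral)
qed

lemma bij_betw_coprime_divisors:
  fixes a b :: nat
  assumes "coprime a b"
  shows "bij_betw (\<lambda>(x, y). x * y) ({d. d dvd a} \<times> {d. d dvd b}) {d. d dvd a * b}"
proof (rule bij_betwI')
  fix u v assume "u \<in> {d. d dvd a} \<times> {d. d dvd b}" "v \<in> {d. d dvd a} \<times> {d. d dvd b}"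
  then obtain x y x' y' where uv: "u = (x, y)" "v = (x', y')" "x dvd a" "y dvd b" "x' dvd a" "y' dvd b"
    by auto
  have c: "coprime x y'" "coprime y x'" "coprime x' y" "coprime y' x"
    using coprime_divisors[OF _ _ assms] uv by (auto simp: coprime_commute)
  have "x = x' \<and> y = y'" if "x * y = x' * y'"
    by (meson c coprime_crossproduct_nat that coprime_commute)
  thus "((case u of (x, y) \<Rightarrow> x * y) = (case v of (x, y) \<Rightarrow> x * y)) \<longleftrightarrow> u = v" using uv by auto
next
  fix d assume "d \<in> {d. d dvd a * b}"
  thus "\<exists>u\<in>{d. d dvd a} \<times> {d. d dvd b}. d = (case u of (x, y) \<Rightarrow> x * y)"
    using division_decomp[of d a b] by auto
qed (auto intro: mult_dvd_mono)

lemma square_dvd_coprime_mult_iff: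
  fixes a b :: nat
  assumes "coprime a b" "x dvd a" "y dvd b"
  shows "(x * y)\<^sup>2 dvd a * b \<longleftrightarrow> x\<^sup>2 dvd a \<and> y\<^sup>2 dvd b"
proof
  assume h: "(x * y)\<^sup>2 dvd a * b"
  have "coprime x b" "coprime a y"
    using coprime_divisors[OF assms(2) dvd_refl assms(1)] coprime_divisors[OF dvd_refl assms(3) assms(1)] by auto
  hence "coprime (x\<^sup>2) b" "coprime (y\<^sup>2) a" by (auto simp: coprime_commute)
  moreover have "x\<^sup>2 dvd a * b" "y\<^sup>2 dvd b * a"
    using h dvd_mult_left[of "x\<^sup>2" "y\<^sup>2"] dvd_mult_right[of "x\<^sup>2" "y\<^sup>2"]
    by (auto simp: power_mult_distrib mult.commute)
  ultimately show "x\<^sup>2 dvd a \<and> y\<^sup>2 dvd b" by (simp add: coprime_dvd_mult_left_iff)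
qed (auto simp: power_mult_distrib intro: mult_dvd_mono)

context imag_quadratic
begin

text \<open>These residues parametrise the ideals of norm \<open>A\<close> that are not divisible by an integer greater than 1.\<close>
definition sqrt_residues :: "nat \<Rightarrow> int set" where
  "sqrt_residues A = {B. 0 \<le> B \<and> B < int A \<and> int A dvd B\<^sup>2 - m}"

lemma finite_sqrt_residues [simp]: "finite (sqrt_residues A)"
  by (rule finite_subset[of _ "{0..int A}"]) (auto simp: sqrt_residues_def)

lemma mod_in_sqrt_residues:
  assumes "A > 0" shows "B mod int A \<in> sqrt_residues A \<longleftrightarrow> int A dvd B\<^sup>2 - m"
proof -
  have "[(B mod int A)\<^sup>2 - m = B\<^sup>2 - m] (mod int A)"
    by (intro cong_diff cong_pow) (auto simp: cong_def)
  thus ?thesis using assms cong_dvd_iff unfolding sqrt_residues_def by auto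
qed

lemma card_sqrt_residues_mult:
  assumes "coprime a b" "a > 0" "b > 0"
  shows "card (sqrt_residues (a * b)) = card (sqrt_residues a) * card (sqrt_residues b)"
proof -
  have cop: "coprime (int a) (int b)" using assms by simp
  have "bij_betw (\<lambda>B. (B mod int a, B mod int b)) (sqrt_residues (a * b)) (sqrt_residues a \<times> sqrt_residues b)"
  proof (rule bij_betwI')
    fix x y assume xy: "x \<in> sqrt_residues (a * b)" "y \<in> sqrt_residues (a * b)"
    have "x = y" if "x mod int a = y mod int a" "x mod int b = y mod int b"
    proof -
      have "[x = y] (mod (int a * int b))"
        using that cop by (intro coprime_cong_mult) (auto simp: cong_def)
      thus "x = y" using xy by (simp add: sqrt_residues_def cong_def)
    qed
    thus "((x mod int a, x mod int b) = (y mod int a, y mod int b)) = (x = y)" by auto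
  next
    fix x assume "x \<in> sqrt_residues (a * b)"
    hence "int a * int b dvd x\<^sup>2 - m" by (simp add: sqrt_residues_def)
    hence "int a dvd x\<^sup>2 - m" "int b dvd x\<^sup>2 - m" using dvd_mult_left dvd_mult_right by blast+
    thus "(x mod int a, x mod int b) \<in> sqrt_residues a \<times> sqrt_residues b"
      using assms by (simp add: mod_in_sqrt_residues)
  next
    fix u assume "u \<in> sqrt_residues a \<times> sqrt_residues b"
    then obtain x y where u: "u = (x, y)" "x \<in> sqrt_residues a" "y \<in> sqrt_residues b" by auto
    obtain z where z: "[z = x] (mod int a)" "[z = y] (mod int b)"
      using binary_chinese_remainder_int[OF cop] by blast
    define w where "w = z mod int (a * b)"
    have w: "w mod int a = x" "w mod int b = y"
      using u z by (auto simp: w_def sqrt_residues_def cong_def mod_mod_cancel)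
    have "int a dvd w\<^sup>2 - m" "int b dvd w\<^sup>2 - m"
      using u assms mod_in_sqrt_residues[of a w] mod_in_sqrt_residues[of b w] w by auto
    hence "int a * int b dvd w\<^sup>2 - m" using cop by (simp add: divides_mult)
    moreover have "0 \<le> w" "w < int (a * b)" using assms by (auto simp: w_def simp del: of_nat_mult)
    ultimately have "w \<in> sqrt_residues (a * b)" by (simp add: sqrt_residues_def)
    thus "\<exists>x\<in>sqrt_residues (a * b). u = (x mod int a, x mod int b)" using w u by blast
  qed
  thus ?thesis using bij_betw_same_card by (fastforce simp: card_cartesian_product)
qed

lemma sqrt_residues_1: "sqrt_residues 1 = {0}"
  by (auto simp: sqrt_residues_def)

text \<open>Modulo \<open>p\<close> the only root is 0 or 1, and no root exists modulo \<open>p\<^sup>2\<close>: for \<open>p\<close> dividing \<open>m\<close> because \<open>m\<close> is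
  square-free, and for \<open>p = 2\<close> and odd \<open>m\<close> because \<open>m\<close> is 3 modulo 4.\<close>
lemma card_sqrt_residues_ramified:
  fixes p :: nat
  assumes p: "prime p" "int p dvd 2 * m"
  shows "card (sqrt_residues (p ^ j)) = (if j \<le> 1 then 1 else 0)"
proof -
  consider "j = 0" | "j = 1" | "j \<ge> 2" by linarith
  thus ?thesis
  proof cases
    case 1
    thus ?thesis by (simp add: sqrt_residues_1[simplified])
  next
    case 2
    have ip: "prime (int p)" using p by simp
    have "sqrt_residues p = {if int p dvd m then 0 else 1}"
    proof (cases "int p dvd m")
      case True
      have "int p dvd B\<^sup>2 - m \<longleftrightarrow> int p dvd B" for B
        using dvd_add_left_iff[OF True, of "B\<^sup>2 - m"] ip by (simp add: prime_dvd_power_iff)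
      hence "B \<in> sqrt_residues p \<longleftrightarrow> B = 0" for B
        using prime_gt_0_nat[OF p(1)] zdvd_imp_le[of "int p" B]
        by (cases "B = 0") (auto simp: sqrt_residues_def)
      thus ?thesis using True by auto
    next
      case False
      hence "int p dvd 2" using p ip by (simp add: prime_dvd_mult_iff)
      hence p2: "p = 2" using prime_ge_2_nat[OF p(1)] zdvd_imp_le[of "int p" 2] by simp
      have "odd m" using False p2 by simp
      have "B \<in> sqrt_residues p \<longleftrightarrow> B = 1" for B
        using \<open>odd m\<close> p2 by (auto simp: sqrt_residues_def) presburger
      thus ?thesis using False by auto
    qed
    thus ?thesis using 2 by simp
  next
    case 3
    have "\<not> (int p)\<^sup>2 dvd B\<^sup>2 - m" for B
    proof
      assume h: "(int p)\<^sup>2 dvd B\<^sup>2 - m"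
      have ip: "prime (int p)" using p by simp
      show False
      proof (cases "int p dvd m")
        case True
        have "int p dvd B\<^sup>2 - m" using h by (metis dvd_mult_left power2_eq_square)
        hence "int p dvd B\<^sup>2" using True by (metis dvd_add_left_iff diff_add_cancel)
        hence "int p dvd B" using ip prime_dvd_power by blast
        hence "(int p)\<^sup>2 dvd B\<^sup>2" by simp
        hence "(int p)\<^sup>2 dvd m" using h by (metis dvd_diff_right_iff)
        hence "int p dvd 1" using squarefree_m squarefreeD by blast
        thus False using ip not_prime_unit by blast
      next
        case False
        hence "int p dvd 2" using p ip by (simp add: prime_dvd_mult_iff)
        hence p2: "p = 2" using prime_ge_2_nat[OF p(1)] zdvd_imp_le[of "int p" 2] by simp
        hence "odd m" using False by simp
        hence m3: "m mod 4 = 3" using m_mod4 by presburger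
        have "B\<^sup>2 mod 4 = m mod 4" using h p2 by (simp add: mod_eq_dvd_iff)
        thus False using m3 square_mod_4[of B] by (simp split: if_splits)
      qed
    qed
    moreover have "(int p)\<^sup>2 dvd int (p ^ j)" using 3 by (simp add: le_imp_power_dvd)
    ultimately have "sqrt_residues (p ^ j) = {}" unfolding sqrt_residues_def by (auto dest: dvd_trans)
    thus ?thesis using 3 by simp
  qed
qed

text \<open>Hensel lifting: the derivative \<open>2 b\<close> of \<open>b\<^sup>2 - m\<close> is invertible modulo \<open>p\<close>.\<close>
lemma hensel_sqrt:
  fixes p :: int
  assumes p: "prime p" "\<not> p dvd 2 * m" and res: "QuadRes p m"
  shows "\<exists>b. p ^ j dvd b\<^sup>2 - m"
proof (induction j)
  case 0 thus ?case by simp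
next
  case (Suc j)
  show ?case
  proof (cases "j = 0")
    case True
    thus ?thesis using res by (auto simp: QuadRes_def cong_iff_dvd_diff)
  next
    case False
    obtain b where b: "p ^ j dvd b\<^sup>2 - m" using Suc by auto
    then obtain k where k: "b\<^sup>2 - m = p ^ j * k" by auto
    have "\<not> p dvd 2 * b"
    proof
      assume "p dvd 2 * b"
      hence "p dvd b" using p by (auto simp: prime_dvd_mult_iff)
      moreover have "p dvd b\<^sup>2 - m" using b False by (meson dvd_power dvd_trans gr0I)
      ultimately have "p dvd m" by (metis dvd_diff_right_iff dvd_power dvd_trans zero_less_numeral)
      thus False using p by simp
    qed
    hence "coprime (2 * b) p" using p prime_imp_coprime coprime_commute by blast
    then obtain x where x: "[2 * b * x = 1] (mod p)" using cong_solve_coprime_int by blast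
    define t where "t = - k * x"
    have "[k + 2 * b * t = k - k * (2 * b * x)] (mod p)" by (simp add: t_def algebra_simps)
    also have "[k - k * (2 * b * x) = k - k * 1] (mod p)" using x by (intro cong_diff cong_mult cong_refl)
    finally have "p dvd k + 2 * b * t" by (simp add: cong_0_iff)
    moreover have "p dvd t\<^sup>2 * p ^ j" using False by (simp add: dvd_mult dvd_power)
    ultimately have "p dvd k + 2 * b * t + t\<^sup>2 * p ^ j" by (rule dvd_add)
    hence "p ^ j * p dvd p ^ j * (k + 2 * b * t + t\<^sup>2 * p ^ j)" by (rule mult_dvd_mono[OF dvd_refl])
    also have "p ^ j * (k + 2 * b * t + t\<^sup>2 * p ^ j) = (b + t * p ^ j)\<^sup>2 - m"
      using k by (simp add: power2_eq_square algebra_simps)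
    finally show ?thesis by (auto simp: mult.commute)
  qed
qed

text \<open>If \<open>b\<close> is a root modulo \<open>p ^ j\<close> then \<open>b\<close> and \<open>-b\<close> are the only ones, because \<open>p\<close> cannot divide both
  \<open>B - b\<close> and \<open>B + b\<close>.\<close>
lemma card_sqrt_residues_unramified:
  fixes p :: nat
  assumes p: "prime p" "\<not> int p dvd 2 * m" and j: "j > 0"
  shows "int (card (sqrt_residues (p ^ j))) = 1 + chi (int p)"
proof -
  have ip: "prime (int p)" using p by simp
  have "p \<noteq> 2" using p by auto
  hence p2: "int p > 2" using prime_ge_2_nat[OF p(1)] by simp
  have nm: "\<not> int p dvd m" using p(2) dvd_mult by blast
  have chi: "chi (int p) = Legendre m (int p)" using chi_prime ip p2 nm by blast
  show ?thesis
  proof (cases "QuadRes (int p) m")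
    case False
    have "sqrt_residues (p ^ j) = {}"
    proof -
      have "\<not> int (p ^ j) dvd B\<^sup>2 - m" for B
      proof
        assume "int (p ^ j) dvd B\<^sup>2 - m"
        hence "int p dvd B\<^sup>2 - m" using j by (metis dvd_power dvd_trans of_nat_power)
        thus False using False by (auto simp: QuadRes_def cong_iff_dvd_diff)
      qed
      thus ?thesis by (auto simp: sqrt_residues_def)
    qed
    thus ?thesis using chi False nm by (simp add: Legendre_def cong_0_iff)
  next
    case True
    define q where "q = int p ^ j"
    have q: "q > 0" "int (p ^ j) = q" using prime_gt_0_nat[OF p(1)] by (auto simp: q_def)
    obtain b where b: "q dvd b\<^sup>2 - m" using hensel_sqrt[OF ip p(2) True] q_def by blast
    have pq: "int p dvd q" using j by (simp add: q_def dvd_power)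
    have n2b: "\<not> int p dvd 2 * b"
    proof
      assume "int p dvd 2 * b"
      hence "int p dvd b" using ip p by (auto simp: prime_dvd_mult_iff)
      moreover have "int p dvd b\<^sup>2 - m" using b pq dvd_trans by blast
      ultimately have "int p dvd m" by (metis dvd_diff_right_iff dvd_power dvd_trans zero_less_numeral)
      thus False using nm by simp
    qed
    have sol: "q dvd B\<^sup>2 - m \<longleftrightarrow> q dvd B - b \<or> q dvd B + b" for B
    proof
      assume "q dvd B\<^sup>2 - m"
      hence "q dvd (B\<^sup>2 - m) - (b\<^sup>2 - m)" using b by (rule dvd_diff)
      also have "(B\<^sup>2 - m) - (b\<^sup>2 - m) = (B - b) * (B + b)" by (simp add: power2_eq_square algebra_simps)
      finally have d: "q dvd (B - b) * (B + b)" .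
      have "\<not> (int p dvd B - b \<and> int p dvd B + b)"
      proof
        assume "int p dvd B - b \<and> int p dvd B + b"
        hence "int p dvd (B + b) - (B - b)" using dvd_diff by blast
        thus False using n2b by simp
      qed
      hence "coprime (int p) (B - b) \<or> coprime (int p) (B + b)" using ip prime_imp_coprime by blast
      hence "coprime q (B - b) \<or> coprime q (B + b)" unfolding q_def by auto
      thus "q dvd B - b \<or> q dvd B + b"
        using d by (auto simp: coprime_dvd_mult_right_iff coprime_dvd_mult_left_iff)
    next
      assume h: "q dvd B - b \<or> q dvd B + b"
      have "B\<^sup>2 - m = (B - b) * (B + b) + (b\<^sup>2 - m)" by (simp add: power2_eq_square algebra_simps)
      thus "q dvd B\<^sup>2 - m" using h b by (metis dvd_add dvd_mult dvd_mult2)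
    qed
    have "sqrt_residues (p ^ j) = {b mod q, (- b) mod q}"
    proof (rule Set.set_eqI)
      fix B
      have "B \<in> sqrt_residues (p ^ j) \<longleftrightarrow> 0 \<le> B \<and> B < q \<and> (q dvd B - b \<or> q dvd B + b)"
        by (simp only: sqrt_residues_def q mem_Collect_eq sol)
      also have "\<dots> \<longleftrightarrow> 0 \<le> B \<and> B < q \<and> (B mod q = b mod q \<or> B mod q = (-b) mod q)"
        by (simp add: mod_eq_dvd_iff)
      also have "\<dots> \<longleftrightarrow> B \<in> {b mod q, (- b) mod q}" using q(1) by auto
      finally show "B \<in> sqrt_residues (p ^ j) \<longleftrightarrow> B \<in> {b mod q, (- b) mod q}" .
    qed
    moreover have "b mod q \<noteq> (- b) mod q"
    proof
      assume "b mod q = (- b) mod q"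
      hence "q dvd 2 * b" by (simp add: mod_eq_dvd_iff)
      thus False using pq n2b dvd_trans by blast
    qed
    ultimately have "card (sqrt_residues (p ^ j)) = 2" by simp
    thus ?thesis using chi True nm by (simp add: Legendre_def cong_0_iff)
  qed
qed

text \<open>The number of integral ideals of norm \<open>n\<close>, sorted by the largest integer \<open>k\<close> that divides the ideal.\<close>
definition ideal_count :: "nat \<Rightarrow> int" where
  "ideal_count n = (\<Sum>k | k\<^sup>2 dvd n. int (card (sqrt_residues (n div k\<^sup>2))))"

definition divisor_chi :: "nat \<Rightarrow> int" where
  "divisor_chi n = (\<Sum>d | d dvd n. chi (int d))"

lemma square_dvd_subset: "{k::nat. k\<^sup>2 dvd n} \<subseteq> {k. k dvd n}"
  by (auto simp: power2_eq_square elim: dvd_mult_left)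

lemma divisor_chi_mult:
  assumes "coprime a b"
  shows "divisor_chi (a * b) = divisor_chi a * divisor_chi b"
proof -
  have "divisor_chi (a * b) = (\<Sum>(x, y)\<in>{d. d dvd a} \<times> {d. d dvd b}. chi (int (x * y)))"
    unfolding divisor_chi_def
    by (subst sum.reindex_bij_betw[OF bij_betw_coprime_divisors[OF assms], symmetric])
       (simp add: case_prod_unfold)
  also have "\<dots> = divisor_chi a * divisor_chi b"
    unfolding divisor_chi_def sum_product sum.cartesian_product by (simp add: chi_mult)
  finally show ?thesis .
qed

lemma ideal_count_mult:
  assumes "coprime a b" "a > 0" "b > 0"
  shows "ideal_count (a * b) = ideal_count a * ideal_count b"
proof -
  let ?f = "\<lambda>n k. int (card (sqrt_residues (n div k\<^sup>2)))"
  have alt: "ideal_count n = (\<Sum>k | k dvd n. if k\<^sup>2 dvd n then ?f n k else 0)" if "n > 0" for n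
  proof -
    have "finite {k. k dvd n}" using that by simp
    thus ?thesis unfolding ideal_count_def
      by (intro sum.mono_neutral_cong_left) (use square_dvd_subset in auto)
  qed
  have "ideal_count (a * b) = (\<Sum>(x, y)\<in>{d. d dvd a} \<times> {d. d dvd b}.
      if (x * y)\<^sup>2 dvd a * b then ?f (a * b) (x * y) else 0)"
    using assms by (subst alt, simp)
      (subst sum.reindex_bij_betw[OF bij_betw_coprime_divisors[OF assms(1)], symmetric],
        auto intro!: sum.cong)
  also have "\<dots> = (\<Sum>(x, y)\<in>{d. d dvd a} \<times> {d. d dvd b}.
      (if x\<^sup>2 dvd a then ?f a x else 0) * (if y\<^sup>2 dvd b then ?f b y else 0))"
  proof (rule sum.cong[OF refl], clarify)
    fix x y assume xy: "x dvd a" "y dvd b"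
    have "?f (a * b) (x * y) = ?f a x * ?f b y" if sq: "x\<^sup>2 dvd a" "y\<^sup>2 dvd b"
    proof -
      obtain a' b' where ab: "a = x\<^sup>2 * a'" "b = y\<^sup>2 * b'" using sq unfolding dvd_def by blast
      have "x > 0" "y > 0" "a' > 0" "b' > 0" using ab assms by auto
      moreover have "coprime a' b'" using assms(1) unfolding ab by simp
      moreover have "a * b = (x * y)\<^sup>2 * (a' * b')" by (simp add: ab power_mult_distrib)
      ultimately have "(a * b) div (x * y)\<^sup>2 = a' * b'" "a div x\<^sup>2 = a'" "b div y\<^sup>2 = b'"
        "coprime a' b'" "a' > 0" "b' > 0" by (simp_all add: ab(1) ab(2) power_mult_distrib)
      thus ?thesis by (simp add: card_sqrt_residues_mult)
    qed
    thus "(if (x * y)\<^sup>2 dvd a * b then ?f (a * b) (x * y) else 0)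
      = (if x\<^sup>2 dvd a then ?f a x else 0) * (if y\<^sup>2 dvd b then ?f b y else 0)"
      using square_dvd_coprime_mult_iff[OF assms(1) xy] by auto
  qed
  also have "\<dots> = ideal_count a * ideal_count b"
    unfolding alt[OF assms(2)] alt[OF assms(3)] sum_product sum.cartesian_product by (simp add: case_prod_unfold)
  finally show ?thesis .
qed

lemma divisor_chi_prime_power:
  assumes "prime p"
  shows "divisor_chi (p ^ e) = (\<Sum>i\<le>e. chi (int p) ^ i)"
proof -
  have pow: "chi (int (p ^ i)) = chi (int p) ^ i" for i
    by (induction i) (simp_all add: chi_1 chi_mult)
  have "{d. d dvd p ^ e} = (\<lambda>i. p ^ i) ` {..e}"
    using assms by (auto simp: divides_primepow_nat le_imp_power_dvd)
  moreover have "inj_on (\<lambda>i. p ^ i) {..e}"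
    using prime_gt_1_nat[OF assms] by (auto intro!: inj_onI simp: power_inject_exp)
  ultimately show ?thesis by (simp add: divisor_chi_def sum.reindex pow del: of_nat_power)
qed

lemma ideal_count_prime_power:
  assumes p: "prime p"
  shows "ideal_count (p ^ e) = (\<Sum>i\<le>e div 2. int (card (sqrt_residues (p ^ (e - 2 * i)))))"
proof -
  have p1: "p > 1" using prime_gt_1_nat[OF p] .
  have "{k. k\<^sup>2 dvd p ^ e} = (\<lambda>i. p ^ i) ` {..e div 2}"
  proof (intro Set.set_eqI iffI)
    fix k assume "k \<in> {k. k\<^sup>2 dvd p ^ e}"
    hence k: "k\<^sup>2 dvd p ^ e" by simp
    hence "k dvd p ^ e" using square_dvd_subset by blast
    then obtain i where i: "k = p ^ i" using p by (auto simp: divides_primepow_nat)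
    hence "p ^ (i * 2) dvd p ^ e" using k by (simp add: power_mult)
    hence "i * 2 \<le> e" using p1 by (simp add: power_dvd_imp_le)
    thus "k \<in> (\<lambda>i. p ^ i) ` {..e div 2}" using i by auto
  next
    fix k assume "k \<in> (\<lambda>i. p ^ i) ` {..e div 2}"
    then obtain i where "k = p ^ i" "i * 2 \<le> e" by auto
    thus "k \<in> {k. k\<^sup>2 dvd p ^ e}" by (simp add: power_mult[symmetric] le_imp_power_dvd)
  qed
  moreover have "inj_on (\<lambda>i. p ^ i) {..e div 2}"
    using p1 by (auto intro!: inj_onI simp: power_inject_exp)
  ultimately have "ideal_count (p ^ e) = (\<Sum>i\<le>e div 2. int (card (sqrt_residues (p ^ e div (p ^ i)\<^sup>2))))"
    by (simp add: ideal_count_def sum.reindex)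
  also have "\<dots> = (\<Sum>i\<le>e div 2. int (card (sqrt_residues (p ^ (e - 2 * i)))))"
  proof (intro sum.cong refl)
    fix i assume "i \<in> {..e div 2}"
    hence "i * 2 \<le> e" by auto
    hence "p ^ e div (p ^ i)\<^sup>2 = p ^ (e - 2 * i)"
      using p1 by (simp add: power_mult[symmetric] power_diff mult.commute)
    thus "int (card (sqrt_residues (p ^ e div (p ^ i)\<^sup>2))) = int (card (sqrt_residues (p ^ (e - 2 * i))))"
      by simp
  qed
  finally show ?thesis .
qed

text \<open>For unramified \<open>p\<close>, both sides grow by \<open>1 + \<chi>(p)\<close> when \<open>e\<close> grows by 2; for ramified \<open>p\<close> both are 1.\<close>
lemma ideal_count_eq_divisor_chi_prime_power:
  assumes p: "prime p"
  shows "ideal_count (p ^ e) = divisor_chi (p ^ e)"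
proof (cases "int p dvd 2 * m")
  case True
  have "ideal_count (p ^ e) = (\<Sum>i\<le>e div 2. if i = e div 2 then 1 else 0)"
    unfolding ideal_count_prime_power[OF p] card_sqrt_residues_ramified[OF p True]
    by (intro sum.cong refl) auto
  also have "\<dots> = 1" by simp
  also have "\<dots> = (\<Sum>i\<le>e. if i = 0 then 1 else 0)" by simp
  also have "\<dots> = divisor_chi (p ^ e)"
    unfolding divisor_chi_prime_power[OF p]
    using chi_prime_dvd[of "int p"] True p by (intro sum.cong refl) (auto simp: power_0_left)
  finally show ?thesis .
next
  case False
  define c where "c = chi (int p)"
  have card: "int (card (sqrt_residues (p ^ j))) = 1 + c" if "j > 0" for j
    using card_sqrt_residues_unramified[OF p False that] by (simp add: c_def)
  have "prime (int p)" "p \<noteq> 2" "\<not> int p dvd m" using p False by auto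
  hence "c = Legendre m (int p)" using prime_ge_2_nat[OF p] unfolding c_def by (intro chi_prime) auto
  hence c: "c = 1 \<or> c = -1" using \<open>\<not> int p dvd m\<close> by (auto simp: Legendre_def cong_0_iff)
  define g where "g = (\<lambda>e. \<Sum>i\<le>e div 2. int (card (sqrt_residues (p ^ (e - 2 * i)))))"
  define f where "f = (\<lambda>e. \<Sum>i\<le>e. c ^ i)"
  have step: "g (Suc (Suc e)) = (1 + c) + g e" for e
  proof -
    have "g (Suc (Suc e)) = (\<Sum>i\<le>Suc (e div 2). int (card (sqrt_residues (p ^ (Suc (Suc e) - 2 * i)))))"
      by (simp add: g_def)
    also have "\<dots> = (1 + c) + g e"
      unfolding g_def by (subst sum.atMost_Suc_shift) (simp add: card del: power_Suc)
    finally show ?thesis .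
  qed
  have step': "f (Suc (Suc e)) = (1 + c) + f e" for e
  proof -
    have "c ^ Suc e + c ^ Suc (Suc e) = 1 + c" using c by (cases "even e") auto
    thus ?thesis by (simp add: f_def)
  qed
  have "g e = f e"
  proof (induction e rule: induct_nat_012)
    case 0 thus ?case by (simp add: g_def f_def sqrt_residues_1[simplified])
  next
    case 1 thus ?case using card[of 1] by (simp add: g_def f_def)
  next
    case (ge2 n) thus ?case by (simp add: step step')
  qed
  thus ?thesis by (simp add: ideal_count_prime_power[OF p] divisor_chi_prime_power[OF p] g_def f_def c_def)
qed

text \<open>Coefficientwise, this is the factorisation of the Dedekind zeta function into the Riemann zeta function
  and the L-function of the character. Both sides are multiplicative.\<close>
theorem ideal_count_eq_divisor_chi:
  assumes "n > 0"
  shows "ideal_count n = divisor_chi n"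
  using assms
proof (induction n rule: less_induct)
  case (less n)
  show ?case
  proof (cases "n = 1")
    case True
    thus ?thesis using ideal_count_eq_divisor_chi_prime_power[of 2 0] by simp
  next
    case False
    then obtain p where p: "prime p" "p dvd n" using prime_factor_nat by blast
    define e where "e = multiplicity p n"
    define k where "k = n div p ^ e"
    have k: "n = p ^ e * k" "\<not> p dvd k"
      using multiplicity_decompose[of n p] less.prems p(1) prime_gt_1_nat[OF p(1)]
      by (auto simp: k_def e_def multiplicity_dvd)
    have "e > 0" unfolding e_def using p less.prems by (simp add: prime_multiplicity_gt_zero_iff)
    have "k > 0" using k less.prems by (auto intro: Nat.gr0I)
    have "p ^ e > 1" using \<open>e > 0\<close> prime_gt_1_nat[OF p(1)] one_less_power by blast
    hence "k < n" using k(1) \<open>k > 0\<close> by simp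
    have cop: "coprime (p ^ e) k" using p(1) k(2) by (simp add: prime_imp_coprime)
    have "ideal_count n = ideal_count (p ^ e) * ideal_count k"
      unfolding k(1) using cop \<open>k > 0\<close> p(1) by (intro ideal_count_mult) (auto simp: prime_gt_0_nat)
    also have "\<dots> = divisor_chi (p ^ e) * divisor_chi k"
      using less.IH[OF \<open>k < n\<close> \<open>k > 0\<close>] ideal_count_eq_divisor_chi_prime_power[OF p(1)] by simp
    also have "\<dots> = divisor_chi n" unfolding k(1) using cop by (rule divisor_chi_mult[symmetric])
    finally show ?thesis .
  qed
qed

end

section \<open>The constant term of a Lambert series\<close>

lemma bounded_if_periodic:
  fixes f :: "nat \<Rightarrow> real"
  assumes N: "N > 0" and per: "\<And>n. f (n + N) = f n"
  obtains K where "\<And>n. \<bar>f n\<bar> \<le> K"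
proof -
  have "f n = f (n mod N)" for n
  proof (induction n rule: less_induct)
    case (less n)
    show ?case
    proof (cases "n < N")
      case False
      hence "f n = f (n - N)" using per[of "n - N"] by simp
      also have "\<dots> = f ((n - N) mod N)" using less[of "n - N"] False N by simp
      also have "(n - N) mod N = n mod N" using False by (simp add: le_mod_geq)
      finally show ?thesis .
    qed simp
  qed
  moreover have "\<bar>f (n mod N)\<bar> \<le> (\<Sum>i<N. \<bar>f i\<bar>)" for n
    using N by (intro member_le_sum[of "n mod N" "{..<N}" "\<lambda>i. \<bar>f i\<bar>"]) auto
  ultimately show ?thesis using that by metis
qed

lemma abel_summation:
  fixes c a :: "nat \<Rightarrow> real"
  shows "(\<Sum>k=1..n. c k * a k) = (\<Sum>k=1..n. c k) * a (Suc n) + (\<Sum>k=1..n. (\<Sum>i=1..k. c i) * (a k - a (Suc k)))"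
  by (induction n) (simp_all add: algebra_simps)

lemma sum_periodic_shift:
  fixes c :: "nat \<Rightarrow> real"
  assumes per: "\<And>n. c (n + N) = c n" and zero: "(\<Sum>k=1..N. c k) = 0"
  shows "(\<Sum>k=1..n + N. c k) = (\<Sum>k=1..n. c k)"
proof (induction n)
  case 0 thus ?case using zero by simp
next
  case (Suc n)
  thus ?case using per[of "Suc n"] by simp
qed

text \<open>Two Abel summations: the first turns the periodic coefficients into their partial sums, the
  second, after removal of the mean value, into bounded coefficients of a second difference, which
  telescopes because of convexity.\<close>
lemma periodic_sum_convex_bound:
  fixes c :: "nat \<Rightarrow> real"
  assumes N: "N > 0" and per: "\<And>n. c (n + N) = c n" and zero: "(\<Sum>k=1..N. c k) = 0"
  defines "L \<equiv> (\<Sum>n=1..N. \<Sum>k=1..n. c k) / real N"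
  obtains K where "\<And>a n. (\<And>k. k \<ge> 1 \<Longrightarrow> a (Suc k) \<le> a k) \<Longrightarrow>
     (\<And>k. k \<ge> 1 \<Longrightarrow> a (Suc k) - a (Suc (Suc k)) \<le> a k - a (Suc k)) \<Longrightarrow>
     \<bar>(\<Sum>k=1..n. c k * a k) - (\<Sum>k=1..n. c k) * a (Suc n) - L * (a 1 - a (Suc n))\<bar> \<le> K * (a 1 - a 2)"
proof -
  define A where "A = (\<lambda>n. \<Sum>k=1..n. c k)"
  define B where "B = (\<lambda>n. \<Sum>k=1..n. A k - L)"
  have perA: "A (n + N) = A n" for n unfolding A_def using sum_periodic_shift[OF per zero] .
  have "(\<Sum>k=1..N. A k - L) = 0" using N by (simp add: sum_subtractf L_def A_def)
  hence perB: "B (n + N) = B n" for n unfolding B_def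
    by (intro sum_periodic_shift) (simp_all add: perA)
  obtain K where K: "\<And>n. \<bar>B n\<bar> \<le> K" using bounded_if_periodic[of N B, OF N perB] by blast
  show ?thesis
  proof (rule that[of K])
    fix a :: "nat \<Rightarrow> real" and n
    assume dec: "\<And>k. k \<ge> 1 \<Longrightarrow> a (Suc k) \<le> a k"
      and conv: "\<And>k. k \<ge> 1 \<Longrightarrow> a (Suc k) - a (Suc (Suc k)) \<le> a k - a (Suc k)"
    define d where "d = (\<lambda>k. a k - a (Suc k))"
    have tel: "(\<Sum>k=1..n. f k - f (Suc k)) = f 1 - f (Suc n)" for f :: "nat \<Rightarrow> real"
      by (induction n) auto
    have "(\<Sum>k=1..n. c k * a k) - A n * a (Suc n) = (\<Sum>k=1..n. A k * d k)"
      using abel_summation[of c a n] by (simp add: A_def d_def)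
    also have "\<dots> = L * (\<Sum>k=1..n. d k) + (\<Sum>k=1..n. (A k - L) * d k)"
      by (simp add: algebra_simps sum_distrib_left sum.distrib sum_subtractf)
    also have "(\<Sum>k=1..n. d k) = a 1 - a (Suc n)" unfolding d_def by (rule tel)
    also have "(\<Sum>k=1..n. (A k - L) * d k) = B n * d (Suc n) + (\<Sum>k=1..n. B k * (d k - d (Suc k)))"
      unfolding B_def by (rule abel_summation)
    finally have e: "(\<Sum>k=1..n. c k * a k) - A n * a (Suc n) - L * (a 1 - a (Suc n))
      = B n * d (Suc n) + (\<Sum>k=1..n. B k * (d k - d (Suc k)))" by simp
    have "\<bar>B n * d (Suc n)\<bar> \<le> K * d (Suc n)"
      using K[of n] dec[of "Suc n"] by (simp add: abs_mult d_def mult_right_mono)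
    moreover have "\<bar>\<Sum>k=1..n. B k * (d k - d (Suc k))\<bar> \<le> (\<Sum>k=1..n. K * (d k - d (Suc k)))"
    proof (rule order_trans[OF sum_abs], rule sum_mono)
      fix k assume "k \<in> {1..n}"
      thus "\<bar>B k * (d k - d (Suc k))\<bar> \<le> K * (d k - d (Suc k))"
        using K[of k] conv[of k] by (simp add: abs_mult d_def mult_right_mono)
    qed
    moreover have "(\<Sum>k=1..n. K * (d k - d (Suc k))) = K * (d 1 - d (Suc n))"
      using tel[of d] by (simp add: sum_distrib_left[symmetric])
    ultimately have "\<bar>B n * d (Suc n) + (\<Sum>k=1..n. B k * (d k - d (Suc k)))\<bar> \<le> K * d (Suc n) + K * (d 1 - d (Suc n))"
      by linarith
    also have "\<dots> = K * (a 1 - a 2)" by (simp add: algebra_simps d_def numeral_2_eq_2)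
    finally show "\<bar>(\<Sum>k=1..n. c k * a k) - (\<Sum>k=1..n. c k) * a (Suc n) - L * (a 1 - a (Suc n))\<bar> \<le> K * (a 1 - a 2)"
      unfolding e[symmetric] by (simp add: A_def)
  qed
qed

text \<open>The Fermi function. It enters through \<open>1 / (exp u - 1) - 2 / (exp (2 u) - 1) = fermi u\<close>, in which the poles
  at 0 cancel.\<close>
definition fermi :: "real \<Rightarrow> real" where "fermi u = 1 / (exp u + 1)"

lemma fermi_antimono: "u \<le> v \<Longrightarrow> fermi v \<le> fermi u"
  unfolding fermi_def by (intro divide_left_mono mult_pos_pos add_pos_pos) auto

lemma fermi_convex:
  assumes "0 \<le> u" "0 \<le> t"
  shows "fermi (u + t) - fermi (u + t + t) \<le> fermi u - fermi (u + t)"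
proof -
  define x w where "x = exp u" and "w = exp t"
  have x: "x \<ge> 1" "w \<ge> 1" using assms by (auto simp: x_def w_def)
  hence pos: "x > 0" "w > 0" by auto
  have "1 / (x + 1) + 1 / (x * w * w + 1) - 2 / (x * w + 1)
    = x * (w - 1)\<^sup>2 * (x * w - 1) / ((x + 1) * (x * w * w + 1) * (x * w + 1))"
  proof -
    have "x + 1 \<noteq> 0" "x * w * w + 1 \<noteq> 0" "x * w + 1 \<noteq> 0"
      using pos by (metis add_pos_pos mult_pos_pos zero_less_one less_irrefl)+
    thus ?thesis by (simp add: divide_simps power2_eq_square) (simp add: algebra_simps)
  qed
  also have "\<dots> \<ge> 0"
  proof -
    have "x * w \<ge> 1 * 1" using x by (intro mult_mono) auto
    thus ?thesis using pos by (intro divide_nonneg_pos mult_nonneg_nonneg mult_pos_pos add_pos_pos) auto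
  qed
  finally have "1 / (x + 1) + 1 / (x * w * w + 1) - 2 / (x * w + 1) \<ge> 0" .
  moreover have "exp (u + t) = x * w" "exp (u + t + t) = x * w * w" "exp u = x"
    by (simp_all add: x_def w_def mult_exp_exp)
  ultimately show ?thesis unfolding fermi_def by simp
qed

lemma fermi_le_exp: "fermi u \<le> exp (- u)"
  unfolding fermi_def exp_minus inverse_eq_divide
  by (intro divide_left_mono mult_pos_pos add_pos_pos) auto

lemma fermi_pos: "fermi u > 0"
  unfolding fermi_def by (simp add: add_pos_pos)

text \<open>With \<open>a k = fermi (k t)\<close> in the preceding bound, \<open>a 1\<close> tends to \<open>1/2\<close> and the error \<open>a 1 - a 2\<close> to 0.\<close>
lemma tendsto_fermi_sum:
  fixes c :: "nat \<Rightarrow> real" and S :: "real \<Rightarrow> real"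
  assumes N: "N > 0" and per: "\<And>n. c (n + N) = c n" and zero: "(\<Sum>k=1..N. c k) = 0"
  assumes S: "\<And>t. t > 0 \<Longrightarrow> ((\<lambda>n. c n * fermi (real n * t)) has_sum S t) {1..}"
  shows "(S \<longlongrightarrow> ((\<Sum>n=1..N. \<Sum>k=1..n. c k) / real N) / 2) (at_right 0)"
proof -
  define L where "L = (\<Sum>n=1..N. \<Sum>k=1..n. c k) / real N"
  obtain K where K: "\<And>a n. (\<And>k. k \<ge> 1 \<Longrightarrow> a (Suc k) \<le> a k) \<Longrightarrow>
     (\<And>k. k \<ge> 1 \<Longrightarrow> a (Suc k) - a (Suc (Suc k)) \<le> a k - a (Suc k)) \<Longrightarrow>
     \<bar>(\<Sum>k=1..n. c k * a k) - (\<Sum>k=1..n. c k) * a (Suc n) - L * (a 1 - a (Suc n))\<bar> \<le> K * (a 1 - a 2)"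
    using periodic_sum_convex_bound[OF N per zero] unfolding L_def by blast
  obtain K' where K': "\<And>n. \<bar>\<Sum>k=1..n. c k\<bar> \<le> K'"
    using bounded_if_periodic[of N "\<lambda>n. \<Sum>k=1..n. c k"] N sum_periodic_shift[OF per zero] by blast
  have bound: "\<bar>S t - L * fermi t\<bar> \<le> K * (fermi t - fermi (2 * t))" if t: "t > 0" for t
  proof -
    define a where "a = (\<lambda>k. fermi (real k * t))"
    have a: "a (Suc k) \<le> a k" "a (Suc k) - a (Suc (Suc k)) \<le> a k - a (Suc k)" for k
      using fermi_antimono[of "real k * t" "real k * t + t"] fermi_convex[of "real k * t" t] t
      by (auto simp: a_def algebra_simps)
    have a0: "a \<longlonglongrightarrow> 0"
    proof (rule Lim_null_comparison)
      show "\<forall>\<^sub>F n in sequentially. norm (a n) \<le> exp (-t) ^ n"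
        using fermi_le_exp fermi_pos by (auto simp: a_def exp_of_nat_mult[symmetric] less_imp_le)
      show "(\<lambda>n. exp (-t) ^ n) \<longlonglongrightarrow> 0" using t by (intro LIMSEQ_power_zero) auto
    qed
    hence a0': "(\<lambda>n. a (Suc n)) \<longlonglongrightarrow> 0" by (rule LIMSEQ_Suc)
    have "(\<lambda>n. (\<Sum>k=1..n. c k) * a (Suc n)) \<longlonglongrightarrow> 0"
    proof (rule Lim_null_comparison)
      show "\<forall>\<^sub>F n in sequentially. norm ((\<Sum>k=1..n. c k) * a (Suc n)) \<le> K' * \<bar>a (Suc n)\<bar>"
        using K' by (intro always_eventually) (auto simp: abs_mult intro: mult_right_mono)
      show "(\<lambda>n. K' * \<bar>a (Suc n)\<bar>) \<longlonglongrightarrow> 0"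
        using tendsto_mult[OF tendsto_const tendsto_rabs_zero[OF a0'], of K'] by simp
    qed
    moreover have "(\<lambda>n. \<Sum>k=1..n. c k * a k) \<longlonglongrightarrow> S t"
    proof -
      have "((\<lambda>n. c (Suc n) * a (Suc n)) has_sum S t) UNIV"
        using S[OF t] unfolding a_def
        by (subst has_sum_reindex_bij_witness[of _ "\<lambda>n. n - 1" Suc "{1..}" "\<lambda>n. c n * fermi (real n * t)" _ "S t"]) auto
      hence "(\<lambda>n. c (Suc n) * a (Suc n)) sums S t" by (rule has_sum_imp_sums)
      hence "(\<lambda>n. \<Sum>k<n. c (Suc k) * a (Suc k)) \<longlonglongrightarrow> S t" by (simp add: sums_def)
      thus ?thesis by (simp add: sum.atLeast1_atMost_eq)
    qed
    ultimately have "(\<lambda>n. (\<Sum>k=1..n. c k * a k) - (\<Sum>k=1..n. c k) * a (Suc n) - L * (a 1 - a (Suc n)))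
       \<longlonglongrightarrow> S t - 0 - L * (a 1 - 0)"
      by (intro tendsto_diff tendsto_mult tendsto_const a0')
    hence "(\<lambda>n. \<bar>(\<Sum>k=1..n. c k * a k) - (\<Sum>k=1..n. c k) * a (Suc n) - L * (a 1 - a (Suc n))\<bar>)
       \<longlonglongrightarrow> \<bar>S t - L * a 1\<bar>" by (intro tendsto_rabs) simp
    hence "\<bar>S t - L * a 1\<bar> \<le> K * (a 1 - a 2)"
      by (rule LIMSEQ_le_const2) (use K[of a] a in blast)
    thus ?thesis by (simp add: a_def)
  qed
  have f: "(fermi \<longlongrightarrow> 1 / 2) (at_right 0)" "((\<lambda>t. fermi (2 * t)) \<longlongrightarrow> 1 / 2) (at_right 0)"
    unfolding fermi_def by (auto intro!: tendsto_eq_intros add_pos_pos simp: add_eq_0_iff)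
  have "((\<lambda>t. S t - L * fermi t) \<longlongrightarrow> 0) (at_right 0)"
  proof (rule Lim_null_comparison)
    show "\<forall>\<^sub>F t in at_right 0. norm (S t - L * fermi t) \<le> K * (fermi t - fermi (2 * t))"
      using bound by (auto simp: eventually_at_right_less intro: eventually_mono[OF eventually_at_right_less])
    show "((\<lambda>t. K * (fermi t - fermi (2 * t))) \<longlongrightarrow> 0) (at_right 0)"
      using tendsto_mult[OF tendsto_const tendsto_diff[OF f], of K] by simp
  qed
  hence "((\<lambda>t. (S t - L * fermi t) + L * fermi t) \<longlongrightarrow> 0 + L * (1 / 2)) (at_right 0)"
    by (intro tendsto_add tendsto_mult tendsto_const f)
  thus ?thesis by (simp add: L_def)
qed

text \<open>The double series of \<open>c d * q ^ (d k)\<close> is summed once along the hyperbolas \<open>d k = n\<close> and once over \<open>k\<close>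
  first.\<close>
lemma lambert_series:
  fixes c :: "nat \<Rightarrow> real" and q :: real
  assumes q: "0 < q" "q < 1" and bd: "\<And>n. \<bar>c n\<bar> \<le> C"
  shows "\<exists>Z. ((\<lambda>n. (\<Sum>d | d dvd n. c d) * q ^ n) has_sum Z) {1..} \<and>
    ((\<lambda>d. c d * (q ^ d / (1 - q ^ d))) has_sum Z) {1..}"
proof -
  define f where "f = (\<lambda>(d, k). c d * q ^ (d * k))"
  have C: "C \<ge> 0" using bd[of 0] by linarith
  have geo: "((\<lambda>k. q ^ (d * k)) has_sum q ^ d / (1 - q ^ d)) {1..}" if "d \<ge> 1" for d
  proof -
    have "norm (q ^ d) < 1" using q that by (simp add: power_less_one_iff)
    from has_sum_geometric_from_1[OF this] show ?thesis by (simp add: power_mult)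
  qed
  have qle: "q ^ d / (1 - q ^ d) \<le> q ^ d / (1 - q)" if "d \<ge> 1" for d
  proof -
    have "q ^ d \<le> q ^ 1" using q that by (intro power_decreasing) auto
    thus ?thesis using q by (intro divide_left_mono mult_pos_pos) auto
  qed
  have "(\<lambda>k. q ^ k) summable_on {1..}" using has_sum_geometric_from_1[of q] q has_sum_imp_summable by auto
  hence "(\<lambda>d. C * (q ^ d / (1 - q))) summable_on {1..}"
    by (intro summable_on_cmult_right) (simp add: divide_inverse summable_on_cmult_left)
  hence s: "(\<lambda>d. C * (q ^ d / (1 - q ^ d))) summable_on {1..}"
  proof (rule summable_on_comparison_test)
    fix d :: nat assume d: "d \<in> {1..}"
    have "q ^ d < 1" using q d by (simp add: power_less_one_iff)
    thus "0 \<le> C * (q ^ d / (1 - q ^ d))" using q C by (intro mult_nonneg_nonneg divide_nonneg_nonneg) auto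
    show "C * (q ^ d / (1 - q ^ d)) \<le> C * (q ^ d / (1 - q))" using C qle d by (intro mult_left_mono) auto
  qed
  have "(\<lambda>(d, k). C * q ^ (d * k)) summable_on ({1..} \<times> {1..})"
  proof (rule summable_on_SigmaI[where g = "\<lambda>d. C * (q ^ d / (1 - q ^ d))"])
    fix d :: nat assume "d \<in> {1..}"
    thus "((\<lambda>k. case (d, k) of (d, k) \<Rightarrow> C * q ^ (d * k)) has_sum C * (q ^ d / (1 - q ^ d))) {1..}"
      unfolding prod.case by (intro has_sum_cmult_right geo) simp
  qed (use s C q in auto)
  hence "(\<lambda>x. norm (f x)) summable_on ({1..} \<times> {1..})"
    by (rule Infinite_Sum.abs_summable_on_comparison_test')
      (use bd q in \<open>auto simp: f_def abs_mult intro!: mult_right_mono\<close>)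
  hence "f summable_on ({1..} \<times> {1..})" by (rule abs_summable_summable)
  then obtain Z where Z: "(f has_sum Z) ({1..} \<times> {1..})" unfolding summable_on_def by blast
  have "((\<lambda>d. c d * (q ^ d / (1 - q ^ d))) has_sum Z) {1..}"
    by (rule has_sum_SigmaD[OF Z]) (simp only: f_def prod.case, intro has_sum_cmult_right geo, simp)
  moreover have "((\<lambda>n. (\<Sum>d | d dvd n. c d) * q ^ n) has_sum Z) {1..}"
  proof (rule has_sum_SigmaD)
    show "((\<lambda>(n, d). c d * q ^ n) has_sum Z) (Sigma {1..} (\<lambda>n. {d. d dvd n}))"
      using Z
      by (subst has_sum_reindex_bij_witness[of _ "\<lambda>(d, k). (d * k, d)" "\<lambda>(n, d). (d, n div d)" "{1..} \<times> {1..}" f])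
        (auto simp: f_def Suc_le_eq intro: Nat.gr0I elim!: dvdE)
  next
    fix n :: nat assume "n \<in> {1..}"
    hence "finite {d. d dvd n}" by simp
    thus "((\<lambda>y. case (n, y) of (n, d) \<Rightarrow> c d * q ^ n) has_sum (\<Sum>d | d dvd n. c d) * q ^ n) {d. d dvd n}"
      by (intro has_sum_finiteI) (auto simp: sum_distrib_right)
  qed
  ultimately show ?thesis by blast
qed

theorem lambert_constant_term:
  fixes c :: "nat \<Rightarrow> real" and Z :: "real \<Rightarrow> real"
  assumes N: "N > 0" and per: "\<And>n. c (n + N) = c n" and zero: "(\<Sum>k=1..N. c k) = 0"
  assumes Z: "\<And>t. t > 0 \<Longrightarrow> ((\<lambda>n. (\<Sum>d | d dvd n. c d) * exp (- t * real n)) has_sum Z t) {1..}"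
  shows "((\<lambda>t. 2 * Z (2 * t) - Z t) \<longlongrightarrow> - ((\<Sum>n=1..N. \<Sum>k=1..n. c k) / real N) / 2) (at_right 0)"
proof -
  obtain C where C: "\<And>n. \<bar>c n\<bar> \<le> C" using bounded_if_periodic[of N c, OF N per] by blast
  have e: "exp (- t * real n) = exp (- t) ^ n" for t n by (simp add: exp_of_nat_mult[symmetric] mult.commute)
  have Z': "((\<lambda>d. c d * (exp (-t) ^ d / (1 - exp (-t) ^ d))) has_sum Z t) {1..}" if "t > 0" for t
  proof -
    obtain Y where Y: "((\<lambda>n. (\<Sum>d | d dvd n. c d) * exp (-t) ^ n) has_sum Y) {1..}"
      "((\<lambda>d. c d * (exp (-t) ^ d / (1 - exp (-t) ^ d))) has_sum Y) {1..}"
      using lambert_series[of "exp (-t)" c C] C \<open>t > 0\<close> by (auto simp del: One_nat_def)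
    have "Y = Z t" using Y(1) Z[OF that] unfolding e by (rule has_sum_unique)
    thus ?thesis using Y by simp
  qed
  have "((\<lambda>d. c d * fermi (real d * t)) has_sum (Z t - 2 * Z (2 * t))) {1..}" if t: "t > 0" for t
  proof -
    have hs: "((\<lambda>d. c d * (exp (-t) ^ d / (1 - exp (-t) ^ d)) + (-2) * (c d * (exp (-(2*t)) ^ d / (1 - exp (-(2*t)) ^ d))))
        has_sum (Z t + (-2) * Z (2 * t))) {1..}" (is ?this_sum)
      using Z'[of t] Z'[of "2 * t"] t by (intro has_sum_add has_sum_cmult_right) (simp_all only: mult_pos_pos zero_less_numeral)
    have eq: "c d * (exp (-t) ^ d / (1 - exp (-t) ^ d)) + (-2) * (c d * (exp (-(2*t)) ^ d / (1 - exp (-(2*t)) ^ d)))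
        = c d * fermi (real d * t)" if "d \<in> {1..}" for d
    proof -
      define x where "x = exp (-t) ^ d"
      have x: "0 < x" "x < 1" using t that by (auto simp: x_def power_less_one_iff)
      have 1: "exp (-(2*t)) ^ d = x\<^sup>2"
        by (simp add: x_def exp_of_nat_mult[symmetric] exp_double[symmetric] algebra_simps)
      have ex: "exp (real d * t) = 1 / x"
        by (simp add: x_def exp_of_nat_mult[symmetric] exp_minus field_simps)
      have 2: "fermi (real d * t) = x / (1 + x)"
        using x unfolding fermi_def ex by (simp add: divide_simps add.commute)
      have "1 - x\<^sup>2 = (1 - x) * (1 + x)" by (simp add: power2_eq_square algebra_simps)
      hence "x / (1 - x) - 2 * (x\<^sup>2 / (1 - x\<^sup>2)) = x / (1 + x)"
        using x by (simp add: divide_simps power2_eq_square) (simp add: algebra_simps)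
      thus ?thesis unfolding 1 2 x_def[symmetric] by (simp add: algebra_simps flip: distrib_left right_diff_distrib)
    qed
    have "?this_sum \<longleftrightarrow> ((\<lambda>d. c d * fermi (real d * t)) has_sum (Z t + (-2) * Z (2 * t))) {1..}"
      by (intro has_sum_cong eq)
    thus ?thesis using hs by simp
  qed
  from tendsto_fermi_sum[OF N per zero this]
  have "((\<lambda>t. - (Z t - 2 * Z (2 * t))) \<longlongrightarrow> - (((\<Sum>n=1..N. \<Sum>k=1..n. c k) / real N) / 2)) (at_right 0)"
    by (rule tendsto_minus)
  thus ?thesis by simp
qed

section \<open>Theta series of binary forms have no constant term\<close>

text \<open>Comparison with increments of the arctangent.\<close>
lemma sum_inverse_square_le:
  fixes c :: real
  assumes c: "0 < c" "c \<le> 1"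
  shows "(\<lambda>n::int. 1 / (1 + c * (of_int n)\<^sup>2)) summable_on UNIV"
    and "infsum (\<lambda>n::int. 1 / (1 + c * (of_int n)\<^sup>2)) UNIV \<le> 5 / sqrt c"
proof -
  define f where "f = (\<lambda>n::int. 1 / (1 + c * (of_int n)\<^sup>2))"
  define s where "s = sqrt c"
  have s: "0 < s" "s \<le> 1" "c = s\<^sup>2" using c by (auto simp: s_def)
  have f0: "f n \<ge> 0" for n using c by (simp add: f_def)
  have even_f: "f (- n) = f n" for n by (simp add: f_def)
  have step: "f (int (Suc n)) \<le> (arctan (s * real (Suc n)) - arctan (s * real n)) / s" for n
  proof -
    have lt: "s * real n < s * real (Suc n)" using s by simp
    have "\<exists>z. s * real n < z \<and> z < s * real (Suc n) \<and>
      arctan (s * real (Suc n)) - arctan (s * real n) = (s * real (Suc n) - s * real n) * inverse (1 + z\<^sup>2)"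
      using lt by (intro MVT2) (auto intro!: DERIV_arctan)
    then obtain z where z: "s * real n < z" "z < s * real (Suc n)"
      "arctan (s * real (Suc n)) - arctan (s * real n) = (s * real (Suc n) - s * real n) * inverse (1 + z\<^sup>2)"
      by blast
    have "(arctan (s * real (Suc n)) - arctan (s * real n)) / s = 1 / (1 + z\<^sup>2)"
    proof -
      have "s * real (Suc n) - s * real n = s" by (simp add: algebra_simps)
      thus ?thesis using z(3) s by (simp add: divide_inverse)
    qed
    moreover have "z\<^sup>2 \<le> (s * real (Suc n))\<^sup>2"
    proof (rule power_mono)
      show "0 \<le> z" using z(1) s by (meson less_imp_le mult_nonneg_nonneg of_nat_0_le_iff order_trans)
    qed (use z in simp)
    ultimately show ?thesis
      by (simp only: f_def s(3) of_int_of_nat_eq power_mult_distrib)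
         (intro divide_left_mono, auto intro!: add_pos_nonneg mult_pos_pos)
  qed
  have part: "(\<Sum>i<n. f (int (Suc i))) \<le> 2 / s" for n
  proof -
    have "(\<Sum>i<n. f (int (Suc i))) \<le> (\<Sum>i<n. (arctan (s * real (Suc i)) - arctan (s * real i)) / s)"
      by (intro sum_mono step)
    also have "\<dots> = arctan (s * real n) / s"
      using sum_lessThan_telescope[of "\<lambda>i. arctan (s * real i)" n]
      by (simp add: sum_divide_distrib[symmetric])
    also have "\<dots> \<le> 2 / s"
      using arctan_ubound[of "s * real n"] pi_less_4 s by (intro divide_right_mono) auto
    finally show ?thesis .
  qed
  have fin: "sum f F \<le> 5 / s" if "finite F" for F
  proof -
    obtain n where n: "F \<subseteq> {- int n..int n}"
    proof -
      define n where "n = nat (Max (abs ` insert 0 F))"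
      have "\<bar>x\<bar> \<le> int n" if "x \<in> F" for x
      proof -
        have "\<bar>x\<bar> \<le> Max (abs ` insert 0 F)" using that \<open>finite F\<close> by (intro Max_ge) auto
        moreover from this have "0 \<le> Max (abs ` insert 0 F)" using abs_ge_zero order_trans by blast
        ultimately show ?thesis unfolding n_def by (simp only: int_nat_eq if_True)
      qed
      hence "F \<subseteq> {- int n..int n}" by (fastforce simp: abs_le_iff)
      thus ?thesis using that by blast
    qed
    have "sum f F \<le> sum f {- int n..int n}" using n by (intro sum_mono2) (auto simp: f0)
    also have "{- int n..int n} = {0} \<union> ((\<lambda>i. int (Suc i)) ` {..<n} \<union> (\<lambda>i. - int (Suc i)) ` {..<n})"
    proof (rule Set.set_eqI)
      fix x
      have "x \<in> (\<lambda>i. int (Suc i)) ` {..<n} \<longleftrightarrow> 0 < x \<and> x \<le> int n"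
      proof
        assume "0 < x \<and> x \<le> int n"
        thus "x \<in> (\<lambda>i. int (Suc i)) ` {..<n}" by (intro image_eqI[of _ _ "nat x - 1"]) auto
      qed auto
      moreover have "x \<in> (\<lambda>i. - int (Suc i)) ` {..<n} \<longleftrightarrow> x < 0 \<and> - int n \<le> x"
      proof
        assume "x < 0 \<and> - int n \<le> x"
        thus "x \<in> (\<lambda>i. - int (Suc i)) ` {..<n}" by (intro image_eqI[of _ _ "nat (-x) - 1"]) auto
      qed auto
      ultimately show "x \<in> {- int n..int n} \<longleftrightarrow>
         x \<in> {0} \<union> ((\<lambda>i. int (Suc i)) ` {..<n} \<union> (\<lambda>i. - int (Suc i)) ` {..<n})" by auto
    qed
    also have "sum f \<dots> = f 0 + ((\<Sum>i<n. f (int (Suc i))) + (\<Sum>i<n. f (- int (Suc i))))"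
      by (subst sum.union_disjoint; (subst sum.union_disjoint)?)
         (auto simp: sum.reindex inj_on_def simp del: of_nat_Suc)
    also have "(\<Sum>i<n. f (- int (Suc i))) = (\<Sum>i<n. f (int (Suc i)))"
      by (simp only: even_f)
    also have "f 0 + ((\<Sum>i<n. f (int (Suc i))) + (\<Sum>i<n. f (int (Suc i)))) \<le> 1 + (2 / s + 2 / s)"
      using part[of n] by (simp add: f_def)
    also have "\<dots> \<le> 5 / s" using s by (simp add: field_simps)
    finally show ?thesis .
  qed
  show sm: "(\<lambda>n::int. 1 / (1 + c * (of_int n)\<^sup>2)) summable_on UNIV"
    unfolding f_def[symmetric]
    by (rule nonneg_bdd_above_summable_on) (use f0 fin in \<open>auto intro!: bdd_aboveI[of _ "5 / s"]\<close>)
  show "infsum (\<lambda>n::int. 1 / (1 + c * (of_int n)\<^sup>2)) UNIV \<le> 5 / sqrt c"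
    using infsum_le_finite_sums[of f UNIV "5 / s"] sm fin unfolding f_def s_def by simp
qed

lemma exp_minus_square_le:
  fixes w c :: real
  assumes "c \<ge> 0" shows "exp (- c * w\<^sup>2) \<le> 1 / (1 + c * w\<^sup>2)"
proof -
  have "0 \<le> c * w\<^sup>2" using assms by simp
  hence "1 + c * w\<^sup>2 \<le> exp (c * w\<^sup>2)" "0 < 1 + c * w\<^sup>2" using exp_ge_add_one_self by (auto intro: add_pos_nonneg)
  thus ?thesis by (simp add: exp_minus inverse_eq_divide divide_left_mono)
qed

text \<open>Moves a point by a bounded distance, so that sums over intermediate points become sums over integers.\<close>
lemma inverse_square_compare:
  fixes c u v d :: real
  assumes "0 \<le> c" "c \<le> 1" "\<bar>u - v\<bar> \<le> d"
  shows "1 / (1 + c * u\<^sup>2) \<le> (2 + 2 * d\<^sup>2) / (1 + c * v\<^sup>2)"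
proof -
  have "(u - v)\<^sup>2 \<le> d\<^sup>2" using assms(3) by (metis abs_ge_zero power2_abs power_mono)
  moreover have "v\<^sup>2 \<le> 2 * u\<^sup>2 + 2 * (u - v)\<^sup>2"
    using zero_le_power2[of "2 * u - v"] by (simp add: power2_eq_square algebra_simps)
  ultimately have "c * v\<^sup>2 \<le> c * (2 * u\<^sup>2 + 2 * d\<^sup>2)" using assms by (intro mult_left_mono) auto
  also have "\<dots> = 2 * (c * u\<^sup>2) + c * (2 * d\<^sup>2)" by (simp add: algebra_simps)
  also have "c * (2 * d\<^sup>2) \<le> 1 * (2 * d\<^sup>2)" using assms by (intro mult_right_mono) auto
  finally have "c * v\<^sup>2 \<le> 2 * (c * u\<^sup>2) + 2 * d\<^sup>2" by simp
  moreover have "(2 + 2 * d\<^sup>2) * (1 + c * u\<^sup>2) = 2 + 2 * d\<^sup>2 + 2 * (c * u\<^sup>2) + 2 * (d\<^sup>2 * (c * u\<^sup>2))"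
    by (simp add: algebra_simps)
  moreover have "0 \<le> d\<^sup>2 * (c * u\<^sup>2)" using assms by simp
  ultimately have "1 + c * v\<^sup>2 \<le> (2 + 2 * d\<^sup>2) * (1 + c * u\<^sup>2)" by linarith
  moreover have "0 < 1 + c * u\<^sup>2" "0 < 1 + c * v\<^sup>2" using assms by (auto intro: add_pos_nonneg)
  ultimately show ?thesis by (simp add: field_simps)
qed

lemma gaussian_le:
  fixes c s :: real and x :: int
  assumes "0 < c" "c \<le> 1"
  shows "exp (- c * (of_int x + s)\<^sup>2) \<le> 4 * (1 / (1 + c * (of_int (x + \<lfloor>s\<rfloor>))\<^sup>2))"
proof -
  have "exp (- c * (of_int x + s)\<^sup>2) \<le> 1 / (1 + c * (of_int x + s)\<^sup>2)"
    using assms by (intro exp_minus_square_le) auto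
  also have "\<dots> \<le> (2 + 2 * 1\<^sup>2) / (1 + c * (of_int (x + \<lfloor>s\<rfloor>))\<^sup>2)"
    using assms by (intro inverse_square_compare) (auto, linarith)
  finally show ?thesis by simp
qed

lemma bij_int_shift: "bij_betw (\<lambda>x::int. x + k) UNIV UNIV"
  by (rule bij_betwI[of _ _ _ "\<lambda>x. x - k"]) auto

lemma inverse_square_shift_has_sum:
  fixes c :: real and k :: int
  assumes "0 < c" "c \<le> 1"
  shows "((\<lambda>x. 1 / (1 + c * (of_int (x + k))\<^sup>2)) has_sum
     infsum (\<lambda>n::int. 1 / (1 + c * (of_int n)\<^sup>2)) UNIV) UNIV"
  using has_sum_reindex_bij_betw[OF bij_int_shift, of "\<lambda>n::int. 1 / (1 + c * (of_int n)\<^sup>2)" k]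
    has_sum_infsum[OF sum_inverse_square_le(1)[OF assms]] by simp

lemma gaussian_summable:
  fixes c s :: real
  assumes "0 < c" "c \<le> 1"
  shows "(\<lambda>x::int. exp (- c * (of_int x + s)\<^sup>2)) summable_on UNIV"
    and "infsum (\<lambda>x::int. exp (- c * (of_int x + s)\<^sup>2)) UNIV \<le> 20 / sqrt c"
proof -
  note 1 = has_sum_cmult_right[OF inverse_square_shift_has_sum[OF assms, of "\<lfloor>s\<rfloor>"], of 4]
  show sm: "(\<lambda>x::int. exp (- c * (of_int x + s)\<^sup>2)) summable_on UNIV"
    by (rule summable_on_comparison_test[OF has_sum_imp_summable[OF 1]]) (use gaussian_le[OF assms] in auto)
  have "infsum (\<lambda>x::int. exp (- c * (of_int x + s)\<^sup>2)) UNIV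
    \<le> 4 * infsum (\<lambda>n::int. 1 / (1 + c * (of_int n)\<^sup>2)) UNIV"
    by (rule has_sum_mono[OF has_sum_infsum[OF sm] 1]) (use gaussian_le[OF assms] in auto)
  thus "infsum (\<lambda>x::int. exp (- c * (of_int x + s)\<^sup>2)) UNIV \<le> 20 / sqrt c"
    using sum_inverse_square_le(2)[OF assms] by simp
qed

lemma third_difference_mvt:
  fixes f0 f1 f2 f3 :: "real \<Rightarrow> real"
  assumes "\<And>u. (f0 has_real_derivative f1 u) (at u)" "\<And>u. (f1 has_real_derivative f2 u) (at u)"
    "\<And>u. (f2 has_real_derivative f3 u) (at u)"
  shows "\<exists>z. x < z \<and> z < x + 3 \<and> f0 (x + 3) - 3 * f0 (x + 2) + 3 * f0 (x + 1) - f0 x = f3 z"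
proof -
  have mvt: "\<exists>z>y. z < y + 1 \<and> g (y + 1) - g y = g' z"
    if "\<And>u. (g has_real_derivative g' u) (at u)" for g g' :: "real \<Rightarrow> real" and y
    using MVT2[of y "y + 1" g g'] that by auto
  have sh: "((\<lambda>u. g (u + r)) has_real_derivative g' (u + r)) (at u)"
    if "\<And>u. (g has_real_derivative g' u) (at u)" for g g' :: "real \<Rightarrow> real" and u r
    using that by (subst DERIV_shift[symmetric]) auto
  define g0 where "g0 = (\<lambda>u. f0 (u + 2) - 2 * f0 (u + 1) + f0 u)"
  define g1 where "g1 = (\<lambda>u. f1 (u + 2) - 2 * f1 (u + 1) + f1 u)"
  have "(g0 has_real_derivative g1 u) (at u)" for u
    unfolding g0_def g1_def using sh[of f0 f1] assms(1)
    by (intro DERIV_add DERIV_diff DERIV_cmult) auto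
  from mvt[OF this, of x] obtain z1 where z1: "z1 > x" "z1 < x + 1" "g0 (x + 1) - g0 x = g1 z1" by auto
  define h1 where "h1 = (\<lambda>u. f1 (u + 1) - f1 u)"
  define h2 where "h2 = (\<lambda>u. f2 (u + 1) - f2 u)"
  have "(h1 has_real_derivative h2 u) (at u)" for u
    unfolding h1_def h2_def using sh[of f1 f2] assms(2) by (intro DERIV_diff) auto
  from mvt[OF this, of z1] obtain z2 where z2: "z2 > z1" "z2 < z1 + 1" "h1 (z1 + 1) - h1 z1 = h2 z2" by auto
  from mvt[OF assms(3), of z2] obtain z3 where z3: "z3 > z2" "z3 < z2 + 1" "f2 (z2 + 1) - f2 z2 = f3 z3" by auto
  have "g1 z1 = f3 z3" using z2 z3 by (simp add: g1_def h1_def h2_def algebra_simps)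
  hence "f0 (x + 3) - 3 * f0 (x + 2) + 3 * f0 (x + 1) - f0 x = f3 z3"
    using z1(3) by (simp add: g0_def algebra_simps)
  thus ?thesis using z1 z2 z3 by (intro exI[of _ z3]) auto
qed

text \<open>The left side is the third derivative of \<open>exp (- c w\<^sup>2)\<close>. In the variable \<open>y = c w\<^sup>2\<close> a polynomial is
  weighed against \<open>exp y \<ge> (1 + y/3)\<^sup>3\<close>.\<close>
lemma gaussian_third_derivative_bound:
  fixes c w :: real
  assumes "c > 0"
  shows "\<bar>(12 * c\<^sup>2 * w - 8 * c ^ 3 * w ^ 3) * exp (- c * w\<^sup>2)\<bar> \<le> 540 * (c * sqrt c) / (1 + c * w\<^sup>2)"
proof -
  define z where "z = sqrt c * w"
  define y where "y = z\<^sup>2"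
  have sc: "sqrt c > 0" "sqrt c * sqrt c = c" using assms by auto
  have y: "y = c * w\<^sup>2" "y \<ge> 0" using assms by (simp_all add: y_def z_def power_mult_distrib)
  have eq: "12 * c\<^sup>2 * w - 8 * c ^ 3 * w ^ 3 = c * sqrt c * (12 * z - 8 * z ^ 3)"
  proof -
    have "c * sqrt c * (12 * z - 8 * z ^ 3)
      = 12 * c * (sqrt c * sqrt c) * w - 8 * c * (sqrt c * sqrt c) * (sqrt c * sqrt c) * w ^ 3"
      by (simp only: z_def power3_eq_cube) (simp only: algebra_simps)
    thus ?thesis unfolding sc(2) by (simp add: power2_eq_square power3_eq_cube)
  qed
  have "\<bar>z\<bar> \<le> 1 + y"
    using zero_le_power2[of "\<bar>z\<bar> - 1"] y(2) by (simp add: y_def power2_eq_square algebra_simps)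
  moreover have "\<bar>z\<bar> ^ 3 \<le> (1 + y)\<^sup>2"
  proof -
    have "\<bar>z\<bar> ^ 3 = \<bar>z\<bar> * y" by (simp add: y_def power3_eq_cube power2_eq_square)
    also have "\<dots> \<le> (1 + y) * (1 + y)" using \<open>\<bar>z\<bar> \<le> 1 + y\<close> y(2) by (intro mult_mono) auto
    finally show ?thesis by (simp add: power2_eq_square)
  qed
  moreover have "\<bar>12 * z - 8 * z ^ 3\<bar> \<le> 12 * \<bar>z\<bar> + 8 * \<bar>z\<bar> ^ 3"
    using abs_triangle_ineq4[of "12 * z" "8 * z ^ 3"] by (simp add: abs_mult power_abs)
  moreover have "1 + y \<le> (1 + y)\<^sup>2" using y(2) by (simp add: power2_eq_square algebra_simps)
  ultimately have "\<bar>12 * z - 8 * z ^ 3\<bar> \<le> 20 * (1 + y)\<^sup>2" by linarith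
  moreover have "(1 + y) ^ 3 \<le> 27 * exp y"
  proof -
    have "(1 + y) ^ 3 \<le> (3 * (1 + y / 3)) ^ 3" using y(2) by (intro power_mono) auto
    also have "\<dots> = 27 * (1 + y / 3) ^ 3" by (simp only: power_mult_distrib) simp
    also have "(1 + y / 3) ^ 3 \<le> exp (y / 3) ^ 3" using y(2) by (intro power_mono) auto
    also have "exp (y / 3) ^ 3 = exp y" by (simp add: exp_of_nat_mult[symmetric])
    finally show ?thesis by simp
  qed
  hence "exp (- y) * (1 + y) ^ 3 \<le> 27" by (simp add: exp_minus field_simps)
  ultimately have "\<bar>12 * z - 8 * z ^ 3\<bar> * exp (- y) * (1 + y) \<le> 540"
  proof -
    assume a: "\<bar>12 * z - 8 * z ^ 3\<bar> \<le> 20 * (1 + y)\<^sup>2" and b: "exp (- y) * (1 + y) ^ 3 \<le> 27"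
    have "\<bar>12 * z - 8 * z ^ 3\<bar> * (exp (- y) * (1 + y)) \<le> 20 * (1 + y)\<^sup>2 * (exp (- y) * (1 + y))"
      using a y(2) by (intro mult_right_mono) auto
    also have "\<dots> = 20 * (exp (- y) * (1 + y) ^ 3)" by (simp add: power2_eq_square power3_eq_cube)
    also have "\<dots> \<le> 540" using b by simp
    finally show ?thesis by (simp add: mult.assoc)
  qed
  hence "\<bar>12 * z - 8 * z ^ 3\<bar> * exp (- y) \<le> 540 / (1 + y)" using y(2) by (simp add: field_simps)
  hence "c * sqrt c * (\<bar>12 * z - 8 * z ^ 3\<bar> * exp (- y)) \<le> c * sqrt c * (540 / (1 + y))"
    using assms by (intro mult_left_mono) auto
  thus ?thesis unfolding eq using assms by (simp add: abs_mult y(1) mult_ac)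
qed

definition alt_sign :: "int \<Rightarrow> real" where "alt_sign x = (if even x then 1 else -1)"

text \<open>An alternating sum of a smooth function equals, up to a constant factor, the alternating sum of
  any of its iterated differences; three differences of a Gaussian of width \<open>c powr (-1/2)\<close> have
  total size \<open>O(c)\<close>.\<close>
lemma alternating_gaussian_bound:
  fixes c s :: real
  assumes c: "0 < c" "c \<le> 1"
  shows "\<bar>infsum (\<lambda>x::int. alt_sign x * exp (- c * (of_int x + s)\<^sup>2)) UNIV\<bar> \<le> 12000 * c"
proof -
  define g where "g = (\<lambda>u::real. exp (- c * (u + s)\<^sup>2))"
  define G where "G = infsum (\<lambda>x::int. alt_sign x * g (of_int x)) UNIV"
  have gs: "(\<lambda>x::int. g (of_int x)) summable_on UNIV"
    unfolding g_def using gaussian_summable(1)[OF c] by simp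
  have "(\<lambda>x::int. alt_sign x * g (of_int x)) summable_on UNIV"
    by (rule abs_summable_summable, rule Infinite_Sum.abs_summable_on_comparison_test'[OF gs])
       (auto simp: alt_sign_def g_def)
  hence G: "((\<lambda>x::int. alt_sign x * g (of_int x)) has_sum G) UNIV" unfolding G_def by simp
  have sh: "((\<lambda>x::int. alt_sign x * g (of_int x + of_int k)) has_sum (alt_sign k * G)) UNIV" for k
  proof -
    have "((\<lambda>x::int. alt_sign (x + k) * g (of_int (x + k))) has_sum G) UNIV"
      using has_sum_reindex_bij_betw[OF bij_int_shift, of "\<lambda>x::int. alt_sign x * g (of_int x)" k G] G by simp
    hence "((\<lambda>x::int. alt_sign k * (alt_sign (x + k) * g (of_int (x + k)))) has_sum (alt_sign k * G)) UNIV"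
      by (rule has_sum_cmult_right)
    moreover have "alt_sign k * (alt_sign (x + k) * g (of_int (x + k))) = alt_sign x * g (of_int x + of_int k)" for x
      by (simp add: alt_sign_def)
    ultimately show ?thesis by (simp only:)
  qed
  define D where "D = (\<lambda>x::int. g (of_int x + 3) - 3 * g (of_int x + 2) + 3 * g (of_int x + 1) - g (of_int x))"
  have "((\<lambda>x::int. alt_sign x * g (of_int x + of_int 3) + (-3) * (alt_sign x * g (of_int x + of_int 2))
      + 3 * (alt_sign x * g (of_int x + of_int 1)) + (-1) * (alt_sign x * g (of_int x + of_int 0)))
    has_sum (alt_sign 3 * G + (-3) * (alt_sign 2 * G) + 3 * (alt_sign 1 * G) + (-1) * (alt_sign 0 * G))) UNIV"
    by (intro has_sum_add has_sum_cmult_right sh)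
  moreover have "alt_sign 3 * G + (-3) * (alt_sign 2 * G) + 3 * (alt_sign 1 * G) + (-1) * (alt_sign 0 * G) = - 8 * G"
    by (simp add: alt_sign_def)
  moreover have "alt_sign x * g (of_int x + of_int 3) + (-3) * (alt_sign x * g (of_int x + of_int 2))
      + 3 * (alt_sign x * g (of_int x + of_int 1)) + (-1) * (alt_sign x * g (of_int x + of_int 0)) = alt_sign x * D x" for x
    by (simp add: D_def algebra_simps)
  ultimately have DG: "((\<lambda>x. alt_sign x * D x) has_sum (- 8 * G)) UNIV"
    by (simp only:)
  have Dle: "\<bar>alt_sign x * D x\<bar> \<le> 18360 * (c * sqrt c) * (1 / (1 + c * (of_int (x + \<lfloor>s\<rfloor>))\<^sup>2))" for x
  proof -
    define g3 where "g3 = (\<lambda>u. (12 * c\<^sup>2 * (u + s) - 8 * c ^ 3 * (u + s) ^ 3) * g u)"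
    have "\<exists>z. real_of_int x < z \<and> z < real_of_int x + 3 \<and>
       g (of_int x + 3) - 3 * g (of_int x + 2) + 3 * g (of_int x + 1) - g (of_int x) = g3 z"
    proof (rule third_difference_mvt)
      show Dg: "(g has_real_derivative (- 2 * c * (u + s)) * g u) (at u)" for u
        unfolding g_def by (auto intro!: derivative_eq_intros)
      show "((\<lambda>u. (- 2 * c * (u + s)) * g u) has_real_derivative
         (4 * c\<^sup>2 * (u + s)\<^sup>2 - 2 * c) * g u) (at u)" for u
        by (auto intro!: derivative_eq_intros Dg simp: power2_eq_square algebra_simps)
      show "((\<lambda>u. (4 * c\<^sup>2 * (u + s)\<^sup>2 - 2 * c) * g u) has_real_derivative g3 u) (at u)" for u
        unfolding g3_def by (auto intro!: derivative_eq_intros Dg simp: power2_eq_square power3_eq_cube algebra_simps)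
    qed
    then obtain z where z: "real_of_int x < z" "z < real_of_int x + 3" "D x = g3 z" by (auto simp: D_def)
    have "\<bar>alt_sign x * D x\<bar> = \<bar>g3 z\<bar>" by (simp add: z(3) alt_sign_def)
    also have "\<dots> \<le> 540 * (c * sqrt c) / (1 + c * (z + s)\<^sup>2)"
      unfolding g3_def g_def by (rule gaussian_third_derivative_bound[OF c(1)])
    also have "\<dots> = 540 * (c * sqrt c) * (1 / (1 + c * (z + s)\<^sup>2))" by simp
    also have "1 / (1 + c * (z + s)\<^sup>2) \<le> (2 + 2 * 4\<^sup>2) / (1 + c * (of_int (x + \<lfloor>s\<rfloor>))\<^sup>2)"
    proof (rule inverse_square_compare)
      show "\<bar>z + s - real_of_int (x + \<lfloor>s\<rfloor>)\<bar> \<le> 4" using z by (simp add: abs_le_iff) linarith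
    qed (use c in auto)
    finally show ?thesis using c by (simp add: mult_left_mono)
  qed
  have "norm (- 8 * G) \<le> 18360 * (c * sqrt c) * infsum (\<lambda>n::int. 1 / (1 + c * (of_int n)\<^sup>2)) UNIV"
    by (rule norm_infsum_le[OF DG has_sum_cmult_right[OF inverse_square_shift_has_sum[OF c, of "\<lfloor>s\<rfloor>"]]])
       (use Dle in simp)
  also have "\<dots> \<le> 18360 * (c * sqrt c) * (5 / sqrt c)"
    using c sum_inverse_square_le(2)[OF c] by (intro mult_left_mono) auto
  \<comment> \<open>The factors are the derivative bound 540, the cost \<open>34 = 2 + 2 * 4\<^sup>2\<close> of moving the intermediate
    point, and the sum bound 5.\<close>
  also have "\<dots> = 91800 * c" using c by simp
  finally have "\<bar>G\<bar> \<le> 12000 * c" using c by simp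
  thus ?thesis by (simp add: G_def g_def)
qed

definition theta_term :: "real \<Rightarrow> real \<Rightarrow> real \<Rightarrow> real \<Rightarrow> int \<times> int \<Rightarrow> real" where
  "theta_term a b d t = (\<lambda>(x, y). exp (- t * (a * (of_int x)\<^sup>2 + 2 * b * of_int x * of_int y + d * (of_int y)\<^sup>2)))"

lemma theta_term_nonneg [simp]: "theta_term a b d t p \<ge> 0"
  by (simp add: theta_term_def case_prod_unfold)

text \<open>Completing the square reduces the form to one-dimensional Gaussians: the alternating sums over \<open>x\<close> are
  \<open>O(t)\<close>, and the Gaussian sum over \<open>y\<close> is \<open>O(t powr (-1/2))\<close>.\<close>
lemma alternating_theta_tendsto:
  fixes a b d :: real
  assumes a: "a > 0" and disc: "a * d - b\<^sup>2 > 0"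
  defines "F \<equiv> theta_term a b d"
  shows "\<forall>\<^sub>F t in at_right 0. F t summable_on UNIV"
    and "((\<lambda>t. infsum (\<lambda>(x, y). alt_sign x * F t (x, y)) UNIV) \<longlongrightarrow> 0) (at_right 0)"
proof -
  define e where "e = (a * d - b\<^sup>2) / a"
  have e: "e > 0" using a disc by (simp add: e_def)
  define t0 where "t0 = min (1 / a) (1 / e)"
  have t0: "t0 > 0" using a e by (simp add: t0_def)
  have sq: "F t (x, y) = exp (- (t * e) * (of_int y + 0)\<^sup>2) * exp (- (t * a) * (of_int x + b * of_int y / a)\<^sup>2)" for t x y
  proof -
    have eq: "a * (of_int x)\<^sup>2 + 2 * b * of_int x * of_int y + d * (of_int y)\<^sup>2
      = e * (of_int y)\<^sup>2 + a * (of_int x + b * of_int y / a)\<^sup>2"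
      using a by (simp add: e_def power2_eq_square field_simps)
    show ?thesis by (simp only: F_def theta_term_def prod.case eq mult_exp_exp add_0_right) (simp add: algebra_simps)
  qed
  have main: "F t summable_on UNIV \<and> \<bar>infsum (\<lambda>(x, y). alt_sign x * F t (x, y)) UNIV\<bar> \<le> (240000 * a / sqrt e) * sqrt t"
    if t: "0 < t" "t < t0" for t
  proof -
    have ta: "0 < t * a" "t * a \<le> 1" and te: "0 < t * e" "t * e \<le> 1"
      using t a e by (auto simp: t0_def field_simps)
    define H where "H = (\<lambda>(y::int, x::int). F t (x, y))"
    have bij: "bij_betw prod.swap (UNIV :: (int \<times> int) set) UNIV"
      by (rule bij_betwI[of _ _ _ prod.swap]) auto
    have inner: "((\<lambda>x. H (y, x)) has_sum
        exp (- (t * e) * (of_int y + 0)\<^sup>2) * infsum (\<lambda>x::int. exp (- (t * a) * (of_int x + b * of_int y / a)\<^sup>2)) UNIV) UNIV" for y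
      unfolding H_def prod.case sq
      by (intro has_sum_cmult_right has_sum_infsum gaussian_summable(1) ta)
    have y_sum: "((\<lambda>y::int. exp (- (t * e) * (of_int y + 0)\<^sup>2)) has_sum
        infsum (\<lambda>y::int. exp (- (t * e) * (of_int y + 0)\<^sup>2)) UNIV) UNIV"
      by (intro has_sum_infsum gaussian_summable(1) te)
    have outer: "(\<lambda>y::int. exp (- (t * e) * (of_int y + 0)\<^sup>2) *
        infsum (\<lambda>x::int. exp (- (t * a) * (of_int x + b * of_int y / a)\<^sup>2)) UNIV) summable_on UNIV"
    proof (rule summable_on_comparison_test[OF has_sum_imp_summable[OF has_sum_cmult_left[OF y_sum, of "20 / sqrt (t * a)"]]])
      fix y :: int
      show "exp (- (t * e) * (of_int y + 0)\<^sup>2) * infsum (\<lambda>x::int. exp (- (t * a) * (of_int x + b * of_int y / a)\<^sup>2)) UNIV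
         \<le> exp (- (t * e) * (of_int y + 0)\<^sup>2) * (20 / sqrt (t * a))"
        by (intro mult_left_mono gaussian_summable(2) ta) auto
      show "0 \<le> exp (- (t * e) * (of_int y + 0)\<^sup>2) * infsum (\<lambda>x::int. exp (- (t * a) * (of_int x + b * of_int y / a)\<^sup>2)) UNIV"
        by (intro mult_nonneg_nonneg infsum_nonneg) auto
    qed
    have "H summable_on (UNIV \<times> UNIV)"
      by (rule summable_on_SigmaI[OF inner outer]) (auto simp: H_def F_def theta_term_def)
    hence Hs: "H summable_on UNIV" by simp
    hence Fs: "F t summable_on UNIV"
      using summable_on_reindex_bij_betw[OF bij, of "F t"] by (simp add: H_def case_prod_unfold prod.swap_def)
    define K where "K = (\<lambda>(y::int, x::int). alt_sign x * F t (x, y))"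
    have "K summable_on UNIV"
      by (rule abs_summable_summable, rule Infinite_Sum.abs_summable_on_comparison_test'[OF Hs])
         (auto simp: K_def H_def F_def alt_sign_def)
    hence Ks: "(K has_sum infsum K UNIV) (UNIV \<times> UNIV)" by simp
    have Kinner: "((\<lambda>x. K (y, x)) has_sum
        exp (- (t * e) * (of_int y + 0)\<^sup>2) * infsum (\<lambda>x::int. alt_sign x * exp (- (t * a) * (of_int x + b * of_int y / a)\<^sup>2)) UNIV) UNIV" for y
    proof -
      have "(\<lambda>x::int. alt_sign x * exp (- (t * a) * (of_int x + b * of_int y / a)\<^sup>2)) summable_on UNIV"
        by (rule abs_summable_summable,
            rule Infinite_Sum.abs_summable_on_comparison_test'[OF gaussian_summable(1)[OF ta, of "b * of_int y / a"]])
           (auto simp: alt_sign_def)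
      thus ?thesis unfolding K_def prod.case sq
        by (subst mult.left_commute) (intro has_sum_cmult_right has_sum_infsum)
    qed
    have "norm (infsum K UNIV) \<le> infsum (\<lambda>y::int. exp (- (t * e) * (of_int y + 0)\<^sup>2)) UNIV * (12000 * (t * a))"
    proof (rule norm_infsum_le[OF has_sum_SigmaD[OF Ks Kinner] has_sum_cmult_left[OF y_sum]])
      fix y :: int
      show "norm (exp (- (t * e) * (of_int y + 0)\<^sup>2) * infsum (\<lambda>x::int. alt_sign x * exp (- (t * a) * (of_int x + b * of_int y / a)\<^sup>2)) UNIV)
        \<le> exp (- (t * e) * (of_int y + 0)\<^sup>2) * (12000 * (t * a))"
        unfolding real_norm_def abs_mult
        by (intro mult_mono alternating_gaussian_bound ta) auto
    qed
    also have "\<dots> \<le> 20 / sqrt (t * e) * (12000 * (t * a))"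
      using ta by (intro mult_right_mono gaussian_summable(2) te) auto
    also have "\<dots> = (240000 * a / sqrt e) * (t / sqrt t)"
      using t e by (simp add: real_sqrt_mult mult_ac)
    also have "t / sqrt t = sqrt t" using t by (simp add: real_div_sqrt)
    finally have "\<bar>infsum K UNIV\<bar> \<le> (240000 * a / sqrt e) * sqrt t" by simp
    moreover have "infsum K UNIV = infsum (\<lambda>(x, y). alt_sign x * F t (x, y)) UNIV"
      using infsum_reindex_bij_betw[OF bij, of "\<lambda>(x, y). alt_sign x * F t (x, y)"]
      by (simp add: K_def case_prod_unfold prod.swap_def)
    ultimately show ?thesis using Fs by simp
  qed
  have ev: "\<forall>\<^sub>F t in at_right 0. 0 < t \<and> t < t0"
    using t0 eventually_at_right_field by blast
  show "\<forall>\<^sub>F t in at_right 0. F t summable_on UNIV"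
    using ev by eventually_elim (use main in blast)
  show "((\<lambda>t. infsum (\<lambda>(x, y). alt_sign x * F t (x, y)) UNIV) \<longlongrightarrow> 0) (at_right 0)"
  proof (rule Lim_null_comparison)
    show "\<forall>\<^sub>F t in at_right 0. norm (infsum (\<lambda>(x, y). alt_sign x * F t (x, y)) UNIV) \<le> (240000 * a / sqrt e) * sqrt t"
      using ev by eventually_elim (use main in simp)
    have "((\<lambda>t. (240000 * a / sqrt e) * sqrt t) \<longlongrightarrow> (240000 * a / sqrt e) * sqrt 0) (at_right 0)"
      by (intro tendsto_mult tendsto_const tendsto_real_sqrt tendsto_ident_at)
    thus "((\<lambda>t. (240000 * a / sqrt e) * sqrt t) \<longlongrightarrow> 0) (at_right 0)" by simp
  qed
qed

text \<open>The series at \<open>4 t\<close> is the sum over vectors with even coordinates. Four times the indicator function of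
  these vectors minus 1 is the sum of the three nontrivial sign characters modulo 2, and a linear change of
  variables turns each of them into \<open>(-1)\<^sup>x\<close>.\<close>
lemma theta_no_constant_term:
  fixes a b d :: real
  assumes a: "a > 0" and disc: "a * d - b\<^sup>2 > 0"
  shows "((\<lambda>t. 4 * infsum (theta_term a b d (4 * t)) UNIV - infsum (theta_term a b d t) UNIV) \<longlongrightarrow> 0) (at_right 0)"
proof -
  have d: "d > 0"
  proof -
    have "a * d > 0" using disc zero_le_power2[of b] by linarith
    thus ?thesis using a by (simp add: zero_less_mult_iff)
  qed
  define S1 where "S1 = (\<lambda>t. infsum (\<lambda>(x, y). alt_sign x * theta_term a b d t (x, y)) UNIV)"
  define S2 where "S2 = (\<lambda>t. infsum (\<lambda>(x, y). alt_sign y * theta_term a b d t (x, y)) UNIV)"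
  define S3 where "S3 = (\<lambda>t. infsum (\<lambda>(x, y). alt_sign (x + y) * theta_term a b d t (x, y)) UNIV)"
  have 1: "(S1 \<longlongrightarrow> 0) (at_right 0)" and ev: "\<forall>\<^sub>F t in at_right 0. theta_term a b d t summable_on UNIV"
    using alternating_theta_tendsto[OF a disc] unfolding S1_def by simp_all
  have 2: "(S2 \<longlongrightarrow> 0) (at_right 0)"
  proof -
    have bij: "bij_betw prod.swap (UNIV :: (int \<times> int) set) UNIV"
      by (rule bij_betwI[of _ _ _ prod.swap]) auto
    have "S2 = (\<lambda>t. infsum (\<lambda>(x, y). alt_sign x * theta_term d b a t (x, y)) UNIV)"
      unfolding S2_def
      by (rule ext, subst infsum_reindex_bij_betw[OF bij, symmetric])
         (simp add: theta_term_def case_prod_unfold prod.swap_def algebra_simps)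
    thus ?thesis using alternating_theta_tendsto(2)[OF d, of a b] disc by (simp add: mult.commute)
  qed
  have 3: "(S3 \<longlongrightarrow> 0) (at_right 0)"
  proof -
    have bij: "bij_betw (\<lambda>(x, y). (x - y, y)) (UNIV :: (int \<times> int) set) UNIV"
      by (rule bij_betwI[of _ _ _ "\<lambda>(x, y). (x + y, y)"]) auto
    have "S3 = (\<lambda>t. infsum (\<lambda>(x, y). alt_sign x * theta_term a (b - a) (a - 2 * b + d) t (x, y)) UNIV)"
      unfolding S3_def
      by (rule ext, subst infsum_reindex_bij_betw[OF bij, symmetric])
         (simp add: theta_term_def case_prod_unfold algebra_simps power2_eq_square)
    moreover have "a * (a - 2 * b + d) - (b - a)\<^sup>2 > 0" using disc by (simp add: power2_eq_square algebra_simps)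
    ultimately show ?thesis using alternating_theta_tendsto(2)[OF a, of "a - 2 * b + d" "b - a"] by simp
  qed
  have "\<forall>\<^sub>F t in at_right 0. S1 t + S2 t + S3 t
      = 4 * infsum (theta_term a b d (4 * t)) UNIV - infsum (theta_term a b d t) UNIV"
    using ev
  proof eventually_elim
    case (elim t)
    define E where "E = {(x::int, y::int). even x \<and> even y}"
    define T where "T = theta_term a b d t"
    have T0: "T p \<ge> 0" for p by (auto simp: T_def theta_term_def split: prod.split)
    have sg: "(\<lambda>(x, y). s x y * T (x, y)) summable_on UNIV" if "\<And>x y. \<bar>s x y\<bar> \<le> 1" for s :: "int \<Rightarrow> int \<Rightarrow> real"
    proof (rule abs_summable_summable, rule Infinite_Sum.abs_summable_on_comparison_test'[of T])
      fix p :: "int \<times> int"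
      show "norm (case p of (x, y) \<Rightarrow> s x y * T (x, y)) \<le> T p"
        using that T0 by (cases p) (auto simp: abs_mult intro: mult_left_le_one_le)
    qed (use elim T_def in simp)
    have "((\<lambda>p. (case p of (x, y) \<Rightarrow> alt_sign x * T (x, y)) + (case p of (x, y) \<Rightarrow> alt_sign y * T (x, y))
       + (case p of (x, y) \<Rightarrow> alt_sign (x + y) * T (x, y)) + T p) has_sum (S1 t + S2 t + S3 t + infsum T UNIV)) UNIV"
      unfolding S1_def S2_def S3_def T_def[symmetric]
      by (intro has_sum_add has_sum_infsum sg) (use elim T_def in \<open>auto simp: alt_sign_def\<close>)
    moreover have "(case p of (x, y) \<Rightarrow> alt_sign x * T (x, y)) + (case p of (x, y) \<Rightarrow> alt_sign y * T (x, y))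
       + (case p of (x, y) \<Rightarrow> alt_sign (x + y) * T (x, y)) + T p = (if p \<in> E then 4 * T p else 0)" for p
      by (cases p) (auto simp: E_def alt_sign_def)
    ultimately have "((\<lambda>p. if p \<in> E then 4 * T p else 0) has_sum (S1 t + S2 t + S3 t + infsum T UNIV)) UNIV"
      by simp
    hence "((\<lambda>p. 4 * T p) has_sum (S1 t + S2 t + S3 t + infsum T UNIV)) E"
      by (subst has_sum_cong_neutral[where S = UNIV and f = "\<lambda>p. if p \<in> E then 4 * T p else 0", symmetric]) auto
    moreover have bij: "bij_betw (\<lambda>(x, y). (2 * x, 2 * y)) (UNIV :: (int \<times> int) set) E"
      by (rule bij_betwI[of _ _ _ "\<lambda>(x, y). (x div 2, y div 2)"]) (auto simp: E_def)
    ultimately have "((\<lambda>p. 4 * T (case p of (x, y) \<Rightarrow> (2 * x, 2 * y))) has_sum (S1 t + S2 t + S3 t + infsum T UNIV)) UNIV"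
      using has_sum_reindex_bij_betw[OF bij, of "\<lambda>p. 4 * T p"] by blast
    moreover have "T (case p of (x, y) \<Rightarrow> (2 * x, 2 * y)) = theta_term a b d (4 * t) p" for p
      by (cases p) (simp add: T_def theta_term_def power2_eq_square algebra_simps)
    ultimately have h: "((\<lambda>p. 4 * theta_term a b d (4 * t) p) has_sum (S1 t + S2 t + S3 t + infsum T UNIV)) UNIV"
      by simp
    have "4 * infsum (theta_term a b d (4 * t)) UNIV = infsum (\<lambda>p. 4 * theta_term a b d (4 * t) p) UNIV"
      by (simp add: infsum_cmult_right')
    also have "\<dots> = S1 t + S2 t + S3 t + infsum T UNIV" using h by (rule infsumI)
    finally show ?case by (simp add: T_def)
  qed
  moreover have "((\<lambda>t. S1 t + S2 t + S3 t) \<longlongrightarrow> 0 + 0 + 0) (at_right 0)"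
    by (intro tendsto_add 1 2 3)
  ultimately show ?thesis by (simp add: tendsto_cong)
qed

section \<open>Lattices and the ring of integers\<close>

text \<open>If the denominator were greater than 1, its powers would divide \<open>M\<close>.\<close>
lemma rational_power_bounded_denominator:
  fixes x :: real
  assumes x: "x \<in> \<rat>" and M: "M \<noteq> 0" and pow: "\<And>n. of_int M * x ^ n \<in> \<int>"
  shows "x \<in> \<int>"
proof -
  from x obtain a b :: int where ab: "b > 0" "coprime a b" "x = of_int a / of_int b"
    by (elim Rats_cases')
  have dvd: "b ^ n dvd M" for n
  proof -
    obtain z where z: "of_int M * x ^ n = of_int z" using pow[of n] by (elim Ints_cases)
    hence "of_int M * of_int a ^ n = (of_int z :: real) * of_int b ^ n"
      using ab by (simp add: power_divide field_simps)
    hence "M * a ^ n = z * b ^ n" by (simp flip: of_int_power of_int_mult)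
    hence "b ^ n dvd M * a ^ n" by simp
    moreover have "coprime (b ^ n) (a ^ n)" using ab(2) by (simp add: coprime_commute)
    ultimately show ?thesis by (simp add: coprime_dvd_mult_left_iff)
  qed
  have "b = 1"
  proof (rule ccontr)
    assume "b \<noteq> 1"
    hence b2: "b \<ge> 2" using ab(1) by simp
    define n where "n = nat \<bar>M\<bar>"
    have "int n < 2 ^ n" using of_nat_less_two_power[of n, where 'a = int] by simp
    also have "\<dots> \<le> b ^ n" using b2 by (intro power_mono) auto
    also have "\<dots> \<le> \<bar>M\<bar>" using dvd[of n] M by (intro zdvd_imp_le) auto
    finally show False by (simp add: n_def)
  qed
  thus ?thesis using ab by simp
qed

lemma int_subgroup_cyclic:
  fixes S :: "int set"
  assumes add: "\<And>x y. x \<in> S \<Longrightarrow> y \<in> S \<Longrightarrow> x + y \<in> S" and minus: "\<And>x. x \<in> S \<Longrightarrow> - x \<in> S"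
    and nz: "a \<in> S" "a \<noteq> 0"
  obtains g where "g > 0" "\<And>x. x \<in> S \<longleftrightarrow> g dvd x"
proof -
  define n where "n = (LEAST n. n > 0 \<and> int n \<in> S)"
  have ex: "nat \<bar>a\<bar> > 0 \<and> int (nat \<bar>a\<bar>) \<in> S" using nz minus[of a] by (auto simp: abs_if)
  have n: "n > 0 \<and> int n \<in> S" unfolding n_def by (rule LeastI[of "\<lambda>n. n > 0 \<and> int n \<in> S", OF ex])
  have least: "n \<le> k" if "k > 0" "int k \<in> S" for k
    unfolding n_def by (rule Least_le) (use that in simp)
  have zero: "0 \<in> S" using add[OF nz(1) minus[OF nz(1)]] by simp
  have mult_nat: "int k * int n \<in> S" for k
    by (induction k) (use zero n add in \<open>auto simp: algebra_simps\<close>)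
  have mult: "k * int n \<in> S" for k
  proof (cases "k \<ge> 0")
    case True thus ?thesis using mult_nat[of "nat k"] by simp
  next
    case False thus ?thesis using minus[OF mult_nat[of "nat (-k)"]] by simp
  qed
  have "x \<in> S \<longleftrightarrow> int n dvd x" for x
  proof
    assume x: "x \<in> S"
    have "x mod int n = x + (- (x div int n)) * int n" by (simp add: minus_div_mult_eq_mod)
    hence xm: "x mod int n \<in> S" using add[OF x mult[of "- (x div int n)"]] by simp
    show "int n dvd x"
    proof (rule ccontr)
      assume "\<not> int n dvd x"
      hence "x mod int n \<noteq> 0" by (simp add: mod_eq_0_iff_dvd)
      moreover have "x mod int n \<ge> 0" using n by simp
      ultimately have pos: "x mod int n > 0" by simp
      hence "n \<le> nat (x mod int n)" using xm by (intro least) auto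
      hence "int n \<le> x mod int n" using pos by (simp add: le_nat_iff)
      moreover have "x mod int n < int n" using n by simp
      ultimately show False by simp
    qed
  qed (use mult in \<open>auto simp: dvd_def mult.commute\<close>)
  thus ?thesis using n that[of "int n"] by simp
qed

definition lattice :: "complex \<Rightarrow> complex \<Rightarrow> complex set" where
  "lattice a b = {of_int x * a + of_int y * b | x y. True}"

lemma lattice_scale: "(*) c ` lattice a b = lattice (c * a) (c * b)"
proof -
  have "c * (of_int x * a + of_int y * b) = of_int x * (c * a) + of_int y * (c * b)" for x y
    by (simp add: algebra_simps)
  thus ?thesis unfolding lattice_def by (auto simp: image_iff) metis+
qed

lemma lattice_swap: "lattice a b = lattice b a"
  unfolding lattice_def by (rule Collect_cong) (metis add.commute)

lemma lattice_minus: "lattice a (- b) = lattice a b"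
proof -
  have "lattice a (- b) \<subseteq> lattice a b" for b
  proof
    fix z assume "z \<in> lattice a (- b)"
    then obtain x y where "z = of_int x * a + of_int y * (- b)" unfolding lattice_def by blast
    hence "z = of_int x * a + of_int (- y) * b" by simp
    thus "z \<in> lattice a b" unfolding lattice_def by blast
  qed
  from this[of b] this[of "- b"] show ?thesis by auto
qed

lemma lattice_shift: "lattice a (b + of_int k * a) = lattice a b"
proof -
  have "lattice a (b + of_int k * a) \<subseteq> lattice a b" for b k
  proof
    fix z assume "z \<in> lattice a (b + of_int k * a)"
    then obtain x y where "z = of_int x * a + of_int y * (b + of_int k * a)" unfolding lattice_def by blast
    hence "z = of_int (x + y * k) * a + of_int y * b" by (simp add: algebra_simps)
    thus "z \<in> lattice a b" unfolding lattice_def by blast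
  qed
  from this[of b k] this[of "b + of_int k * a" "- k"] show ?thesis by auto
qed

lemma lattice_basis: "a \<in> lattice a b" "b \<in> lattice a b"
proof -
  have "a = of_int 1 * a + of_int 0 * b" "b = of_int 0 * a + of_int 1 * b" by simp_all
  thus "a \<in> lattice a b" "b \<in> lattice a b" unfolding lattice_def by blast+
qed

text \<open>Two bases of the same lattice differ by an integer matrix with integer inverse, so the covolume
  does not depend on the basis.\<close>
lemma lattice_covolume:
  assumes "lattice a b = lattice a' b'"
  shows "\<bar>Im (cnj a * b)\<bar> = \<bar>Im (cnj a' * b')\<bar>"
proof -
  have *: "\<exists>d::int. Im (cnj a' * b') = of_int d * Im (cnj a * b)" if "lattice a b = lattice a' b'" for a b a' b'
  proof -
    have "a' \<in> lattice a b" "b' \<in> lattice a b" using lattice_basis that by auto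
    then obtain x y z w where "a' = of_int x * a + of_int y * b" "b' = of_int z * a + of_int w * b"
      unfolding lattice_def by blast
    hence "Im (cnj a' * b') = of_int (x * w - y * z) * Im (cnj a * b)" by (simp add: algebra_simps)
    thus ?thesis by blast
  qed
  obtain d d' :: int where d: "Im (cnj a' * b') = of_int d * Im (cnj a * b)"
    "Im (cnj a * b) = of_int d' * Im (cnj a' * b')" using *[OF assms] *[OF assms[symmetric]] by blast
  show ?thesis
  proof (cases "Im (cnj a * b) = 0")
    case True thus ?thesis using d by simp
  next
    case False
    have "Im (cnj a * b) = of_int (d' * d) * Im (cnj a * b)" using d by (simp add: mult.assoc)
    hence "of_int (d' * d) = (1 :: real)" using False by simp
    hence "d' * d = 1" by linarith
    hence "\<bar>d\<bar> = 1" by (metis abs_mult abs_one zmult_eq_1_iff mult.commute abs_minus_cancel)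
    thus ?thesis using d(1) by (simp add: abs_mult flip: of_int_abs)
  qed
qed

lemma Re_of_rat [simp]: "Re (of_rat q) = of_rat q" and Im_of_rat [simp]: "Im (of_rat q) = 0"
proof -
  have "of_rat q = (of_real (of_rat q) :: complex)" by (cases q) (simp add: of_rat_rat)
  thus "Re (of_rat q) = of_rat q" "Im (of_rat q) = 0" by simp_all
qed

text \<open>Real parts of products are simplified through the coordinates with respect to 1 and \<open>sqrt m\<close> instead
  (\<open>Re_mult\<close> below).\<close>
declare times_complex.sel(1) [simp del]

context imag_quadratic
begin

definition sqrtm :: complex where "sqrtm = csqrt (of_int m)"
definition sqrt_abs :: real where "sqrt_abs = sqrt (- of_int m)"

abbreviation "K \<equiv> quad_field m"
abbreviation "OK \<equiv> ring_of_integers K"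

lemma sqrt_abs_pos: "sqrt_abs > 0" using m_less by (simp add: sqrt_abs_def)

lemma sqrt_abs_square: "sqrt_abs * sqrt_abs = - of_int m" using m_less by (simp add: sqrt_abs_def)

text \<open>The coordinate along \<open>sqrt m\<close>.\<close>
definition imc :: "complex \<Rightarrow> real" where "imc z = Im z / sqrt_abs"

lemma Im_eq: "Im z = sqrt_abs * imc z"
  using sqrt_abs_pos by (simp add: imc_def)

lemma imc_simps [simp]: "imc (x + y) = imc x + imc y" "imc (x - y) = imc x - imc y" "imc (- x) = - imc x"
    "imc (of_real a) = 0" "imc (of_int i) = 0" "imc (of_nat j) = 0" "imc 1 = 0" "imc 0 = 0"
    "imc (of_rat q) = 0" "imc (cnj x) = - imc x" "imc (numeral k) = 0"
  by (simp_all add: imc_def add_divide_distrib diff_divide_distrib)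

lemma complex_eq_imc_iff: "x = y \<longleftrightarrow> Re x = Re y \<and> imc x = imc y"
  using sqrt_abs_pos by (simp add: complex_eq_iff imc_def)

lemma imc_mult [simp]: "imc (x * y) = Re x * imc y + imc x * Re y"
  by (simp add: imc_def add_divide_distrib)

lemma Re_mult [simp]: "Re (x * y) = Re x * Re y + of_int m * (imc x * imc y)"
proof -
  have "Im x * Im y = - of_int m * (imc x * imc y)"
    unfolding Im_eq sqrt_abs_square[symmetric] by (simp add: algebra_simps)
  thus ?thesis by (simp add: times_complex.sel(1))
qed

lemma norm_square_eq: "(norm z)\<^sup>2 = (Re z)\<^sup>2 - of_int m * (imc z)\<^sup>2"
proof -
  have "(Im z)\<^sup>2 = - of_int m * (imc z)\<^sup>2"
    unfolding Im_eq sqrt_abs_square[symmetric] power2_eq_square by (simp add: algebra_simps)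
  thus ?thesis by (simp add: cmod_power2)
qed

lemma sqrtm_eq: "sqrtm = Complex 0 sqrt_abs"
  using m_less by (simp add: sqrtm_def sqrt_abs_def complex_eq_iff)

lemma Re_sqrtm [simp]: "Re sqrtm = 0" and Im_sqrtm [simp]: "Im sqrtm = sqrt_abs"
  by (simp_all add: sqrtm_eq)

lemma imc_sqrtm [simp]: "imc sqrtm = 1"
  using sqrt_abs_pos by (simp add: imc_def)

lemma K_iff: "z \<in> K \<longleftrightarrow> Re z \<in> \<rat> \<and> imc z \<in> \<rat>"
proof
  assume "z \<in> K"
  then obtain a b :: rat where "z = of_rat a + of_rat b * sqrtm"
    by (auto simp: quad_field_def sqrtm_def)
  thus "Re z \<in> \<rat> \<and> imc z \<in> \<rat>" by (simp add: Re_mult)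
next
  assume "Re z \<in> \<rat> \<and> imc z \<in> \<rat>"
  then obtain a b :: rat where "Re z = of_rat a" "imc z = of_rat b" by (auto elim!: Rats_cases)
  hence "z = of_rat a + of_rat b * sqrtm" by (simp add: complex_eq_imc_iff Re_mult)
  thus "z \<in> K" by (auto simp: quad_field_def sqrtm_def)
qed

lemma K_mult: "x \<in> K \<Longrightarrow> y \<in> K \<Longrightarrow> x * y \<in> K"
  by (simp add: K_iff Re_mult)

lemma K_inverse: "x \<in> K \<Longrightarrow> inverse x \<in> K"
proof -
  assume x: "x \<in> K"
  define n where "n = (norm x)\<^sup>2"
  have n: "n \<in> \<rat>" using x by (simp add: n_def norm_square_eq K_iff)
  have "Re (inverse x) = Re x / n" "imc (inverse x) = - imc x / n"
    unfolding n_def cmod_power2 by (simp_all add: imc_def)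
  thus ?thesis using x n unfolding K_iff by (simp only: Rats_divide Rats_minus_iff)
qed

lemma K_1: "1 \<in> K" by (simp add: K_iff)

text \<open>The lattice of the numbers \<open>a + b sqrt m\<close> with integers \<open>a\<close> and \<open>b\<close>.\<close>
definition int_lattice :: "complex set" where
  "int_lattice = {z. Re z \<in> \<int> \<and> imc z \<in> \<int>}"

lemma int_lattice_mult: "x \<in> int_lattice \<Longrightarrow> y \<in> int_lattice \<Longrightarrow> x * y \<in> int_lattice"
  by (simp add: int_lattice_def Re_mult)

lemma int_lattice_add: "x \<in> int_lattice \<Longrightarrow> y \<in> int_lattice \<Longrightarrow> x + y \<in> int_lattice"
  by (simp add: int_lattice_def)

lemma int_lattice_of_int: "of_int k \<in> int_lattice"
  by (simp add: int_lattice_def)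

lemma int_lattice_sum: "(\<And>i. i \<in> A \<Longrightarrow> f i \<in> int_lattice) \<Longrightarrow> sum f A \<in> int_lattice"
  by (induction A rule: infinite_finite_induct)
     (use int_lattice_add int_lattice_of_int[of 0] in auto)

lemma int_lattice_subset_OK: "int_lattice \<subseteq> OK"
proof
  fix z assume z: "z \<in> int_lattice"
  then obtain a b :: int where ab: "Re z = of_int a" "imc z = of_int b"
    by (auto simp: int_lattice_def elim!: Ints_cases)
  define p :: "complex poly" where "p = [:of_int (a\<^sup>2 - b\<^sup>2 * m), of_int (- 2 * a), 1:]"
  have "poly p z = 0"
    by (simp add: p_def complex_eq_imc_iff Re_mult ab power2_eq_square algebra_simps)
  moreover have "lead_coeff p = 1" "\<forall>i. Polynomial.coeff p i \<in> \<int>"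
    by (auto simp: p_def coeff_pCons split: nat.splits)
  ultimately have "algebraic_int z" by (intro algebraic_int.intros)
  moreover have "z \<in> K" unfolding K_iff using ab by simp
  ultimately show "z \<in> OK" by (simp add: ring_of_integers_def)
qed

text \<open>The powers below the degree of a monic equation for \<open>z\<close> have a common denominator, and the equation
  expresses the higher powers through them.\<close>
lemma algebraic_int_powers_bounded:
  assumes z: "z \<in> K" "algebraic_int z"
  obtains M :: int where "M \<noteq> 0" "\<And>n. of_int M * z ^ n \<in> int_lattice"
proof -
  from z(1) obtain a b c d :: int where abcd: "b > 0" "d > 0" "Re z = of_int a / of_int b" "imc z = of_int c / of_int d"
    unfolding K_iff by (metis Rats_cases')
  define e where "e = b * d"
  have e: "e > 0" using abcd by (simp add: e_def)
  have "of_int e * z \<in> int_lattice"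
  proof -
    have "Re (of_int e * z) = of_int (a * d)" "imc (of_int e * z) = of_int (b * c)"
      using abcd by (simp_all add: e_def Re_mult field_simps)
    thus ?thesis by (simp add: int_lattice_def)
  qed
  hence pow: "(of_int e * z) ^ n \<in> int_lattice" for n
    by (induction n) (use int_lattice_of_int[of 1] int_lattice_mult in auto)
  from z(2) obtain p where p: "lead_coeff p = 1" "\<forall>i. Polynomial.coeff p i \<in> \<int>" "poly p z = 0"
    by (auto elim: algebraic_int.cases)
  define D where "D = degree p"
  \<comment> \<open>\<open>e\<close> clears the denominators of \<open>z\<close>, so \<open>e ^ D\<close> clears those of all powers up to the degree.\<close>
  define M where "M = e ^ D"
  have "of_int M * z ^ n \<in> int_lattice" for n
  proof (induction n rule: less_induct)
    case (less n)
    show ?case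
    proof (cases "n \<le> D")
      case True
      have "of_int M * z ^ n = of_int (e ^ (D - n)) * (of_int e * z) ^ n"
        using True by (simp add: M_def power_mult_distrib mult.assoc[symmetric] power_add[symmetric])
      thus ?thesis using int_lattice_mult[OF int_lattice_of_int pow] by (metis)
    next
      case False
      have "0 = (\<Sum>i\<le>D. Polynomial.coeff p i * z ^ i)" using p(3) by (simp add: poly_altdef D_def)
      also have "\<dots> = (\<Sum>i<D. Polynomial.coeff p i * z ^ i) + z ^ D"
        using p(1) by (simp add: lessThan_Suc_atMost[symmetric] D_def)
      finally have "z ^ D = - (\<Sum>i<D. Polynomial.coeff p i * z ^ i)" by (simp add: eq_neg_iff_add_eq_0 add.commute)
      moreover have "z ^ n = z ^ D * z ^ (n - D)" using False by (simp add: power_add[symmetric])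
      ultimately have "of_int M * z ^ n = (\<Sum>i<D. (- Polynomial.coeff p i) * (of_int M * z ^ (i + (n - D))))"
        by (simp add: sum_distrib_left sum_distrib_right sum_negf power_add mult_ac)
      moreover have "(- Polynomial.coeff p i) * (of_int M * z ^ (i + (n - D))) \<in> int_lattice" if "i < D" for i
      proof -
        obtain k where k: "Polynomial.coeff p i = of_int k" using p(2) by (metis Ints_cases)
        have "of_int M * z ^ (i + (n - D)) \<in> int_lattice" using less that False by simp
        hence "of_int (- k) * (of_int M * z ^ (i + (n - D))) \<in> int_lattice"
          by (rule int_lattice_mult[OF int_lattice_of_int])
        thus ?thesis by (simp add: k)
      qed
      ultimately show ?thesis using int_lattice_sum[of "{..<D}"] by simp
    qed
  qed
  moreover have "M \<noteq> 0" using e by (simp add: M_def)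
  ultimately show ?thesis using that by blast
qed

lemma norm_int_lattice: "z \<in> int_lattice \<Longrightarrow> (norm z)\<^sup>2 \<in> \<int>"
proof -
  assume z: "z \<in> int_lattice"
  thus ?thesis by (simp add: int_lattice_def norm_square_eq)
qed

lemma norm_square_in_Ints:
  assumes z: "z \<in> K" and M: "M \<noteq> 0" "\<And>n. of_int M * z ^ n \<in> int_lattice"
  shows "(norm z)\<^sup>2 \<in> \<int>"
proof (rule rational_power_bounded_denominator[of _ "M\<^sup>2"])
  show "(norm z)\<^sup>2 \<in> \<rat>" using z by (simp add: K_iff norm_square_eq)
  show "M\<^sup>2 \<noteq> 0" using M by simp
  show "of_int (M\<^sup>2) * ((norm z)\<^sup>2) ^ n \<in> \<int>" for n
    using norm_int_lattice[OF M(2)[of n]]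
    by (simp add: norm_mult norm_power power_mult_distrib power_mult[symmetric] mult.commute)
qed

text \<open>All powers of an integral \<open>z\<close>, and therefore of \<open>z + 1\<close>, have a common denominator. So the norms of both,
  hence norm and trace of \<open>z\<close>, are integers. Twice the coordinates are then integers \<open>t\<close>, \<open>u\<close> with
  \<open>t\<^sup>2 - m u\<^sup>2\<close> divisible by 4, which forces them to be even as \<open>m\<close> is 2 or 3 modulo 4.\<close>
lemma OK_eq: "OK = int_lattice"
proof
  show "OK \<subseteq> int_lattice"
  proof
    fix z assume "z \<in> OK"
    hence z: "z \<in> K" "algebraic_int z" by (auto simp: ring_of_integers_def)
    obtain M :: int where M: "M \<noteq> 0" "\<And>n. of_int M * z ^ n \<in> int_lattice"
      using algebraic_int_powers_bounded[OF z] by blast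
    have N: "(norm z)\<^sup>2 \<in> \<int>" by (rule norm_square_in_Ints[OF z(1) M])
    have z1: "z + 1 \<in> K" using z(1) by (simp add: K_iff)
    have "of_int M * (z + 1) ^ n \<in> int_lattice" for n
    proof -
      have "of_int M * (z + 1) ^ n = (\<Sum>k\<le>n. of_int (int (n choose k)) * (of_int M * z ^ k))"
        by (simp add: binomial_ring sum_distrib_left mult_ac)
      also have "\<dots> \<in> int_lattice"
        by (intro int_lattice_sum int_lattice_mult[OF int_lattice_of_int M(2)])
      finally show ?thesis .
    qed
    hence "(norm (z + 1))\<^sup>2 \<in> \<int>" by (rule norm_square_in_Ints[OF z1 M(1)])
    moreover have "(norm (z + 1))\<^sup>2 - (norm z)\<^sup>2 - 1 = 2 * Re z"
      unfolding norm_square_eq by (simp add: power2_eq_square algebra_simps)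
    ultimately have "2 * Re z \<in> \<int>" using N by (metis Ints_diff Ints_1)
    then obtain t where t: "2 * Re z = of_int t" by (elim Ints_cases)
    obtain n where n: "(norm z)\<^sup>2 = of_int n" using N by (elim Ints_cases)
    define q where "q = 2 * imc z"
    have q: "q \<in> \<rat>" using z(1) by (simp add: q_def K_iff)
    have tq: "(of_int t)\<^sup>2 - of_int m * q\<^sup>2 = of_int (4 * n)"
    proof -
      have "4 * (norm z)\<^sup>2 = (2 * Re z)\<^sup>2 - of_int m * q\<^sup>2"
        unfolding norm_square_eq by (simp add: q_def power2_eq_square algebra_simps)
      thus ?thesis using n t by simp
    qed
    from q obtain u v :: int where uv: "v > 0" "coprime u v" "q = of_int u / of_int v" by (elim Rats_cases')
    have "of_int m * (of_int u)\<^sup>2 = of_int (t\<^sup>2 - 4 * n) * (of_int v :: real)\<^sup>2"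
      using tq uv by (simp add: power_divide field_simps)
    hence "real_of_int (m * u\<^sup>2) = real_of_int ((t\<^sup>2 - 4 * n) * v\<^sup>2)" by simp
    hence "m * u\<^sup>2 = (t\<^sup>2 - 4 * n) * v\<^sup>2" unfolding of_int_eq_iff .
    hence "v\<^sup>2 dvd m * u\<^sup>2" by simp
    moreover have "coprime (v\<^sup>2) (u\<^sup>2)" using uv(2) by (simp add: coprime_commute)
    ultimately have "v\<^sup>2 dvd m" by (simp add: coprime_dvd_mult_left_iff)
    hence "v dvd 1" using squarefree_m squarefreeD by blast
    hence "v = 1" using uv(1) by simp
    hence qu: "q = of_int u" using uv by simp
    have "of_int (t\<^sup>2 - m * u\<^sup>2) = (of_int (4 * n) :: real)" using tq qu by simp
    hence tu: "t\<^sup>2 - m * u\<^sup>2 = 4 * n" by linarith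
    have "even t \<and> even u"
    proof -
      have "t\<^sup>2 mod 4 = (m * u\<^sup>2) mod 4" using tu by presburger
      also have "\<dots> = ((m mod 4) * (u\<^sup>2 mod 4)) mod 4" by (simp add: mod_mult_eq)
      finally show ?thesis using m_mod4 unfolding square_mod_4 by (auto split: if_splits)
    qed
    then obtain t' u' where "t = 2 * t'" "u = 2 * u'" by (auto elim!: evenE)
    hence "Re z = of_int t'" "imc z = of_int u'" using t qu by (auto simp: q_def)
    thus "z \<in> int_lattice" by (simp add: int_lattice_def)
  qed
qed (rule int_lattice_subset_OK)

end

section \<open>Fractional ideals containing 1\<close>

lemma squarefree_eq_if_square_multiples_eq:
  fixes a b x y :: int
  assumes sf: "squarefree a" "squarefree b" and pos: "a > 0" "b > 0"
    and eq: "a * x\<^sup>2 = b * y\<^sup>2" and x: "x \<noteq> 0"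
  shows "a = b"
proof -
  define g where "g = gcd x y"
  have g: "g \<noteq> 0" using x by (simp add: g_def)
  obtain x' y' where xy: "x = g * x'" "y = g * y'" "coprime x' y'"
  proof -
    have "x = g * (x div g)" "y = g * (y div g)" by (simp_all add: g_def)
    moreover have "coprime (x div g) (y div g)" using x unfolding g_def by (intro div_gcd_coprime) auto
    ultimately show ?thesis using that by blast
  qed
  have e: "a * x'\<^sup>2 = b * y'\<^sup>2" using eq g by (simp add: xy(1,2) power_mult_distrib)
  have "coprime (x'\<^sup>2) (y'\<^sup>2)" using xy(3) by simp
  moreover have "x'\<^sup>2 dvd b * y'\<^sup>2" "y'\<^sup>2 dvd a * x'\<^sup>2" using e by (metis dvd_triv_right)+
  ultimately have "x'\<^sup>2 dvd b" "y'\<^sup>2 dvd a"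
    by (auto simp: coprime_dvd_mult_left_iff coprime_commute)
  hence "x' dvd 1" "y' dvd 1" using sf squarefreeD by blast+
  hence "\<bar>x'\<bar> = 1" "\<bar>y'\<bar> = 1" by auto
  hence "x'\<^sup>2 = 1" "y'\<^sup>2 = 1" by (metis power2_abs one_power2)+
  thus ?thesis using e by simp
qed

context imag_quadratic
begin

lemma K_denominator:
  assumes "z \<in> K" obtains e :: int where "e > 0" "of_int e * z \<in> OK"
proof -
  from assms obtain a b c d :: int where abcd: "b > 0" "d > 0" "Re z = of_int a / of_int b" "imc z = of_int c / of_int d"
    unfolding K_iff by (metis Rats_cases')
  have "Re (of_int (b * d) * z) = of_int (a * d)" "imc (of_int (b * d) * z) = of_int (b * c)"
    using abcd by (simp_all add: field_simps)
  hence "of_int (b * d) * z \<in> OK" by (simp only: OK_eq int_lattice_def mem_Collect_eq Ints_of_int)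
  thus ?thesis using that[of "b * d"] abcd by simp
qed

lemma OK_mult: "x \<in> OK \<Longrightarrow> y \<in> OK \<Longrightarrow> x * y \<in> OK"
  by (simp add: OK_eq int_lattice_mult)

lemma of_int_in_OK: "of_int k \<in> OK" by (simp add: OK_eq int_lattice_of_int)

lemma sqrtm_in_OK: "sqrtm \<in> OK" by (simp add: OK_eq int_lattice_def)

lemma fractional_idealD:
  assumes "fractional_ideal K I"
  shows "I \<subseteq> K" "0 \<in> I" "\<And>x y. x \<in> I \<Longrightarrow> y \<in> I \<Longrightarrow> x + y \<in> I"
    "\<And>r x. r \<in> OK \<Longrightarrow> x \<in> I \<Longrightarrow> r * x \<in> I" "\<And>x. x \<in> I \<Longrightarrow> - x \<in> I"
    "\<And>k x. x \<in> I \<Longrightarrow> of_int k * x \<in> I" "\<exists>x\<in>I. x \<noteq> 0"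
    "\<exists>d\<in>OK. d \<noteq> 0 \<and> (\<forall>x\<in>I. d * x \<in> OK)"
proof -
  show r: "\<And>r x. r \<in> OK \<Longrightarrow> x \<in> I \<Longrightarrow> r * x \<in> I" using assms by (simp add: fractional_ideal_def)
  show "\<And>x. x \<in> I \<Longrightarrow> - x \<in> I" using r[OF of_int_in_OK[of "-1"]] by simp
  show "\<And>k x. x \<in> I \<Longrightarrow> of_int k * x \<in> I" using r[OF of_int_in_OK] .
qed (use assms in \<open>auto simp: fractional_ideal_def\<close>)

lemma fractional_ideal_scale:
  assumes I: "fractional_ideal K I" and a: "a \<in> K" "a \<noteq> 0"
  shows "fractional_ideal K ((*) a ` I)"
proof -
  note D = fractional_idealD[OF I]
  obtain d where d: "d \<in> OK" "d \<noteq> 0" "\<forall>x\<in>I. d * x \<in> OK" using D(8) by blast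
  obtain e where e: "e > 0" "of_int e * a \<in> OK" using K_denominator[OF a(1)] by blast
  have "\<forall>x\<in>(*) a ` I. (of_int e * d) * x \<in> OK"
  proof
    fix z assume "z \<in> (*) a ` I"
    then obtain x where x: "x \<in> I" "z = a * x" by blast
    have "(of_int e * d) * z = (of_int e * a) * (d * x)" by (simp add: x mult_ac)
    also have "\<dots> \<in> OK" using OK_mult[OF e(2)] d(3) x(1) by blast
    finally show "(of_int e * d) * z \<in> OK" .
  qed
  moreover have "of_int e * d \<in> OK" "of_int e * d \<noteq> 0" using OK_mult[OF of_int_in_OK d(1)] d e by auto
  ultimately have 1: "\<exists>d\<in>OK. d \<noteq> 0 \<and> (\<forall>x\<in>(*) a ` I. d * x \<in> OK)" by blast
  have 2: "(*) a ` I \<subseteq> K" using D(1) a K_mult by auto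
  have 3: "0 \<in> (*) a ` I" using D(2) by (auto intro!: image_eqI[of _ _ 0])
  have 4: "(*) a ` I \<noteq> {0}"
  proof -
    obtain x where "x \<in> I" "x \<noteq> 0" using D(7) by blast
    hence "a * x \<in> (*) a ` I" "a * x \<noteq> 0" using a by auto
    thus ?thesis by blast
  qed
  have 5: "\<forall>x\<in>(*) a ` I. \<forall>y\<in>(*) a ` I. x + y \<in> (*) a ` I"
    using D(3) by (auto simp: image_iff distrib_left[symmetric])
  have 6: "\<forall>r\<in>OK. \<forall>x\<in>(*) a ` I. r * x \<in> (*) a ` I"
  proof safe
    fix r x assume "r \<in> OK" "x \<in> I"
    hence "r * x \<in> I" using D(4) by blast
    thus "r * (a * x) \<in> (*) a ` I" by (intro image_eqI[of _ _ "r * x"]) (simp_all add: mult_ac)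
  qed
  show ?thesis unfolding fractional_ideal_def using 1 2 3 4 5 6 by blast
qed

text \<open>This is \<open>(B + sqrt m) / A\<close>.\<close>
definition tau :: "int \<Rightarrow> int \<Rightarrow> complex" where
  "tau A B = Complex (of_int B / of_int A) (sqrt_abs / of_int A)"

lemma Re_tau [simp]: "Re (tau A B) = of_int B / of_int A" and imc_tau [simp]: "imc (tau A B) = 1 / of_int A"
  using sqrt_abs_pos by (simp_all add: tau_def imc_def)

lemma tau_in_K: "tau A B \<in> K" by (simp add: K_iff)

lemma mem_lattice_tau_iff:
  "z \<in> lattice 1 (tau A B) \<longleftrightarrow> (\<exists>x y. Re z = of_int x + of_int y * (of_int B / of_int A) \<and> imc z = of_int y / of_int A)"
  unfolding lattice_def by (simp add: complex_eq_imc_iff)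

text \<open>A pair \<open>(A, B)\<close> stands for the quadratic form \<open>A x\<^sup>2 + 2 B x y + C y\<^sup>2\<close> with \<open>B\<^sup>2 - A C = m\<close>; reducing \<open>B\<close>
  modulo \<open>A\<close> selects one form from each orbit under translations \<open>x \<mapsto> x + j y\<close>.\<close>
definition primitive_forms :: "(int \<times> int) set" where
  "primitive_forms = {(A, B). A > 0 \<and> 0 \<le> B \<and> B < A \<and> A dvd B\<^sup>2 - m}"

definition ideal_of :: "int \<Rightarrow> int \<Rightarrow> int \<Rightarrow> complex set" where
  "ideal_of k A B = (*) (inverse (of_int k)) ` lattice 1 (tau A B)"

lemma fractional_ideal_lattice_tau:
  assumes A: "A > 0" "A dvd B\<^sup>2 - m"
  shows "fractional_ideal K (lattice 1 (tau A B))"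
proof -
  let ?L = "lattice 1 (tau A B)"
  obtain C where C: "B\<^sup>2 - m = A * C" using A by blast
  hence mC: "real_of_int m = (of_int B)\<^sup>2 - of_int A * of_int C"
    by (metis of_int_diff of_int_mult of_int_power diff_diff_eq2 diff_add_cancel add_diff_cancel_left' eq_diff_eq)
  have 1: "?L \<subseteq> K" by (auto simp: mem_lattice_tau_iff K_iff)
  have 2: "0 \<in> ?L" unfolding mem_lattice_tau_iff by (intro exI[of _ 0]) simp
  have 3: "?L \<noteq> {0}" using lattice_basis(1)[of 1 "tau A B"] by force
  have 4: "x + y \<in> ?L" if "x \<in> ?L" "y \<in> ?L" for x y
  proof -
    from that obtain a b c d where "x = of_int a * 1 + of_int b * tau A B" "y = of_int c * 1 + of_int d * tau A B"
      unfolding lattice_def by blast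
    hence "x + y = of_int (a + c) * 1 + of_int (b + d) * tau A B" by (simp add: algebra_simps)
    thus ?thesis unfolding lattice_def by blast
  qed
  have 5: "r * x \<in> ?L" if rx: "r \<in> OK" "x \<in> ?L" for r x
  proof -
    obtain a b where r: "Re r = of_int a" "imc r = of_int b"
      using rx(1) by (auto simp: OK_eq int_lattice_def elim!: Ints_cases)
    obtain p q where x: "Re x = of_int p + of_int q * (of_int B / of_int A)" "imc x = of_int q / of_int A"
      using rx(2) unfolding mem_lattice_tau_iff by blast
    define Y where "Y = a * q + b * (p * A + q * B)"
    define X where "X = a * p - b * (p * B + q * C)"
    have "imc (r * x) = of_int Y / of_int A"
      using A by (simp add: r x Y_def field_simps)
    moreover have "Re (r * x) = of_int X + of_int Y * (of_int B / of_int A)"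
      using A by (simp add: r x X_def Y_def mC field_simps power2_eq_square)
    ultimately show ?thesis unfolding mem_lattice_tau_iff by blast
  qed
  have 6: "\<exists>d\<in>OK. d \<noteq> 0 \<and> (\<forall>x\<in>?L. d * x \<in> OK)"
  proof (intro bexI[of _ "of_int A"] conjI ballI)
    fix x assume "x \<in> ?L"
    then obtain p q where x: "Re x = of_int p + of_int q * (of_int B / of_int A)" "imc x = of_int q / of_int A"
      unfolding mem_lattice_tau_iff by blast
    have "Re (of_int A * x) = of_int (A * p + q * B)" "imc (of_int A * x) = of_int q"
      using A by (simp_all add: x field_simps)
    thus "of_int A * x \<in> OK" by (simp add: OK_eq int_lattice_def)
  qed (use A of_int_in_OK in auto)
  show ?thesis unfolding fractional_ideal_def using 1 2 3 4 5 6 by blast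
qed

lemma tau_shift: "A \<noteq> 0 \<Longrightarrow> tau A (B + j * A) = tau A B + of_int j * 1"
  by (simp add: complex_eq_imc_iff add_divide_distrib)

lemma lattice_tau_mod: "A \<noteq> 0 \<Longrightarrow> lattice 1 (tau A (B mod A)) = lattice 1 (tau A B)"
  using tau_shift[of A "B mod A" "B div A"] lattice_shift[of 1 "tau A (B mod A)" "B div A"]
  by (simp add: mult.commute)

lemma dvd_mod_square: "A dvd (B mod A)\<^sup>2 - m \<longleftrightarrow> A dvd B\<^sup>2 - m" for A B :: int
proof -
  have "[(B mod A)\<^sup>2 - m = B\<^sup>2 - m] (mod A)" by (intro cong_diff cong_pow) (auto simp: cong_def)
  thus ?thesis by (rule cong_dvd_iff)
qed

lemma mem_ideal_of_iff: "k \<noteq> 0 \<Longrightarrow> z \<in> ideal_of k A B \<longleftrightarrow> of_int k * z \<in> lattice 1 (tau A B)"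
  unfolding ideal_of_def by (auto simp: image_iff field_simps)

text \<open>The rational elements of such an ideal form a cyclic group generated by \<open>1/k\<close>, the coordinates
  along \<open>sqrt m\<close> form one generated by \<open>1/(k A)\<close>, and stability under multiplication by \<open>sqrt m\<close>
  yields the congruence for \<open>B\<close>.\<close>
lemma fractional_ideal_containing_1:
  assumes I: "fractional_ideal K I" "1 \<in> I"
  obtains k A B where "k > 0" "(A, B) \<in> primitive_forms" "I = ideal_of k A B"
proof -
  note D = fractional_idealD[OF I(1)]
  obtain d where d: "d \<in> OK" "d \<noteq> 0" "\<And>x. x \<in> I \<Longrightarrow> d * x \<in> OK" using D(8) by blast
  have "(norm d)\<^sup>2 \<in> \<int>" using norm_int_lattice d(1) OK_eq by simp
  then obtain E where E: "(norm d)\<^sup>2 = of_int E" by (elim Ints_cases)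
  have "real_of_int E > 0" using E[symmetric] d(2) by simp
  hence Epos: "E > 0" by simp
  have "cnj d \<in> OK" using d(1) by (simp add: OK_eq int_lattice_def)
  have den: "\<exists>i j. Re z = of_int i / of_int E \<and> imc z = of_int j / of_int E" if "z \<in> I" for z
  proof -
    have "cnj d * (d * z) \<in> OK" using OK_mult[OF \<open>cnj d \<in> OK\<close> d(3)[OF that]] .
    moreover have "cnj d * (d * z) = of_int E * z"
    proof -
      have "cnj d * d = of_int E" using E by (metis complex_norm_square mult.commute of_real_of_int_eq of_real_power)
      thus ?thesis by (simp add: mult.assoc[symmetric])
    qed
    ultimately obtain i j where "Re (of_int E * z) = of_int i" "imc (of_int E * z) = of_int j"
      unfolding OK_eq int_lattice_def by (auto elim!: Ints_cases)
    thus ?thesis using Epos by (intro exI[of _ i] exI[of _ j]) (simp add: field_simps)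
  qed
  define J where "J = {j::int. of_real (of_int j / of_int E) \<in> I}"
  obtain g where g: "g > 0" "\<And>j. j \<in> J \<longleftrightarrow> g dvd j"
  proof (rule int_subgroup_cyclic[of J E])
    show "x + y \<in> J" if "x \<in> J" "y \<in> J" for x y
      using D(3)[of "of_real (of_int x / of_int E)" "of_real (of_int y / of_int E)"] that
      by (simp add: J_def add_divide_distrib)
    show "- x \<in> J" if "x \<in> J" for x
      using D(5)[of "of_real (of_int x / of_int E)"] that by (simp add: J_def)
    show "E \<in> J" using I(2) Epos by (simp add: J_def)
  qed (use Epos in auto)
  have "g dvd E" using g(2)[of E] I(2) Epos by (simp add: J_def)
  then obtain k where k: "E = g * k" by blast
  have kpos: "k > 0" using Epos g(1) k by (simp add: zero_less_mult_iff)
  have real_in: "of_real (of_int l / of_int k) \<in> I" for l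
  proof -
    have "g * l \<in> J" using g(2) by simp
    thus ?thesis using g(1) by (simp add: J_def k)
  qed
  have real_form: "\<exists>l. z = of_real (of_int l / of_int k)" if z: "z \<in> I" "imc z = 0" for z
  proof -
    obtain i where i: "Re z = of_int i / of_int E" using den[OF z(1)] by blast
    have zi: "z = of_real (of_int i / of_int E)" by (simp add: complex_eq_imc_iff i z(2) del: of_real_divide)
    hence "i \<in> J" using z(1) by (simp add: J_def)
    then obtain l where "i = g * l" using g(2) by blast
    thus ?thesis using zi g(1) by (intro exI[of _ l]) (simp add: k)
  qed
  define H where "H = {h. \<exists>z\<in>I. imc z = of_int h / of_int E}"
  obtain g' where g': "g' > 0" "\<And>j. j \<in> H \<longleftrightarrow> g' dvd j"
  proof (rule int_subgroup_cyclic[of H E])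
    show "x + y \<in> H" if xy: "x \<in> H" "y \<in> H" for x y
    proof -
      obtain u v where "u \<in> I" "v \<in> I" "imc u = of_int x / of_int E" "imc v = of_int y / of_int E"
        using xy by (auto simp: H_def)
      thus ?thesis unfolding H_def using D(3)[of u v] by (auto simp: add_divide_distrib intro!: bexI[of _ "u + v"])
    qed
    show "- x \<in> H" if x: "x \<in> H" for x
    proof -
      obtain u where "u \<in> I" "imc u = of_int x / of_int E" using x by (auto simp: H_def)
      thus ?thesis unfolding H_def using D(5)[of u] by (auto intro!: bexI[of _ "- u"])
    qed
    have "sqrtm * 1 \<in> I" using D(4)[OF sqrtm_in_OK I(2)] .
    thus "E \<in> H" using Epos by (auto simp: H_def intro!: bexI[of _ "sqrtm"])
  qed (use Epos in auto)
  have "sqrtm * of_real (of_int 1 / of_int k) \<in> I" using D(4)[OF sqrtm_in_OK real_in] .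
  moreover have "imc (sqrtm * of_real (of_int 1 / of_int k)) = of_int g / of_int E"
    using g(1) kpos by (simp add: k del: of_real_divide)
  ultimately have "g \<in> H" unfolding H_def by blast
  then obtain A where A: "g = g' * A" using g'(2) by blast
  have Apos: "A > 0" using A g g'(1) by (simp add: zero_less_mult_iff)
  have "g' \<in> H" using g'(2) by simp
  then obtain z0 where z0: "z0 \<in> I" "imc z0 = of_int g' / of_int E" by (auto simp: H_def)
  have imz0: "imc z0 = 1 / (of_int k * of_int A)" using z0(2) g'(1) by (simp add: k A)
  have decomp: "\<exists>l y. z = of_real (of_int l / of_int k) + of_int y * z0" if z: "z \<in> I" for z
  proof -
    obtain h where h: "imc z = of_int h / of_int E" using den[OF z] by blast
    hence "h \<in> H" using z by (auto simp: H_def)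
    then obtain y where y: "h = g' * y" using g'(2) by blast
    have "z + - (of_int y * z0) \<in> I" using D(3)[OF z D(5)[OF D(6)[OF z0(1)]]] .
    moreover have "imc (z + - (of_int y * z0)) = 0" using h y z0(2) by simp
    ultimately obtain l where "z + - (of_int y * z0) = of_real (of_int l / of_int k)" using real_form by blast
    hence "z = of_real (of_int l / of_int k) + of_int y * z0" by (simp add: algebra_simps)
    thus ?thesis by blast
  qed
  have "sqrtm * z0 \<in> I" using D(4)[OF sqrtm_in_OK z0(1)] .
  then obtain l y where ly: "sqrtm * z0 = of_real (of_int l / of_int k) + of_int y * z0" using decomp by blast
  have Rez0: "Re z0 = of_int y / (of_int k * of_int A)"
    using arg_cong[OF ly, of imc] by (simp add: imz0 del: of_real_divide)
  have "of_int m * imc z0 = of_int l / of_int k + of_int y * Re z0"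
    using arg_cong[OF ly, of Re] by (simp del: of_real_divide)
  hence "real_of_int m = of_int (l * A + y * y)"
    using kpos Apos by (simp add: imz0 Rez0 field_simps)
  hence my: "m = l * A + y * y" by (simp only: of_int_eq_iff)
  hence "y\<^sup>2 - m = A * (- l)" by (simp add: power2_eq_square algebra_simps)
  hence Ady: "A dvd y\<^sup>2 - m" by (metis dvd_triv_left)
  have kz0: "of_int k * z0 = tau A y"
    using kpos by (simp add: complex_eq_imc_iff imz0 Rez0)
  have "z \<in> I \<longleftrightarrow> of_int k * z \<in> lattice 1 (tau A y)" for z
  proof
    assume "z \<in> I"
    then obtain p q where "z = of_real (of_int p / of_int k) + of_int q * z0" using decomp by blast
    hence "of_int k * z = of_int p * 1 + of_int q * (of_int k * z0)" using kpos by (simp add: algebra_simps)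
    thus "of_int k * z \<in> lattice 1 (tau A y)" unfolding kz0 lattice_def by blast
  next
    assume "of_int k * z \<in> lattice 1 (tau A y)"
    then obtain p q where pq: "of_int k * z = of_int p * 1 + of_int q * (of_int k * z0)" unfolding kz0 lattice_def by blast
    hence "z = of_real (of_int p / of_int k) + of_int q * z0" using kpos by (simp add: field_simps)
    thus "z \<in> I" using D(3)[OF real_in D(6)[OF z0(1)]] by simp
  qed
  hence "I = ideal_of k A y" using kpos by (intro Set.set_eqI) (simp add: mem_ideal_of_iff)
  also have "\<dots> = ideal_of k A (y mod A)" using Apos by (simp add: ideal_of_def lattice_tau_mod)
  finally have "I = ideal_of k A (y mod A)" .
  moreover have "(A, y mod A) \<in> primitive_forms"
    using Apos Ady by (simp add: primitive_forms_def dvd_mod_square)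
  ultimately show ?thesis using that kpos by blast
qed

text \<open>\<open>1/k\<close> generates the rational elements, \<open>1/(k A)\<close> the coordinates along \<open>sqrt m\<close>, and \<open>B\<close> is then determined
  modulo \<open>A\<close>.\<close>
lemma ideal_of_inj:
  assumes f: "k > 0" "k' > 0" "(A, B) \<in> primitive_forms" "(A', B') \<in> primitive_forms"
    and eq: "ideal_of k A B = ideal_of k' A' B'"
  shows "k = k' \<and> A = A' \<and> B = B'"
proof -
  have kd: "k dvd k'" if "k > 0" "k' > 0" "A' > 0" "ideal_of k A B = ideal_of k' A' B'" for k A B k' A' B'
  proof -
    have "of_real (1 / of_int k) \<in> ideal_of k A B"
      using that(1) lattice_basis(1)[of 1 "tau A B"] by (simp add: mem_ideal_of_iff)
    hence "of_real (1 / of_int k) \<in> ideal_of k' A' B'" using that by (simp only:)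
    hence "of_int k' * of_real (1 / of_int k) \<in> lattice 1 (tau A' B')"
      using that(2) by (simp add: mem_ideal_of_iff del: of_real_divide)
    then obtain x y where "Re (of_int k' * of_real (1 / of_int k)) = of_int x + of_int y * (of_int B' / of_int A')"
      "imc (of_int k' * of_real (1 / of_int k)) = of_int y / of_int A'" unfolding mem_lattice_tau_iff by blast
    hence "real_of_int k' / of_int k = of_int x" using that by (simp del: of_real_divide)
    hence "real_of_int k' = of_int (x * k)" using that by (simp add: field_simps)
    hence "k' = x * k" by (simp only: of_int_eq_iff)
    thus ?thesis by simp
  qed
  have pos: "A > 0" "A' > 0" using f by (auto simp: primitive_forms_def)
  have k: "k = k'" using kd[OF f(1,2) pos(2) eq] kd[OF f(2,1) pos(1) eq[symmetric]] f
    by (simp add: zdvd_antisym_nonneg)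
  have L: "lattice 1 (tau A B) = lattice 1 (tau A' B')"
  proof (rule Set.set_eqI)
    fix z
    have "z \<in> lattice 1 (tau A B) \<longleftrightarrow> inverse (of_int k) * z \<in> ideal_of k A B"
      using f by (simp add: mem_ideal_of_iff mult.assoc[symmetric])
    also have "\<dots> \<longleftrightarrow> z \<in> lattice 1 (tau A' B')" unfolding eq using k f by (simp add: mem_ideal_of_iff mult.assoc[symmetric])
    finally show "z \<in> lattice 1 (tau A B) \<longleftrightarrow> z \<in> lattice 1 (tau A' B')" .
  qed
  have Ad: "\<exists>x y. A' = y * A \<and> of_int B / of_int A = of_int x + of_int y * (real_of_int B' / of_int A')"
    if "lattice 1 (tau A B) = lattice 1 (tau A' B')" "A > 0" "A' > 0" for A B A' B'
  proof -
    have "tau A B \<in> lattice 1 (tau A' B')" using lattice_basis(2)[of "tau A B" 1] that by simp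
    then obtain x y where xy: "of_int B / of_int A = of_int x + of_int y * (real_of_int B' / of_int A')"
      "1 / of_int A = of_int y / real_of_int A'" unfolding mem_lattice_tau_iff by auto
    have "real_of_int A' = of_int (y * A)" using xy(2) that by (simp add: field_simps)
    hence "A' = y * A" by (simp only: of_int_eq_iff)
    thus ?thesis using xy(1) by blast
  qed
  have A: "A = A'" using Ad[OF L pos] Ad[OF L[symmetric] pos(2,1)] pos
    by (metis dvd_triv_right zdvd_antisym_nonneg less_imp_le)
  obtain x y where xy: "A' = y * A" "of_int B / of_int A = of_int x + of_int y * (real_of_int B' / of_int A')"
    using Ad[OF L pos] by blast
  have "y = 1" using xy(1) A pos by simp
  hence "real_of_int B = of_int (x * A + B')" using xy(2) A pos by (simp add: field_simps)
  hence "B = x * A + B'" by (simp only: of_int_eq_iff)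
  hence "B mod A = B' mod A" by simp
  hence "B = B'" using f A by (simp add: primitive_forms_def)
  thus ?thesis using k A by simp
qed

definition form_value :: "int \<Rightarrow> int \<Rightarrow> int \<times> int \<Rightarrow> int" where
  "form_value A B = (\<lambda>(x, y). A * x\<^sup>2 + 2 * B * x * y + ((B\<^sup>2 - m) div A) * y\<^sup>2)"

lemma form_value_eq_norm:
  assumes "A > 0" "A dvd B\<^sup>2 - m"
  shows "of_int (form_value A B (x, y)) = of_int A * (norm (of_int x + of_int y * tau A B))\<^sup>2"
proof -
  obtain C where C: "B\<^sup>2 - m = A * C" using assms by blast
  have mC: "real_of_int m = (of_int B)\<^sup>2 - of_int A * of_int C"
    using arg_cong[OF C, of real_of_int] by simp
  have "(B\<^sup>2 - m) div A = C" using C assms by simp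
  thus ?thesis using assms(1) unfolding norm_square_eq
    by (simp add: form_value_def mC power2_eq_square field_simps)
qed

lemma covolume_scaled_tau:
  assumes "A > 0"
  shows "\<bar>Im (cnj (c * 1) * (c * tau A B))\<bar> = (norm c)\<^sup>2 * sqrt_abs / of_int A"
proof -
  have "cnj (c * 1) * (c * tau A B) = of_real ((norm c)\<^sup>2) * tau A B"
  proof -
    have "c * cnj c = of_real ((norm c)\<^sup>2)" using complex_norm_square[of c] by simp
    moreover have "cnj (c * 1) * (c * tau A B) = (c * cnj c) * tau A B" by (simp add: mult_ac)
    ultimately show ?thesis by (simp only:)
  qed
  moreover have "Im (of_real ((norm c)\<^sup>2) * tau A B) = (norm c)\<^sup>2 * (sqrt_abs / of_int A)"
    by (simp add: tau_def del: of_real_power)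
  ultimately have "Im (cnj (c * 1) * (c * tau A B)) = (norm c)\<^sup>2 * (sqrt_abs / of_int A)" by (simp only:)
  thus ?thesis using assms sqrt_abs_pos by (simp add: abs_mult)
qed

lemma norm_of_scaled_lattice:
  assumes "A > 0" "A' > 0" "(*) c ` lattice 1 (tau A B) = (*) c' ` lattice 1 (tau A' B')"
  shows "(norm c)\<^sup>2 * of_int A' = (norm c')\<^sup>2 * of_int A"
proof -
  have "(norm c)\<^sup>2 * sqrt_abs / of_int A = (norm c')\<^sup>2 * sqrt_abs / of_int A'"
    using lattice_covolume[OF assms(3)[unfolded lattice_scale]] assms(1,2) by (simp only: covolume_scaled_tau)
  thus ?thesis using sqrt_abs_pos assms(1,2) by (simp add: field_simps)
qed

text \<open>A multiplier of a lattice preserves its covolume, so it has norm 1, and its trace is an integer. If it were not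
  rational, the trace would be 0 or \<plusminus>1, which forces \<open>m = -1\<close> or \<open>m = -3\<close>.\<close>
lemma lattice_multiplier_unit:
  assumes A: "(A, B) \<in> primitive_forms" and u: "(*) u ` lattice 1 (tau A B) = lattice 1 (tau A B)"
  shows "u = 1 \<or> u = -1"
proof -
  have pos: "A > 0" using A by (simp add: primitive_forms_def)
  have "(*) u ` lattice 1 (tau A B) = (*) 1 ` lattice 1 (tau A B)" using u by simp
  from norm_of_scaled_lattice[OF pos pos this] have nu: "(norm u)\<^sup>2 = 1" using pos by simp
  have "u * 1 \<in> lattice 1 (tau A B)" using u lattice_basis(1)[of 1 "tau A B"] by blast
  then obtain x y where xy: "Re u = of_int x + of_int y * (of_int B / of_int A)" "imc u = of_int y / of_int A"
    unfolding mem_lattice_tau_iff by auto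
  have "u * tau A B \<in> lattice 1 (tau A B)" using u lattice_basis(2)[of "tau A B" 1] by blast
  then obtain w where w: "imc (u * tau A B) = of_int w / of_int A"
    unfolding mem_lattice_tau_iff by blast
  define j where "j = x + w"
  have "Re u / of_int A + of_int y / of_int A * (of_int B / of_int A) = of_int w / of_int A"
    using w xy(2) by simp
  hence "(Re u + of_int y * (of_int B / of_int A)) / of_int A = of_int w / of_int A" by (simp add: add_divide_distrib)
  hence "Re u + of_int y * (of_int B / of_int A) = of_int w" using pos by simp
  hence j: "2 * Re u = of_int j" using xy(1) unfolding j_def of_int_add by linarith
  have "4 * (norm u)\<^sup>2 = (2 * Re u)\<^sup>2 - 4 * of_int m * (imc u)\<^sup>2"
    unfolding norm_square_eq by (simp add: power2_eq_square algebra_simps)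
  hence "4 = (real_of_int j)\<^sup>2 - 4 * of_int m * (of_int y / of_int A)\<^sup>2" using nu j xy(2) by simp
  hence "4 * (of_int A)\<^sup>2 = ((real_of_int j)\<^sup>2 - 4 * of_int m * (of_int y / of_int A)\<^sup>2) * (of_int A)\<^sup>2" by simp
  also have "\<dots> = (real_of_int j)\<^sup>2 * (of_int A)\<^sup>2 - 4 * of_int m * (of_int y)\<^sup>2"
    using pos by (simp add: power_divide left_diff_distrib)
  finally have "4 * (of_int A)\<^sup>2 = (real_of_int j)\<^sup>2 * (of_int A)\<^sup>2 - 4 * of_int m * (of_int y)\<^sup>2" .
  hence "real_of_int (4 * A\<^sup>2) = of_int (j\<^sup>2 * A\<^sup>2 - 4 * m * y\<^sup>2)" by simp
  hence e: "4 * A\<^sup>2 = j\<^sup>2 * A\<^sup>2 - 4 * m * y\<^sup>2" by (simp only: of_int_eq_iff)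
  show ?thesis
  proof (cases "y = 0")
    case True
    hence u': "u = of_int x" using xy by (simp add: complex_eq_imc_iff)
    have "real_of_int (x\<^sup>2) = 1" using nu by (simp add: u')
    hence "x\<^sup>2 = 1" by linarith
    thus ?thesis using u' by (auto simp: power2_eq_1_iff)
  next
    case False
    have sf: "squarefree (- m)" using squarefree_m by simp
    have "- m * y\<^sup>2 > 0" using False m_less by (intro mult_pos_pos) auto
    hence "j\<^sup>2 * A\<^sup>2 < 4 * A\<^sup>2" using e by linarith
    hence "j\<^sup>2 < 4" using pos by simp
    hence "\<bar>j\<bar> < 2" using abs_square_less_1 power2_less_imp_less[of "\<bar>j\<bar>" 2] by simp
    hence "j = 0 \<or> j\<^sup>2 = 1" by (auto simp: power2_eq_1_iff)
    thus ?thesis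
    proof
      assume "j = 0"
      hence "(- m) * y\<^sup>2 = 1 * A\<^sup>2" using e by simp
      from squarefree_eq_if_square_multiples_eq[OF sf _ _ _ this False] have "- m = 1" using m_less by simp
      thus ?thesis using m_less by simp
    next
      assume "j\<^sup>2 = 1"
      hence "(- m) * (2 * y)\<^sup>2 = 3 * A\<^sup>2" using e by (simp add: power_mult_distrib)
      moreover have "squarefree (3 :: int)" by (rule squarefree_prime) simp
      ultimately have "- m = 3" using squarefree_eq_if_square_multiples_eq[OF sf, of 3 "2 * y" A] m_less False by simp
      hence "m = -3" by simp
      thus ?thesis using m_mod4 by simp
    qed
  qed
qed

section \<open>Ideal classes and lattice vectors\<close>

lemma inverse_of_int_in_K: "inverse (of_int k) \<in> K"
  by (rule K_inverse) (simp add: K_iff)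

definition homothety_class :: "complex set \<Rightarrow> complex set set" where
  "homothety_class I = {(*) a ` I | a. a \<in> K \<and> a \<noteq> 0}"

lemma homothety_class_eq:
  assumes "a \<in> K" "a \<noteq> 0"
  shows "homothety_class ((*) a ` I) = homothety_class I"
proof -
  have sub: "homothety_class ((*) a ` I) \<subseteq> homothety_class I" if "a \<in> K" "a \<noteq> 0" for a I
  proof
    fix J assume "J \<in> homothety_class ((*) a ` I)"
    then obtain b where b: "b \<in> K" "b \<noteq> 0" "J = (*) b ` (*) a ` I" by (auto simp: homothety_class_def)
    hence "J = (*) (b * a) ` I" by (simp add: image_image mult.assoc)
    thus "J \<in> homothety_class I" using K_mult[OF b(1) that(1)] b(2) that(2) by (auto simp: homothety_class_def)
  qed
  have "I = (*) (inverse a) ` (*) a ` I" using assms by (simp add: image_image mult.assoc[symmetric])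
  hence "homothety_class I \<subseteq> homothety_class ((*) a ` I)"
    using sub[of "inverse a" "(*) a ` I"] K_inverse assms by simp
  thus ?thesis using sub[OF assms] by blast
qed

lemma self_in_homothety_class: "I \<in> homothety_class I"
  using K_1 unfolding homothety_class_def by (auto intro!: exI[of _ 1])

lemma homothety_class_eqD:
  assumes "homothety_class I = homothety_class J"
  obtains a where "a \<in> K" "a \<noteq> 0" "J = (*) a ` I"
proof -
  have "J \<in> homothety_class I" using self_in_homothety_class[of J] assms by simp
  then obtain a where "J = (*) a ` I" "a \<in> K" "a \<noteq> 0" unfolding homothety_class_def by auto
  thus ?thesis using that by simp
qed

lemma ideal_mult_principal:
  assumes a: "a \<in> K" "a \<noteq> 0" and I: "fractional_ideal K I"
  shows "ideal_mult ((*) a ` OK) I = (*) a ` I"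
proof
  note D = fractional_idealD[OF fractional_ideal_scale[OF I a]]
  show "ideal_mult ((*) a ` OK) I \<subseteq> (*) a ` I"
  proof
    fix z assume "z \<in> ideal_mult ((*) a ` OK) I"
    then obtain n :: nat and f g where fg: "z = (\<Sum>i<n. f i * g i)" "\<forall>i<n. f i \<in> (*) a ` OK \<and> g i \<in> I"
      unfolding ideal_mult_def by blast
    have "f i * g i \<in> (*) a ` I" if i: "i < n" for i
    proof -
      obtain r where r: "r \<in> OK" "f i = a * r" using fg(2) i by blast
      have "r * g i \<in> I" using fractional_idealD(4)[OF I r(1)] fg(2) i by blast
      thus ?thesis using r(2) by (intro image_eqI[of _ _ "r * g i"]) (simp_all add: mult_ac)
    qed
    hence "(\<Sum>i<k. f i * g i) \<in> (*) a ` I" if "k \<le> n" for k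
      using that
    proof (induction k)
      case 0
      show ?case using D(2) by simp
    next
      case (Suc k)
      have "(\<Sum>i<k. f i * g i) + f k * g k \<in> (*) a ` I"
        by (rule D(3)) (use Suc in simp_all)
      thus ?case by simp
    qed
    from this[of n] have "(\<Sum>i<n. f i * g i) \<in> (*) a ` I" by simp
    thus "z \<in> (*) a ` I" using fg(1) by simp
  qed
  show "(*) a ` I \<subseteq> ideal_mult ((*) a ` OK) I"
  proof
    fix z assume "z \<in> (*) a ` I"
    then obtain x where x: "x \<in> I" "z = a * x" by blast
    have "a \<in> (*) a ` OK" using of_int_in_OK[of 1] by (intro image_eqI[of _ _ 1]) auto
    thus "z \<in> ideal_mult ((*) a ` OK) I" unfolding ideal_mult_def
      by (intro CollectI exI[of _ 1] exI[of _ "\<lambda>_. a"] exI[of _ "\<lambda>_. x"]) (use x in simp)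
  qed
qed

definition ideal_classes :: "complex set set set" where
  "ideal_classes = homothety_class ` {I. fractional_ideal K I}"

text \<open>Multiplication by the principal ideal generated by \<open>a\<close> scales an ideal by \<open>a\<close>, so the cosets of the
  principal ideals are the homothety classes.\<close>
lemma class_number_eq: "class_number K = card ideal_classes"
proof -
  have "r_coset (fractional_ideal_group K) (principal_fractional_ideals K) I = homothety_class I"
    if I: "fractional_ideal K I" for I
  proof -
    have "r_coset (fractional_ideal_group K) (principal_fractional_ideals K) I
      = (\<lambda>a. ideal_mult ((*) a ` OK) I) ` (K - {0})"
      unfolding r_coset_def fractional_ideal_group_def principal_fractional_ideals_def monoid.simps by blast
    also have "\<dots> = (\<lambda>a. (*) a ` I) ` (K - {0})"
      by (rule image_cong[OF refl], rule ideal_mult_principal[OF _ _ I]) auto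
    also have "\<dots> = homothety_class I" unfolding homothety_class_def by blast
    finally show ?thesis .
  qed
  hence "carrier (ideal_class_group K) = ideal_classes"
    unfolding ideal_class_group_def carrier_FactGroup ideal_classes_def
    by (intro image_cong) (auto simp: fractional_ideal_group_def)
  thus ?thesis by (simp add: class_number_def Coset.order_def)
qed

lemma ideal_class_form:
  assumes "c \<in> ideal_classes"
  obtains A B where "(A, B) \<in> primitive_forms" "c = homothety_class (lattice 1 (tau A B))"
proof -
  obtain I where I: "fractional_ideal K I" "c = homothety_class I" using assms by (auto simp: ideal_classes_def)
  obtain x where x: "x \<in> I" "x \<noteq> 0" using fractional_idealD(7)[OF I(1)] by blast
  have xK: "inverse x \<in> K" "inverse x \<noteq> 0" using fractional_idealD(1)[OF I(1)] x K_inverse by auto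
  have "1 \<in> (*) (inverse x) ` I" using x by (intro image_eqI[of _ _ x]) auto
  then obtain k A B where kAB: "k > 0" "(A, B) \<in> primitive_forms" "(*) (inverse x) ` I = ideal_of k A B"
    using fractional_ideal_containing_1[OF fractional_ideal_scale[OF I(1) xK]] by blast
  have "inverse (of_int k) \<in> K" "inverse (of_int k :: complex) \<noteq> 0"
    using kAB(1) inverse_of_int_in_K by auto
  hence "homothety_class (ideal_of k A B) = homothety_class (lattice 1 (tau A B))"
    unfolding ideal_of_def by (rule homothety_class_eq)
  hence "c = homothety_class (lattice 1 (tau A B))"
    using I(2) homothety_class_eq[OF xK, of I] kAB(3) by simp
  thus ?thesis using that kAB(2) by blast
qed

text \<open>The map \<open>\<tau> \<mapsto> -1/\<tau>\<close> exchanges the outer coefficients of the form.\<close>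
lemma homothety_class_invert:
  assumes A: "A > 0" and C: "B\<^sup>2 - m = A * C"
  shows "homothety_class (lattice 1 (tau A B)) = homothety_class (lattice 1 (tau C (- B)))"
proof -
  have "A * C > 0" using C m_less zero_le_power2[of B] by linarith
  hence C0: "C > 0" using A by (simp add: zero_less_mult_iff)
  have mC: "real_of_int m = (of_int B)\<^sup>2 - of_int A * of_int C"
    using arg_cong[OF C, of real_of_int] by simp
  have "imc (tau A B) \<noteq> 0" using A by simp
  hence t: "tau A B \<noteq> 0" by (metis imc_simps(8))
  have "tau A B * (- tau C (- B)) = 1"
    using A C0 by (simp add: complex_eq_imc_iff mC field_simps power2_eq_square)
  hence inv: "inverse (tau A B) = - tau C (- B)" by (rule inverse_unique)
  have "(*) (inverse (tau A B)) ` lattice 1 (tau A B) = lattice (- tau C (- B)) 1"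
    using t by (simp add: lattice_scale inv[symmetric])
  also have "\<dots> = lattice 1 (tau C (- B))" by (simp add: lattice_swap[of _ 1] lattice_minus)
  finally show ?thesis
    using homothety_class_eq[of "inverse (tau A B)" "lattice 1 (tau A B)"] t tau_in_K K_inverse by simp
qed

text \<open>Gauss reduction: if the leading coefficient \<open>A\<close> is minimal in its class and \<open>2 \<bar>b\<bar> \<le> A\<close>, then
  \<open>A\<^sup>2 \<le> A C = b\<^sup>2 - m \<le> A\<^sup>2/4 + \<bar>m\<bar>\<close>.\<close>
lemma finite_ideal_classes: "finite ideal_classes"
proof (rule finite_subset)
  show "ideal_classes \<subseteq> (\<lambda>(A, B). homothety_class (lattice 1 (tau A B))) ` ({0..2 * \<bar>m\<bar>} \<times> {0..2 * \<bar>m\<bar>})"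
  proof
    fix c assume c: "c \<in> ideal_classes"
    define P where "P = (\<lambda>n. \<exists>A B. n = nat A \<and> (A, B) \<in> primitive_forms \<and> c = homothety_class (lattice 1 (tau A B)))"
    have "\<exists>n. P n" using ideal_class_form[OF c] unfolding P_def by blast
    hence "P (LEAST n. P n)" by (rule LeastI_ex)
    then obtain A B where AB: "(LEAST n. P n) = nat A" "(A, B) \<in> primitive_forms" "c = homothety_class (lattice 1 (tau A B))"
      unfolding P_def by blast
    have A: "A > 0" "0 \<le> B" "B < A" "A dvd B\<^sup>2 - m" using AB(2) by (auto simp: primitive_forms_def)
    \<comment> \<open>The representative of \<open>B\<close> modulo \<open>A\<close> of least absolute value.\<close>
    define b where "b = (if 2 * B \<le> A then B else B - A)"
    have b: "2 * \<bar>b\<bar> \<le> A" using A by (auto simp: b_def)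
    have bm: "b mod A = B" using A by (auto simp: b_def)
    have cb: "c = homothety_class (lattice 1 (tau A b))" using AB(3) lattice_tau_mod[of A b] A bm by simp
    have "A dvd b\<^sup>2 - m" using A(4) dvd_mod_square[of A b] bm by simp
    then obtain C where C: "b\<^sup>2 - m = A * C" by blast
    have "A * C > 0" using C m_less zero_le_power2[of b] by linarith
    hence C0: "C > 0" using A by (simp add: zero_less_mult_iff)
    have "(- b)\<^sup>2 - m = C * A" using C by (simp add: mult.commute)
    hence "C dvd (- b)\<^sup>2 - m" by (metis dvd_triv_left)
    hence "(C, (- b) mod C) \<in> primitive_forms" using C0 dvd_mod_square[of C "- b"] by (simp add: primitive_forms_def)
    moreover have "c = homothety_class (lattice 1 (tau C ((- b) mod C)))"
      using cb homothety_class_invert[OF A(1) C] lattice_tau_mod[of C "- b"] C0 by simp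
    ultimately have "P (nat C)" unfolding P_def by blast
    hence "nat A \<le> nat C" unfolding AB(1)[symmetric] by (rule Least_le)
    hence AC: "A \<le> C" using C0 by simp
    have "A * A \<le> A * C" using AC A by simp
    moreover have "4 * b\<^sup>2 \<le> A * A"
    proof -
      have "(2 * \<bar>b\<bar>) * (2 * \<bar>b\<bar>) \<le> A * A" using b A by (intro mult_mono) auto
      thus ?thesis by (simp add: power2_eq_square)
    qed
    ultimately have "3 * (A * A) \<le> 4 * \<bar>m\<bar>" using C m_less by linarith
    moreover have "A * 1 \<le> A * A" using A by (intro mult_left_mono) auto
    ultimately have "A \<le> 2 * \<bar>m\<bar>" by linarith
    thus "c \<in> (\<lambda>(A, B). homothety_class (lattice 1 (tau A B))) ` ({0..2 * \<bar>m\<bar>} \<times> {0..2 * \<bar>m\<bar>})"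
      using AB(3) A by (intro image_eqI[of _ _ "(A, B)"]) auto
  qed
qed simp

definition class_form :: "complex set set \<Rightarrow> int \<times> int" where
  "class_form c = (SOME AB. AB \<in> primitive_forms \<and> c = homothety_class (lattice 1 (tau (fst AB) (snd AB))))"

lemma class_form:
  assumes "c \<in> ideal_classes"
  shows "class_form c \<in> primitive_forms" "homothety_class (lattice 1 (tau (fst (class_form c)) (snd (class_form c)))) = c"
proof -
  obtain A B where "(A, B) \<in> primitive_forms" "c = homothety_class (lattice 1 (tau A B))"
    using ideal_class_form[OF assms] by blast
  hence "\<exists>AB. AB \<in> primitive_forms \<and> c = homothety_class (lattice 1 (tau (fst AB) (snd AB)))"
    by (intro exI[of _ "(A, B)"]) simp
  from someI_ex[OF this] show "class_form c \<in> primitive_forms"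
    "homothety_class (lattice 1 (tau (fst (class_form c)) (snd (class_form c)))) = c"
    unfolding class_form_def by auto
qed

abbreviation "class_tau c \<equiv> tau (fst (class_form c)) (snd (class_form c))"
abbreviation "class_value c \<equiv> form_value (fst (class_form c)) (snd (class_form c))"
abbreviation "class_vector c p \<equiv> of_int (fst p) + of_int (snd p) * class_tau c"

lemma class_form_pos:
  assumes "c \<in> ideal_classes"
  shows "fst (class_form c) > 0" "fst (class_form c) dvd (snd (class_form c))\<^sup>2 - m"
  using class_form(1)[OF assms] by (auto simp: primitive_forms_def)

lemma class_value_eq_norm:
  assumes "c \<in> ideal_classes"
  shows "of_int (class_value c p) = of_int (fst (class_form c)) * (norm (class_vector c p))\<^sup>2"
  using form_value_eq_norm[OF class_form_pos[OF assms], of "fst p" "snd p"] by simp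

lemma class_value_nonneg: "c \<in> ideal_classes \<Longrightarrow> class_value c p \<ge> 0"
proof -
  assume c: "c \<in> ideal_classes"
  have "real_of_int (class_value c p) \<ge> 0"
    unfolding class_value_eq_norm[OF c] using class_form_pos[OF c] by (intro mult_nonneg_nonneg) auto
  thus ?thesis by simp
qed

lemma class_vector_inj:
  assumes "c \<in> ideal_classes" "class_vector c p = class_vector c q" shows "p = q"
proof -
  have "imc (class_vector c p) = imc (class_vector c q)" "Re (class_vector c p) = Re (class_vector c q)"
    using assms(2) by simp_all
  hence "snd p = snd q" "fst p = fst q" using class_form_pos[OF assms(1)] by (simp_all del: of_int_mult)
  thus ?thesis by (simp add: prod_eq_iff)
qed

definition vectors :: "nat \<Rightarrow> (complex set set \<times> int \<times> int) set" where
  "vectors n = {(c, p). c \<in> ideal_classes \<and> class_value c p = int n}"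

definition ideals :: "nat \<Rightarrow> (int \<times> int \<times> int) set" where
  "ideals n = {(k, A, B). k > 0 \<and> (A, B) \<in> primitive_forms \<and> k\<^sup>2 * A = int n}"

lemma card_ideals:
  assumes "n > 0"
  shows "finite (ideals n)" "int (card (ideals n)) = ideal_count n"
proof -
  have fin: "finite {k::nat. k\<^sup>2 dvd n}"
    using square_dvd_subset[of n] assms by (rule_tac finite_subset) auto
  have k0: "k > 0" if "k\<^sup>2 dvd n" for k :: nat using that assms by (auto intro: Nat.gr0I)
  have nk: "n div k\<^sup>2 > 0" "n = k\<^sup>2 * (n div k\<^sup>2)" if "k\<^sup>2 dvd n" for k :: nat
    using that assms by (auto simp: div_greater_zero_iff dvd_imp_le k0)
  have bij: "bij_betw (\<lambda>(k, B). (int k, int (n div k\<^sup>2), B)) (SIGMA k:{k. k\<^sup>2 dvd n}. sqrt_residues (n div k\<^sup>2)) (ideals n)"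
  proof (rule bij_betw_byWitness[where f' = "\<lambda>(k, A, B). (nat k, B)"])
    show "(\<lambda>(k, B). (int k, int (n div k\<^sup>2), B)) ` (SIGMA k:{k. k\<^sup>2 dvd n}. sqrt_residues (n div k\<^sup>2)) \<subseteq> ideals n"
    proof safe
      fix k B assume kB: "k\<^sup>2 dvd n" "B \<in> sqrt_residues (n div k\<^sup>2)"
      have "(int k)\<^sup>2 * int (n div k\<^sup>2) = int n" using nk(2)[OF kB(1)] by (metis of_nat_mult of_nat_power)
      thus "(int k, int (n div k\<^sup>2), B) \<in> ideals n"
        using kB k0[OF kB(1)] nk(1)[OF kB(1)] by (auto simp: ideals_def primitive_forms_def sqrt_residues_def)
    qed
    have inv: "(nat k)\<^sup>2 dvd n \<and> n div (nat k)\<^sup>2 = nat A \<and> k > 0 \<and> A > 0 \<and> B \<in> sqrt_residues (nat A)"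
      if "(k, A, B) \<in> ideals n" for k A B
    proof -
      have h: "k > 0" "A > 0" "0 \<le> B" "B < A" "A dvd B\<^sup>2 - m" "k\<^sup>2 * A = int n"
        using that by (auto simp: ideals_def primitive_forms_def)
      have "int ((nat k)\<^sup>2 * nat A) = int n" using h by simp
      hence "n = (nat k)\<^sup>2 * nat A" by (simp only: of_nat_eq_iff)
      thus ?thesis using h by (simp add: sqrt_residues_def)
    qed
    show "(\<lambda>(k, A, B). (nat k, B)) ` ideals n \<subseteq> (SIGMA k:{k. k\<^sup>2 dvd n}. sqrt_residues (n div k\<^sup>2))"
      using inv by fastforce
    show "\<forall>a'\<in>ideals n. (\<lambda>(k, B). (int k, int (n div k\<^sup>2), B)) ((\<lambda>(k, A, B). (nat k, B)) a') = a'"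
      using inv by fastforce
  qed auto
  have finS: "finite (SIGMA k:{k. k\<^sup>2 dvd n}. sqrt_residues (n div k\<^sup>2))" using fin by simp
  show "finite (ideals n)" using bij_betw_finite[OF bij] finS by simp
  show "int (card (ideals n)) = ideal_count n"
    using bij_betw_same_card[OF bij] fin by (simp add: ideal_count_def card_SigmaI flip: of_nat_sum)
qed

text \<open>A nonzero vector \<open>v\<close> of the representing lattice \<open>L\<close> of a class gives the ideal \<open>v\<^sup>-\<^sup>1 L\<close>, which
  contains 1. Every ideal containing 1 arises from exactly one class and exactly two vectors \<open>v\<close>, \<open>-v\<close>.\<close>
lemma card_vectors:
  assumes n: "n > 0"
  shows "finite (vectors n)" "int (card (vectors n)) = 2 * ideal_count n"
proof -
  define L where "L = (\<lambda>c. lattice 1 (class_tau c))"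
  have frac: "fractional_ideal K (L c)" if "c \<in> ideal_classes" for c
    unfolding L_def using fractional_ideal_lattice_tau[OF class_form_pos[OF that]] .
  have vec_in: "class_vector c p \<in> L c" for c p
    unfolding L_def lattice_def by (rule CollectI, rule exI[of _ "fst p"], rule exI[of _ "snd p"]) simp
  have vec_K: "class_vector c p \<in> K" if "c \<in> ideal_classes" for c p
    using fractional_idealD(1)[OF frac[OF that]] vec_in by blast
  have vec_0: "class_vector c p \<noteq> 0" if "(c, p) \<in> vectors n" for c p
    using class_value_eq_norm[of c p] that n by (auto simp: vectors_def)
  define fiber where "fiber = (\<lambda>(k, A, B). {(c, p). (c, p) \<in> vectors n \<and> (*) (inverse (class_vector c p)) ` L c = ideal_of k A B})"
  have val: "class_value c p = k\<^sup>2 * A"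
    if "c \<in> ideal_classes" "A > 0" "k > 0" "class_vector c p \<noteq> 0"
      "(*) (inverse (class_vector c p)) ` L c = ideal_of k A B" for c p k A B
  proof -
    have "(norm (inverse (class_vector c p)))\<^sup>2 * of_int A = (norm (inverse (of_int k) :: complex))\<^sup>2 * of_int (fst (class_form c))"
      using norm_of_scaled_lattice[OF class_form_pos(1)[OF that(1)] that(2)] that(5) unfolding L_def ideal_of_def by blast
    hence "inverse ((norm (class_vector c p))\<^sup>2) * of_int A = inverse ((of_int k)\<^sup>2) * of_int (fst (class_form c))"
      by (simp only: norm_inverse power_inverse norm_of_int power2_abs)
    hence "of_int A * (of_int k)\<^sup>2 = of_int (fst (class_form c)) * (norm (class_vector c p))\<^sup>2"
      using that(3,4) by (simp add: field_simps del: of_int_power)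
    hence "real_of_int (class_value c p) = of_int (k\<^sup>2 * A)"
      unfolding class_value_eq_norm[OF that(1)] by (simp add: mult.commute)
    thus ?thesis by (simp only: of_int_eq_iff)
  qed
  have cover: "vectors n = (\<Union>q\<in>ideals n. fiber q)"
  proof
    show "vectors n \<subseteq> (\<Union>q\<in>ideals n. fiber q)"
    proof safe
      fix c p1 p2 assume w: "(c, p1, p2) \<in> vectors n"
      define p where "p = (p1, p2)"
      have w: "(c, p) \<in> vectors n" using w by (simp add: p_def)
      have c: "c \<in> ideal_classes" "class_value c p = int n" using w by (auto simp: vectors_def)
      define v where "v = class_vector c p"
      have v: "v \<noteq> 0" "v \<in> K" "v \<in> L c" using vec_0[OF w] vec_K[OF c(1)] vec_in unfolding v_def by auto
      have iv: "inverse v \<in> K" "inverse v \<noteq> 0" using v K_inverse by auto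
      have "1 \<in> (*) (inverse v) ` L c" using v by (intro image_eqI[of _ _ v]) auto
      then obtain k A B where kAB: "k > 0" "(A, B) \<in> primitive_forms" "(*) (inverse v) ` L c = ideal_of k A B"
        using fractional_ideal_containing_1[OF fractional_ideal_scale[OF frac[OF c(1)] iv]] by blast
      have "A > 0" using kAB(2) by (simp add: primitive_forms_def)
      hence "k\<^sup>2 * A = int n" using val[OF c(1) _ kAB(1), of A p B] v(1) kAB(3) c(2) unfolding v_def by simp
      hence "(k, A, B) \<in> ideals n" "(c, p) \<in> fiber (k, A, B)" using kAB w by (auto simp: ideals_def fiber_def v_def)
      thus "(c, p1, p2) \<in> (\<Union>q\<in>ideals n. fiber q)" unfolding p_def by blast
    qed
  qed (auto simp: fiber_def)
  have two: "card (fiber q) = 2" if q: "q \<in> ideals n" for q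
  proof -
    obtain k A B where kAB: "q = (k, A, B)" "k > 0" "(A, B) \<in> primitive_forms" "k\<^sup>2 * A = int n"
      using q by (auto simp: ideals_def)
    have A: "A > 0" "A dvd B\<^sup>2 - m" using kAB(3) by (auto simp: primitive_forms_def)
    have kK: "inverse (of_int k) \<in> K" "inverse (of_int k :: complex) \<noteq> 0"
      using kAB(2) inverse_of_int_in_K by auto
    have fI: "fractional_ideal K (ideal_of k A B)"
      unfolding ideal_of_def by (rule fractional_ideal_scale[OF fractional_ideal_lattice_tau[OF A] kK])
    have one: "1 \<in> ideal_of k A B"
    proof -
      have "of_int k * 1 = of_int k * 1 + of_int 0 * tau A B" by simp
      hence "of_int k * 1 \<in> lattice 1 (tau A B)" unfolding lattice_def by blast
      thus ?thesis using kAB(2) by (simp add: mem_ideal_of_iff)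
    qed
    \<comment> \<open>If \<open>L c = a I\<close> with \<open>I\<close> the given ideal, then \<open>a\<close> itself is the vector, as \<open>I\<close> contains 1.\<close>
    define c where "c = homothety_class (ideal_of k A B)"
    have c: "c \<in> ideal_classes" using fI by (auto simp: c_def ideal_classes_def)
    have "homothety_class (ideal_of k A B) = homothety_class (L c)"
      using class_form(2)[OF c] by (simp add: L_def c_def)
    then obtain a where a: "a \<in> K" "a \<noteq> 0" "L c = (*) a ` ideal_of k A B" by (rule homothety_class_eqD)
    have "a \<in> L c" using a(3) one by (auto intro!: image_eqI[of _ _ 1])
    then obtain x y where xy: "a = of_int x * 1 + of_int y * class_tau c" unfolding L_def lattice_def by blast
    define p where "p = (x, y)"
    have av: "a = class_vector c p" using xy by (simp add: p_def)
    have am: "- a = class_vector c (- x, - y)" using xy by simp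
    have La: "(*) (inverse a) ` L c = ideal_of k A B"
      using a(2) unfolding a(3) by (simp add: image_image mult.assoc[symmetric])
    have Lm: "(*) (inverse (- a)) ` L c = ideal_of k A B"
    proof -
      have "(*) (inverse (- a)) ` L c = (*) (inverse a) ` (uminus ` L c)" by (simp add: image_image)
      also have "uminus ` L c = L c"
      proof -
        have "uminus ` L c \<subseteq> L c" using fractional_idealD(5)[OF frac[OF c]] by blast
        moreover have "L c \<subseteq> uminus ` L c"
          using fractional_idealD(5)[OF frac[OF c]] by (metis image_eqI minus_minus subsetI)
        ultimately show ?thesis by blast
      qed
      finally show ?thesis using La by simp
    qed
    have "fiber q = {(c, p), (c, (- x, - y))}"
    proof
      have "class_value c p = int n"
        using val[OF c A(1) kAB(2), of p B] La a(2) kAB(4) unfolding av by simp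
      moreover have "class_value c (- x, - y) = int n"
      proof -
        have "class_vector c (- x, - y) \<noteq> 0" using a(2) am by (metis neg_equal_0_iff_equal)
        from val[OF c A(1) kAB(2) this Lm[unfolded am]] show ?thesis using kAB(4) by simp
      qed
      ultimately have "(c, p) \<in> vectors n" "(c, (- x, - y)) \<in> vectors n" using c by (simp_all add: vectors_def)
      thus "{(c, p), (c, (- x, - y))} \<subseteq> fiber q"
        unfolding fiber_def kAB(1) prod.case using La[unfolded av] Lm[unfolded am] by blast
      show "fiber q \<subseteq> {(c, p), (c, (- x, - y))}"
      proof (rule subsetI)
        fix cp assume cp: "cp \<in> fiber q"
        obtain c' p' where cp': "cp = (c', p')" by (cases cp)
        define v where "v = class_vector c' p'"
        have w: "(c', p') \<in> vectors n" "(*) (inverse v) ` L c' = ideal_of k A B"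
          using cp unfolding cp' fiber_def kAB(1) prod.case v_def by blast+
        have c': "c' \<in> ideal_classes" using w by (simp add: vectors_def)
        have v: "v \<noteq> 0" "v \<in> K" using vec_0[OF w(1)] vec_K[OF c'] by (auto simp: v_def)
        have "homothety_class (L c') = c"
          using homothety_class_eq[of "inverse v" "L c'"] v K_inverse w(2) by (simp add: c_def)
        moreover have "homothety_class (L c') = c'" using class_form(2)[OF c'] by (simp add: L_def)
        ultimately have cc: "c' = c" by simp
        have "(*) (v * inverse a) ` L c = (*) v ` ideal_of k A B"
          unfolding La[symmetric] by (simp add: image_image mult.assoc)
        also have "\<dots> = L c" unfolding w(2)[symmetric] cc using v(1) by (simp add: image_image mult.assoc[symmetric])
        finally have "(*) (v * inverse a) ` lattice 1 (class_tau c) = lattice 1 (class_tau c)" by (simp add: L_def)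
        hence "v * inverse a = 1 \<or> v * inverse a = -1"
          using lattice_multiplier_unit[of "fst (class_form c)" "snd (class_form c)"] class_form(1)[OF c] by simp
        hence "v = a \<or> v = - a" using a(2) by (auto simp: field_simps)
        hence "p' = p \<or> p' = (- x, - y)"
          using class_vector_inj[OF c, of p' p] class_vector_inj[OF c, of p' "(- x, - y)"] av am
          unfolding v_def cc by metis
        thus "cp \<in> {(c, p), (c, (- x, - y))}" using cc cp' by auto
      qed
    qed
    moreover have "p \<noteq> (- x, - y)"
    proof
      assume "p = (- x, - y)"
      hence "a = - a" using av am by metis
      hence "a + a = 0" using eq_neg_iff_add_eq_0 by blast
      thus False using a(2) by (simp flip: mult_2)
    qed
    ultimately show "card (fiber q) = 2" by simp
  qed
  have disj: "fiber q \<inter> fiber q' = {}" if "q \<in> ideals n" "q' \<in> ideals n" "q \<noteq> q'" for q q'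
  proof -
    obtain k A B k' A' B' where qq: "q = (k, A, B)" "q' = (k', A', B')" by (metis prod_cases3)
    show ?thesis
      using that ideal_of_inj[of k k' A B A' B'] unfolding qq fiber_def ideals_def by auto
  qed
  have fin: "finite (fiber q)" if "q \<in> ideals n" for q using two[OF that] card.infinite by fastforce
  show "finite (vectors n)" unfolding cover using card_ideals(1)[OF n] fin by blast
  have "card (vectors n) = (\<Sum>q\<in>ideals n. card (fiber q))"
    unfolding cover using card_ideals(1)[OF n] fin disj by (intro card_UN_disjoint) auto
  also have "\<dots> = 2 * card (ideals n)" using two by simp
  finally show "int (card (vectors n)) = 2 * ideal_count n" using card_ideals(2)[OF n] by simp
qed

lemma vectors_0: "vectors 0 = (\<lambda>c. (c, (0, 0))) ` ideal_classes"
proof -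
  have "class_value c p = 0 \<longleftrightarrow> p = (0, 0)" if c: "c \<in> ideal_classes" for c p
  proof -
    have "class_value c p = 0 \<longleftrightarrow> real_of_int (class_value c p) = 0" by simp
    also have "\<dots> \<longleftrightarrow> class_vector c p = 0"
      unfolding class_value_eq_norm[OF c] using class_form_pos[OF c] by simp
    also have "\<dots> \<longleftrightarrow> class_vector c p = class_vector c (0, 0)" by simp
    also have "\<dots> \<longleftrightarrow> p = (0, 0)" using class_vector_inj[OF c] by blast
    finally show ?thesis .
  qed
  thus ?thesis by (auto simp: vectors_def)
qed

section \<open>The class number formula\<close>

lemma chi_period: "chi (x + 4 * \<bar>m\<bar>) = chi x"
  using chi_half_period[of x] chi_half_period[of "x + 2 * \<bar>m\<bar>"] by (simp add: algebra_simps)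

abbreviation "modulus \<equiv> nat (4 * \<bar>m\<bar>)"

abbreviation "rchi \<equiv> \<lambda>n::nat. real_of_int (chi (int n))"

lemma rchi_period: "rchi (n + modulus) = rchi n"
  using chi_period[of "int n"] by simp

lemma rchi_sum_zero: "(\<Sum>k=1..modulus. rchi k) = 0"
proof -
  \<comment> \<open>The second half of the period cancels the first.\<close>
  define M where "M = nat (2 * \<bar>m\<bar>)"
  have N: "modulus = M + M" by (simp add: M_def nat_add_distrib[symmetric])
  have half: "rchi (k + M) = - rchi k" for k
    using chi_half_period[of "int k"] by (simp add: M_def)
  have "(\<Sum>k=1..n + M. rchi k) = (\<Sum>k=1..M. rchi k) - (\<Sum>k=1..n. rchi k)" for n
  proof (induction n)
    case (Suc n)
    have "(\<Sum>k=1..Suc n + M. rchi k) = (\<Sum>k=1..n + M. rchi k) + rchi (Suc n + M)" by simp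
    also have "rchi (Suc n + M) = - rchi (Suc n)" by (rule half)
    finally show ?case using Suc by simp
  qed simp
  from this[of M] show ?thesis by (simp add: N)
qed

definition theta :: "real \<Rightarrow> real" where
  "theta t = (\<Sum>c\<in>ideal_classes. infsum (\<lambda>p. exp (- t * of_int (class_value c p))) UNIV)"

definition divisor_series :: "real \<Rightarrow> real" where
  "divisor_series t = infsum (\<lambda>n. (\<Sum>d | d dvd n. rchi d) * exp (- t * real n)) {1..}"

lemma divisor_series:
  assumes "t > 0"
  shows "((\<lambda>n. (\<Sum>d | d dvd n. rchi d) * exp (- t * real n)) has_sum divisor_series t) {1..}"
proof -
  have "\<bar>rchi n\<bar> \<le> 1" for n using abs_chi_le_1[of "int n"] by linarith
  then obtain Z where "((\<lambda>n. (\<Sum>d | d dvd n. rchi d) * exp (-t) ^ n) has_sum Z) {1..}"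
    using lambert_series[of "exp (-t)" rchi 1] assms by auto
  hence "((\<lambda>n. (\<Sum>d | d dvd n. rchi d) * exp (- t * real n)) has_sum Z) {1..}"
    by (simp add: exp_of_nat_mult[symmetric] mult.commute)
  thus ?thesis unfolding divisor_series_def by (simp add: infsumI)
qed

text \<open>The vectors of all representing lattices are sorted by the value of the form.\<close>
lemma theta_eq:
  assumes t: "t > 0"
  shows "theta t = real (card ideal_classes) + 2 * divisor_series t"
proof -
  have cardn: "real (card (vectors n)) = 2 * (\<Sum>d | d dvd n. rchi d)" if "n \<ge> 1" for n
  proof -
    have "int (card (vectors n)) = 2 * divisor_chi n"
      using card_vectors(2)[of n] ideal_count_eq_divisor_chi[of n] that by simp
    hence "real_of_int (int (card (vectors n))) = real_of_int (2 * divisor_chi n)" by (simp only:)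
    thus ?thesis by (simp add: divisor_chi_def)
  qed
  have card0: "card (vectors 0) = card ideal_classes"
    unfolding vectors_0 by (rule card_image) (auto simp: inj_on_def)
  have finv: "finite (vectors n)" for n
    using card_vectors(1)[of n] finite_ideal_classes by (cases "n = 0") (auto simp: vectors_0)
  have outer: "((\<lambda>n. real (card (vectors n)) * exp (- t * real n)) has_sum (real (card ideal_classes) + 2 * divisor_series t)) UNIV"
  proof -
    have "((\<lambda>n. 2 * ((\<Sum>d | d dvd n. rchi d) * exp (- t * real n))) has_sum (2 * divisor_series t)) {1..}"
      by (rule has_sum_cmult_right[OF divisor_series[OF t]])
    hence "((\<lambda>n. real (card (vectors n)) * exp (- t * real n)) has_sum (2 * divisor_series t)) {1..}"
      by (rule has_sum_cong[THEN iffD1, rotated]) (simp add: cardn)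
    hence "((\<lambda>n. real (card (vectors n)) * exp (- t * real n)) has_sum
        (real (card (vectors 0)) * exp (- t * real 0) + 2 * divisor_series t)) (insert 0 {1..})"
      by (intro has_sum_insert) auto
    moreover have "insert 0 {1..} = (UNIV :: nat set)" by auto
    ultimately show ?thesis by (simp add: card0)
  qed
  have inner: "((\<lambda>w. exp (- t * real n)) has_sum (real (card (vectors n)) * exp (- t * real n))) (vectors n)" for n
    using finv[of n] by (intro has_sum_finiteI) auto
  have "(\<lambda>(n, w). exp (- t * real n)) summable_on (SIGMA n:UNIV. vectors n)"
    by (rule summable_on_SigmaI[OF _ has_sum_imp_summable[OF outer]]) (use inner in auto)
  hence "((\<lambda>(n, w). exp (- t * real n)) has_sum (real (card ideal_classes) + 2 * divisor_series t)) (SIGMA n:UNIV. vectors n)"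
    by (intro has_sum_SigmaI[OF _ outer]) (use inner in auto)
  moreover have "((\<lambda>(n, w). exp (- t * real n)) has_sum S) (SIGMA n:UNIV. vectors n) \<longleftrightarrow>
      ((\<lambda>(c, p). exp (- t * of_int (class_value c p))) has_sum S) (ideal_classes \<times> UNIV)" for S
    by (rule has_sum_reindex_bij_witness[of _ "\<lambda>(c, p). (nat (class_value c p), c, p)" snd])
       (auto simp: vectors_def class_value_nonneg)
  ultimately have W: "((\<lambda>(c, p). exp (- t * of_int (class_value c p))) has_sum
      (real (card ideal_classes) + 2 * divisor_series t)) (ideal_classes \<times> UNIV)" by blast
  have "((\<lambda>c. infsum (\<lambda>p. exp (- t * of_int (class_value c p))) UNIV) has_sum
      (real (card ideal_classes) + 2 * divisor_series t)) ideal_classes"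
  proof (rule has_sum_SigmaD[OF W])
    fix c assume c: "c \<in> ideal_classes"
    have "(\<lambda>p. exp (- t * of_int (class_value c p))) summable_on UNIV"
      by (rule summable_on_SigmaD1[OF has_sum_imp_summable[OF W] c])
    thus "((\<lambda>p. case (c, p) of (c, p) \<Rightarrow> exp (- t * of_int (class_value c p))) has_sum
        infsum (\<lambda>p. exp (- t * of_int (class_value c p))) UNIV) UNIV" by simp
  qed
  moreover have "((\<lambda>c. infsum (\<lambda>p. exp (- t * of_int (class_value c p))) UNIV) has_sum theta t) ideal_classes"
    unfolding theta_def using finite_ideal_classes by (intro has_sum_finiteI) auto
  ultimately show ?thesis using has_sum_unique by blast
qed

lemma theta_tendsto: "((\<lambda>t. 4 * theta (4 * t) - theta t) \<longlongrightarrow> 0) (at_right 0)"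
proof -
  have one: "((\<lambda>t::real. 4 * infsum (\<lambda>p. exp (- (4 * t) * of_int (class_value c p))) UNIV
      - infsum (\<lambda>p. exp (- t * of_int (class_value c p))) UNIV) \<longlongrightarrow> 0) (at_right 0)"
    if c: "c \<in> ideal_classes" for c
  proof -
    define A B where "A = fst (class_form c)" and "B = snd (class_form c)"
    have AB: "A > 0" "A dvd B\<^sup>2 - m" using class_form_pos[OF c] by (auto simp: A_def B_def)
    define C where "C = (B\<^sup>2 - m) div A"
    have "A * C = B\<^sup>2 - m" using AB by (simp add: C_def)
    hence "real_of_int A * of_int C - (of_int B)\<^sup>2 = of_int (- m)"
      by (metis add_diff_cancel_left' diff_diff_eq diff_minus_eq_add minus_diff_eq of_int_diff of_int_mult of_int_power uminus_add_conv_diff)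
    hence disc: "real_of_int A * of_int C - (of_int B)\<^sup>2 > 0" using m_less by simp
    have "exp (- t * of_int (class_value c p)) = theta_term (of_int A) (of_int B) (of_int C) t p" for t p
      by (simp add: theta_term_def form_value_def A_def[symmetric] B_def[symmetric] C_def[symmetric] case_prod_unfold)
    thus ?thesis using theta_no_constant_term[of "of_int A" "of_int C" "of_int B"] AB(1) disc by simp
  qed
  have "((\<lambda>t::real. \<Sum>c\<in>ideal_classes. 4 * infsum (\<lambda>p. exp (- (4 * t) * of_int (class_value c p))) UNIV
      - infsum (\<lambda>p. exp (- t * of_int (class_value c p))) UNIV) \<longlongrightarrow> (\<Sum>c\<in>ideal_classes. 0)) (at_right 0)"
    by (intro tendsto_sum one)
  thus ?thesis by (simp add: theta_def sum_subtractf sum_distrib_left)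
qed

text \<open>By \<open>theta_eq\<close>, \<open>4 \<Theta>(4 t) - \<Theta>(t)\<close> tends to \<open>3 h - 3 L\<close>, where \<open>L\<close> is the right-hand side; by
  \<open>theta_tendsto\<close> it tends to 0.\<close>
lemma class_number_mean:
  "real (card ideal_classes) = (\<Sum>n=1..modulus. \<Sum>k=1..n. rchi k) / real modulus"
proof -
  define L where "L = (\<Sum>n=1..modulus. \<Sum>k=1..n. rchi k) / real modulus"
  define h where "h = real (card ideal_classes)"
  define U where "U = (\<lambda>t. 2 * divisor_series (2 * t) - divisor_series t)"
  have "modulus > 0" using m_less by simp
  have U: "(U \<longlongrightarrow> - L / 2) (at_right 0)"
    unfolding U_def L_def
    by (rule lambert_constant_term[OF \<open>modulus > 0\<close> rchi_period rchi_sum_zero divisor_series])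
  have f2: "filterlim (\<lambda>t::real. 2 * t) (at_right 0) (at_right 0)"
    by (rule filterlim_at_withinI)
       (auto intro!: tendsto_eq_intros eventually_mono[OF eventually_at_right_less])
  have "((\<lambda>t. 3 * h + 2 * (2 * U (2 * t) + U t)) \<longlongrightarrow> 3 * h + 2 * (2 * (- L / 2) + (- L / 2))) (at_right 0)"
    by (intro tendsto_intros U filterlim_compose[OF U f2])
  moreover have "\<forall>\<^sub>F t in at_right 0. 3 * h + 2 * (2 * U (2 * t) + U t) = 4 * theta (4 * t) - theta t"
    using eventually_at_right_less
  proof eventually_elim
    case (elim t)
    hence "theta t = h + 2 * divisor_series t" "theta (4 * t) = h + 2 * divisor_series (4 * t)"
      by (simp_all add: theta_eq h_def)
    thus ?case by (simp add: U_def)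
  qed
  ultimately have "((\<lambda>t. 4 * theta (4 * t) - theta t) \<longlongrightarrow> 3 * h + 2 * (2 * (- L / 2) + (- L / 2))) (at_right 0)"
    by (rule Lim_transform_eventually)
  hence "3 * h + 2 * (2 * (- L / 2) + (- L / 2)) = 0"
    using theta_tendsto tendsto_unique trivial_limit_at_right_real by blast
  thus ?thesis by (simp add: h_def L_def)
qed

theorem class_number_formula:
  "(\<Sum>x\<in>{0..<4 * \<bar>m\<bar>}. x * chi x) = - (4 * \<bar>m\<bar>) * int (class_number K)"
proof -
  have N: "modulus > 0" using m_less by simp
  have "(\<Sum>k=1..modulus. rchi k * real k) = - (\<Sum>n=1..modulus. \<Sum>k=1..n. rchi k)"
    using abel_summation[of rchi real modulus] by (simp add: rchi_sum_zero[simplified] sum_negf)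
  also have "\<dots> = - (real modulus * real (card ideal_classes))"
    unfolding class_number_mean using N by simp
  finally have "real_of_int (\<Sum>k=1..modulus. chi (int k) * int k) = real_of_int (- (int modulus * int (card ideal_classes)))"
    by simp
  hence *: "(\<Sum>k=1..modulus. chi (int k) * int k) = - (int modulus * int (card ideal_classes))"
    by (simp only: of_int_eq_iff)
  have "chi 0 = 0" using chi_minus[of 0] by simp
  hence chiN: "chi (4 * \<bar>m\<bar>) = 0" using chi_period[of 0] by simp
  have "(\<Sum>k=1..modulus. chi (int k) * int k) = (\<Sum>x\<in>{1..4 * \<bar>m\<bar>}. x * chi x)"
    by (rule sum.reindex_bij_witness[of _ nat int]) (use m_less in auto)
  also have "\<dots> = (\<Sum>x\<in>{0..<4 * \<bar>m\<bar>}. x * chi x)"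
    by (rule sum.mono_neutral_cong) (use chiN \<open>chi 0 = 0\<close> in auto)
  finally show ?thesis using * m_less by (simp add: class_number_eq)
qed

end

section \<open>Character sums over thirds and quarters of the period\<close>

text \<open>The two conclusions are a linear system for the sums over \<open>0 < x < N/6\<close> and \<open>N/6 < x < N/4\<close>, where
  \<open>N = 4 M\<close>: the first is the sum up to \<open>N/4\<close>, the second twice the sum up to \<open>N/3\<close>.\<close>
lemma third_and_quarter_sums_of_character:
  fixes chi :: "int \<Rightarrow> int" and M h c :: int
  assumes M: "M > 1" "\<not> 3 dvd M"
    and half: "\<And>x. chi (x + 2 * M) = - chi x"
    and odd: "\<And>x. chi (- x) = - chi x"
    and chi_M: "chi M = 0"
    and three: "\<And>x. chi (3 * x) = c * chi x" and c: "c = 1 \<or> c = -1"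
    and h: "(\<Sum>x\<in>{0..<4 * M}. x * chi x) = - (4 * M) * h"
  shows "(\<Sum>x | 0 < x \<and> 6 * x < 4 * M. chi x) + (\<Sum>x | 4 * M < 6 * x \<and> x < M. chi x) = h"
    and "2 * ((\<Sum>x | 0 < x \<and> 6 * x < 4 * M. chi x) + 2 * (\<Sum>x | 4 * M < 6 * x \<and> x < M. chi x))
           = (3 - c) * h"
proof -
  define a where "a = (\<Sum>x | 0 < x \<and> 6 * x < 4 * M. chi x)"
  define b where "b = (\<Sum>x | 4 * M < 6 * x \<and> x < M. chi x)"
  define T where "T = (\<Sum>x\<in>{0..<4 * M}. x * chi x)"
  have per: "chi (x + 4 * M) = chi x" for x
    using half[of x] half[of "x + 2 * M"] by (simp add: algebra_simps)
  have per': "chi (x + 4 * M * k) = chi x" for x k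
  proof (induction k rule: int_induct[where k = 0])
    case (step1 i)
    then show ?case using per[of "x + 4 * M * i"] by (simp add: algebra_simps)
  next
    case (step2 i)
    then show ?case using per[of "x + 4 * M * (i - 1)"] by (simp add: algebra_simps)
  qed simp
  have chi0: "chi 0 = 0" using odd[of 0] by simp
  have chi2M: "chi (2 * M) = 0" using half[of 0] chi0 by simp
  have mirror: "chi (2 * M - x) = chi x" for x
    using half[of "-x"] odd[of x] by simp
  have refl4: "chi (4 * M - x) = - chi x" for x
    using per[of "-x"] odd[of x] by simp
  \<comment> \<open>The half-period relation turns the first moment into the sum over half a period.\<close>
  have "T = (\<Sum>x\<in>{0..<2 * M}. x * chi x) + (\<Sum>x\<in>{2 * M..<4 * M}. x * chi x)"
    unfolding T_def using M by (subst sum.union_disjoint[symmetric]) (auto intro!: sum.cong)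
  also have "(\<Sum>x\<in>{2 * M..<4 * M}. x * chi x) = (\<Sum>x\<in>{0..<2 * M}. (x + 2 * M) * chi (x + 2 * M))"
    by (rule sum.reindex_bij_witness[of _ "\<lambda>x. x + 2 * M" "\<lambda>x. x - 2 * M"]) auto
  also have "\<dots> = - (\<Sum>x\<in>{0..<2 * M}. x * chi x) - 2 * M * (\<Sum>x\<in>{0..<2 * M}. chi x)"
    by (unfold half, simp add: algebra_simps sum.distrib sum_distrib_left sum_negf sum_subtractf)
  finally have "2 * M * (\<Sum>x\<in>{0..<2 * M}. chi x) = 2 * M * (2 * h)"
    using h T_def by (simp add: algebra_simps)
  hence S2: "(\<Sum>x\<in>{0..<2 * M}. chi x) = 2 * h" using M by simp
  have "(\<Sum>x\<in>{0..<2 * M}. chi x) = (\<Sum>x\<in>{0<..<M} \<union> {M<..<2 * M} \<union> {0, M}. chi x)"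
    using M by (intro sum.cong) auto
  also have "\<dots> = (\<Sum>x\<in>{0<..<M}. chi x) + (\<Sum>x\<in>{M<..<2 * M}. chi x) + (\<Sum>x\<in>{0, M}. chi x)"
    using M by (subst sum.union_disjoint; (subst sum.union_disjoint)?) auto
  also have "(\<Sum>x\<in>{M<..<2 * M}. chi x) = (\<Sum>x\<in>{0<..<M}. chi x)"
    by (rule sum.reindex_bij_witness[of _ "\<lambda>x. 2 * M - x" "\<lambda>x. 2 * M - x"]) (auto simp: mirror)
  also have "(\<Sum>x\<in>{0, M}. chi x) = 0" using M chi0 chi_M by simp
  finally have S1: "(\<Sum>x\<in>{0<..<M}. chi x) = h" using S2 by simp
  have six: "6 * x \<noteq> 4 * M" for x using M(2) by presburger
  have fin: "finite {x. 0 < x \<and> 6 * x < 4 * M}" "finite {x. 4 * M < 6 * x \<and> x < M}"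
    by (rule finite_subset[of _ "{0..4*M}"]; use M in auto)+
  have "(\<Sum>x\<in>{0<..<M}. chi x) = (\<Sum>x\<in>{x. 0 < x \<and> 6 * x < 4 * M} \<union> {x. 4 * M < 6 * x \<and> x < M}. chi x)"
proof (rule arg_cong[where f = "sum chi"], rule Set.set_eqI)
    fix x show "x \<in> {0<..<M} \<longleftrightarrow> x \<in> {x. 0 < x \<and> 6 * x < 4 * M} \<union> {x. 4 * M < 6 * x \<and> x < M}"
      using six[of x] M by simp linarith
  qed
  also have "\<dots> = a + b"
    unfolding a_def b_def using fin by (subst sum.union_disjoint) auto
  finally have ab: "a + b = h" using S1 by simp

  \<comment> \<open>Multiplication by 3 permutes the residues; comparing first moments gives the sum up to N/3.\<close>
  define P where "P = (\<Sum>x | 0 < x \<and> 3 * x < 4 * M. chi x)"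
  have cop: "coprime 3 (4 * M)"
    using M(2) by (intro prime_imp_coprime) (auto simp: prime_dvd_mult_iff)
  have inj: "inj_on (\<lambda>x. (3 * x) mod (4 * M)) {0..<4 * M}"
  proof (rule inj_onI)
    fix x y assume xy: "x \<in> {0..<4 * M}" "y \<in> {0..<4 * M}" "(3 * x) mod (4 * M) = (3 * y) mod (4 * M)"
    hence "[3 * x = 3 * y] (mod (4 * M))" by (simp add: cong_def)
    hence "[x = y] (mod (4 * M))" using cop by (simp add: cong_mult_lcancel coprime_commute)
    thus "x = y" using xy by (simp add: cong_def)
  qed
  have "(\<lambda>x. (3 * x) mod (4 * M)) ` {0..<4 * M} = {0..<4 * M}"
    using M by (intro endo_inj_surj inj) auto
  hence bij: "bij_betw (\<lambda>x. (3 * x) mod (4 * M)) {0..<4 * M} {0..<4 * M}"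
    using inj by (simp add: bij_betw_def)
  define V where "V = (\<Sum>x\<in>{0..<4 * M}. ((3 * x) div (4 * M)) * chi x)"
  have "T = (\<Sum>x\<in>{0..<4 * M}. ((3 * x) mod (4 * M)) * chi ((3 * x) mod (4 * M)))"
    unfolding T_def by (rule sum.reindex_bij_betw[OF bij, symmetric])
  also have "\<dots> = (\<Sum>x\<in>{0..<4 * M}. (3 * x - 4 * M * ((3 * x) div (4 * M))) * (c * chi x))"
  proof (rule sum.cong[OF refl])
    fix x
    have e: "(3 * x) mod (4 * M) = 3 * x - 4 * M * ((3 * x) div (4 * M))"
      by (simp add: minus_mult_div_eq_mod)
    show "((3 * x) mod (4 * M)) * chi ((3 * x) mod (4 * M))
      = (3 * x - 4 * M * ((3 * x) div (4 * M))) * (c * chi x)"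
      using per'[of "3 * x" "- ((3 * x) div (4 * M))"] three[of x] by (simp add: e)
  qed
  also have "\<dots> = c * (3 * T - 4 * M * V)"
    by (simp add: T_def V_def algebra_simps sum_subtractf sum_distrib_left)
  finally have "4 * M * V = (3 - c) * T" using c by auto
  hence "4 * M * V = 4 * M * (- (3 - c) * h)" using h T_def by (simp add: algebra_simps)
  hence V: "V = - (3 - c) * h" using M by simp
  have thr: "3 * x \<noteq> 4 * M" "3 * x \<noteq> 8 * M" for x using M(2) by presburger+
  have dv: "(3 * x) div (4 * M) = (if 4 * M < 3 * x then 1 else 0) + (if 8 * M < 3 * x then 1 else 0)"
    if "x \<in> {0..<4 * M}" for x
  proof -
    consider "3 * x < 4 * M" | "4 * M < 3 * x" "3 * x < 8 * M" | "8 * M < 3 * x"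
      using thr[of x] by linarith
    thus ?thesis
    proof cases
      case 1 thus ?thesis using that M by (simp add: div_pos_pos_trivial)
    next
      case 2
      have "(3 * x) div (4 * M) = 1" using 2 M by (intro int_div_pos_eq[of _ _ _ "3*x - 4*M"]) auto
      thus ?thesis using 2 by simp
    next
      case 3
      have "(3 * x) div (4 * M) = 2" using 3 M that by (intro int_div_pos_eq[of _ _ _ "3*x - 8*M"]) auto
      thus ?thesis using 3 M by simp
    qed
  qed
  have "V = (\<Sum>x\<in>{0..<4 * M}. (if 4 * M < 3 * x then chi x else 0) + (if 8 * M < 3 * x then chi x else 0))"
    unfolding V_def by (intro sum.cong) (simp_all only: dv, auto)
  also have "\<dots> = (\<Sum>x\<in>{x\<in>{0..<4 * M}. 4 * M < 3 * x}. chi x) + (\<Sum>x\<in>{x\<in>{0..<4 * M}. 8 * M < 3 * x}. chi x)"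
    by (simp add: sum.distrib sum.If_cases Int_def)
  also have "(\<Sum>x\<in>{x\<in>{0..<4 * M}. 8 * M < 3 * x}. chi x) = - P"
    unfolding P_def sum_negf[symmetric]
    by (rule sum.reindex_bij_witness[of _ "\<lambda>x. 4 * M - x" "\<lambda>x. 4 * M - x"]) (use M in \<open>auto simp: refl4\<close>)
  also have "(\<Sum>x\<in>{x\<in>{0..<4 * M}. 4 * M < 3 * x}. chi x) = - P"
  proof -
    have "(\<Sum>x\<in>{0..<4*M}. chi x) = (\<Sum>x\<in>{0<..<4*M}. chi x)"
      using chi0 M by (intro sum.mono_neutral_right) (auto simp: order_le_less)
    moreover have "(\<Sum>x\<in>{0<..<4*M}. chi x) = (\<Sum>x\<in>{0<..<4*M}. - chi x)"
      by (rule sum.reindex_bij_witness[of _ "\<lambda>x. 4 * M - x" "\<lambda>x. 4 * M - x"]) (auto simp: refl4)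
    ultimately have z: "(\<Sum>x\<in>{0..<4*M}. chi x) = 0" unfolding sum_negf by linarith
    have "(\<Sum>x\<in>{0..<4*M}. chi x) = (\<Sum>x\<in>{x. 0 < x \<and> 3 * x < 4 * M} \<union> {0} \<union> {x\<in>{0..<4 * M}. 4 * M < 3 * x}. chi x)"
    proof (rule arg_cong[where f = "sum chi"], rule Set.set_eqI)
      fix x show "x \<in> {0..<4*M} \<longleftrightarrow> x \<in> {x. 0 < x \<and> 3 * x < 4 * M} \<union> {0} \<union> {x\<in>{0..<4 * M}. 4 * M < 3 * x}"
        using thr(1)[of x] M by simp linarith
    qed
    also have "\<dots> = P + (\<Sum>x\<in>{x\<in>{0..<4 * M}. 4 * M < 3 * x}. chi x)"
    proof -
      have "finite {x. 0 < x \<and> 3 * x < 4 * M}" "finite {x\<in>{0..<4 * M}. 4 * M < 3 * x}"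
        by (rule finite_subset[of _ "{0..4*M}"]; auto)+
      thus ?thesis unfolding P_def using M chi0
        by (subst sum.union_disjoint; (subst sum.union_disjoint)?) auto
    qed
    finally show ?thesis using z by simp
  qed
  finally have P: "2 * P = (3 - c) * h" using V by (simp add: algebra_simps)
  have fin2: "finite {x. 0 < x \<and> 3 * x < 4 * M}" "finite {x. M < x \<and> 3 * x < 4 * M}"
    by (rule finite_subset[of _ "{0..4*M}"]; use M in auto)+
  have "P = (\<Sum>x\<in>{x. 0 < x \<and> 6 * x < 4 * M} \<union> {x. 4 * M < 6 * x \<and> x < M} \<union> {M} \<union> {x. M < x \<and> 3 * x < 4 * M}. chi x)"
    unfolding P_def
  proof (rule arg_cong[where f = "sum chi"], rule Set.set_eqI)
    fix x show "x \<in> {x. 0 < x \<and> 3 * x < 4 * M} \<longleftrightarrow> x \<in> {x. 0 < x \<and> 6 * x < 4 * M} \<union> {x. 4 * M < 6 * x \<and> x < M} \<union> {M} \<union> {x. M < x \<and> 3 * x < 4 * M}"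
      using six[of x] M by simp linarith
  qed
  also have "\<dots> = a + b + chi M + (\<Sum>x | M < x \<and> 3 * x < 4 * M. chi x)"
    unfolding a_def b_def using fin fin2 M
    by (subst sum.union_disjoint; (subst sum.union_disjoint)?; (subst sum.union_disjoint)?) auto
  also have "(\<Sum>x | M < x \<and> 3 * x < 4 * M. chi x) = b"
    unfolding b_def
    by (rule sum.reindex_bij_witness[of _ "\<lambda>x. 2 * M - x" "\<lambda>x. 2 * M - x"]) (auto simp: mirror)
  finally have "P = a + 2 * b" using chi_M by simp
  with P ab show "a + b = h" "2 * (a + 2 * b) = (3 - c) * h" by auto
qed

theorem theorem5p2:
  fixes m D N :: int and chi :: "int \<Rightarrow> int" and h :: nat
  assumes "m < 0" and "squarefree m" and "m mod 4 = 2 \<or> m mod 4 = 3"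
    and "D = 4 * m" and "D < -4" and "\<not> 3 dvd D"
    and "N = \<bar>D\<bar>" and "chi = quad_char D" and "h = class_number (quad_field m)"
  shows
    "(D mod 3 = 1 \<longrightarrow>
        int h = (\<Sum>x | x \<in> {1..N} \<and> coprime x N \<and> real_of_int x < real_of_int N / 6. chi x) \<and>
        (\<Sum>x | x \<in> {1..N} \<and> coprime x N \<and>
             real_of_int N / 6 < real_of_int x \<and> real_of_int x < real_of_int N / 4. chi x) = 0) \<and>
     (D mod 3 = 2 \<longrightarrow>
        (\<Sum>x | x \<in> {1..N} \<and> coprime x N \<and> real_of_int x < real_of_int N / 6. chi x) = 0 \<and>
        int h = (\<Sum>x | x \<in> {1..N} \<and> coprime x N \<and>
             real_of_int N / 6 < real_of_int x \<and> real_of_int x < real_of_int N / 4. chi x))"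
proof -
  interpret Q: imag_quadratic m
    using assms(2-5) by unfold_locales auto
  define M where "M = \<bar>m\<bar>"
  have M: "M > 1" "N = 4 * M" using assms(4,5,7) by (auto simp: M_def)
  have chi: "chi = Q.chi" using assms(4,8) by (simp add: Q.chi_def)
  have m3: "\<not> 3 dvd m" using assms(4,6) by auto
  have M3: "\<not> 3 dvd M" using m3 by (simp add: M_def)
  have ncop: "chi x = 0" if "\<not> coprime x N" for x
    using that Q.chi_eq_0[of x] by (simp only: chi M M_def) blast
  have "\<not> coprime M N"
  proof
    assume "coprime M N"
    moreover have "M dvd N" by (simp add: M)
    ultimately have "is_unit M" by (meson coprime_common_divisor dvd_refl)
    thus False using M by simp
  qed
  hence chiM: "chi M = 0" by (rule ncop)
  define c where "c = Q.chi 3"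
  have c: "c = (if m mod 3 = 1 then 1 else -1)" using Q.chi_3[OF m3] by (simp add: c_def)
  have res: "m mod 3 = D mod 3" using assms(4) by presburger
  define a where "a = (\<Sum>x | 0 < x \<and> 6 * x < 4 * M. chi x)"
  define b where "b = (\<Sum>x | 4 * M < 6 * x \<and> x < M. chi x)"
  have ab: "a + b = int h" "2 * (a + 2 * b) = (3 - c) * int h"
    unfolding a_def b_def
    by (rule third_and_quarter_sums_of_character[of M chi c];
        use M M3 chiM c Q.chi_half_period Q.chi_minus Q.chi_mult[of 3] Q.class_number_formula assms(9)
        in \<open>simp add: chi c_def M_def\<close>)+
  have suma: "(\<Sum>x | x \<in> {1..N} \<and> coprime x N \<and> real_of_int x < real_of_int N / 6. chi x) = a"
    unfolding a_def
  proof (rule sum.mono_neutral_left)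
    show "finite {x. 0 < x \<and> 6 * x < 4 * M}" by (rule finite_subset[of _ "{0..4 * M}"]) auto
    show "{x. x \<in> {1..N} \<and> coprime x N \<and> real_of_int x < real_of_int N / 6} \<subseteq> {x. 0 < x \<and> 6 * x < 4 * M}"
      using M by auto
    show "\<forall>x\<in>{x. 0 < x \<and> 6 * x < 4 * M} - {x. x \<in> {1..N} \<and> coprime x N \<and> real_of_int x < real_of_int N / 6}. chi x = 0"
    proof
      fix x assume x: "x \<in> {x. 0 < x \<and> 6 * x < 4 * M} - {x. x \<in> {1..N} \<and> coprime x N \<and> real_of_int x < real_of_int N / 6}"
      hence "x \<in> {1..N}" "real_of_int x < real_of_int N / 6" using M by auto
      hence "\<not> coprime x N" using x by blast
      thus "chi x = 0" by (rule ncop)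
    qed
  qed
  have sumb: "(\<Sum>x | x \<in> {1..N} \<and> coprime x N \<and>
             real_of_int N / 6 < real_of_int x \<and> real_of_int x < real_of_int N / 4. chi x) = b"
    unfolding b_def
  proof (rule sum.mono_neutral_left)
    show "finite {x. 4 * M < 6 * x \<and> x < M}" by (rule finite_subset[of _ "{0..4 * M}"]) (use M in auto)
    show "{x. x \<in> {1..N} \<and> coprime x N \<and> real_of_int N / 6 < real_of_int x \<and> real_of_int x < real_of_int N / 4}
      \<subseteq> {x. 4 * M < 6 * x \<and> x < M}"
      using M by auto
    show "\<forall>x\<in>{x. 4 * M < 6 * x \<and> x < M} - {x. x \<in> {1..N} \<and> coprime x N \<and>
             real_of_int N / 6 < real_of_int x \<and> real_of_int x < real_of_int N / 4}. chi x = 0"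
    proof
      fix x assume x: "x \<in> {x. 4 * M < 6 * x \<and> x < M} - {x. x \<in> {1..N} \<and> coprime x N \<and>
             real_of_int N / 6 < real_of_int x \<and> real_of_int x < real_of_int N / 4}"
      hence "x \<in> {1..N}" "real_of_int N / 6 < real_of_int x" "real_of_int x < real_of_int N / 4" using M by auto
      hence "\<not> coprime x N" using x by blast
      thus "chi x = 0" by (rule ncop)
    qed
  qed
  show ?thesis unfolding suma sumb using ab c unfolding res by auto
qed

end
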